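(* Let $T$ denote a proper homaloidal type of degree $d\geq 4$ and highest virtual multiplicity $d-2$. Then $T=(d;d-2,2^{d-2},1^{3})$. Moreover, given a plane Cremona map $F$ of degree $d\geq 4$ with this homaloidal type and with proper base points, $R/I$ is Cohen–Macaulay, where $I\subset R=k[x,y,z]$ is the base ideal of $F$.
   Context: $k$ is an algebraically closed field and $R=k[x,y,z]$ has the standard grading. A plane Cremona map of degree $d$ is a birational map $\mathbb{P}^2\dashrightarrow\mathbb{P}^2$ defined by three $k$-linearly independent forms of degree $d$ without common factor; these span its linear system $L_d\subset R_d$, and its base ideal is $I=(L_d)$. The virtual multiplicity of a proper base point $p\in V(I)\subset\mathbb{P}^2$ is the minimum of the multiplicities at $p$ of members of $L_d$ (similarly for infinitely near base points after blowing up). "With proper base points" means that all base points lie in $\mathbb{P}^2$ (none infinitely near). A homaloidal type of degree $d$ is a tuple of integers $(d;\mu_1,\ldots,\mu_r)$ satisfying the equations of condition $\sum\mu_i=3d-3$ and $\sum\mu_i^2=d^2-1$ (zero multiplicities are suppressed, order is irrelevant, exponents denote repetition). The type of a plane Cremona map is given by its degree and the virtual multiplicities at all its base points (proper and infinitely near). A homaloidal type is proper if there exists a plane Cremona map with this type. *)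

theory Defs
  imports "HOL-Algebra.Algebraic_Closure_Type" "HOL-Library.Multiset" "HOL-Library.Extended_Nat"
begin

section \<open>The polynomial rings $k[x,y,z]$ and $k[u,v]$\<close>

text \<open>
  Polynomial rings are iterated univariate ones: in \<open>'a poly poly poly\<close> the innermost variable
  is $x$ and the outermost is $z$, so that the coefficient of $x^i y^j z^l$ in \<open>f\<close> is
  \<open>coeff (coeff (coeff f l) j) i\<close>.  In \<open>'a poly poly\<close> the inner variable is $u$, the outer $v$.
\<close>

type_synonym 'a poly3 = "'a poly poly poly"
type_synonym 'a poly2 = "'a poly poly"

definition const3 :: "'a::comm_ring_1 \<Rightarrow> 'a poly3" where
  "const3 c = [:[:[:c:]:]:]"

definition const2 :: "'a::comm_ring_1 \<Rightarrow> 'a poly2" where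
  "const2 c = [:[:c:]:]"

definition X3 :: "'a::comm_ring_1 poly3" where "X3 = [:[:[:0, 1:]:]:]"
definition Y3 :: "'a::comm_ring_1 poly3" where "Y3 = [:[:0, 1:]:]"
definition Z3 :: "'a::comm_ring_1 poly3" where "Z3 = [:0, 1:]"

definition U2 :: "'a::comm_ring_1 poly2" where "U2 = [:[:0, 1:]:]"
definition V2 :: "'a::comm_ring_1 poly2" where "V2 = [:0, 1:]"

text \<open>
  Substitution of elements of a commutative algebra for the variables; the first argument is the
  structure map of the algebra.
\<close>

definition subst2 ::
  "('a::comm_ring_1 \<Rightarrow> 'b::comm_ring_1) \<Rightarrow> 'a poly2 \<Rightarrow> 'b \<Rightarrow> 'b \<Rightarrow> 'b" where
  "subst2 \<phi> f a b = poly (map_poly (\<lambda>g. poly (map_poly \<phi> g) a) f) b"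

definition subst3 ::
  "('a::comm_ring_1 \<Rightarrow> 'b::comm_ring_1) \<Rightarrow> 'a poly3 \<Rightarrow> 'b \<Rightarrow> 'b \<Rightarrow> 'b \<Rightarrow> 'b" where
  "subst3 \<phi> f a b c = poly (map_poly (\<lambda>g. subst2 \<phi> g a b) f) c"

text \<open>The zero polynomial is a form of every degree.\<close>

definition is_form :: "nat \<Rightarrow> 'a::comm_ring_1 poly3 \<Rightarrow> bool" where
  "is_form d f \<longleftrightarrow> (\<forall>i j l. coeff (coeff (coeff f l) j) i \<noteq> 0 \<longrightarrow> i + j + l = d)"


section \<open>Plane Cremona maps\<close>

type_synonym 'a triple = "'a poly3 \<times> 'a poly3 \<times> 'a poly3"

fun forms_triple :: "nat \<Rightarrow> 'a::field triple \<Rightarrow> bool" where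
  "forms_triple d (f, g, h) \<longleftrightarrow> is_form d f \<and> is_form d g \<and> is_form d h"

fun lin_indep :: "'a::field triple \<Rightarrow> bool" where
  "lin_indep (f, g, h) \<longleftrightarrow>
     (\<forall>a b c. const3 a * f + const3 b * g + const3 c * h = 0 \<longrightarrow> a = 0 \<and> b = 0 \<and> c = 0)"

fun no_common_factor :: "'a::field triple \<Rightarrow> bool" where
  "no_common_factor (f, g, h) \<longleftrightarrow> (\<forall>q. q dvd f \<and> q dvd g \<and> q dvd h \<longrightarrow> q dvd 1)"

fun comp_triple :: "'a::field triple \<Rightarrow> 'a triple \<Rightarrow> 'a triple" where
  "comp_triple (g0, g1, g2) (f0, f1, f2) =
     (subst3 const3 g0 f0 f1 f2, subst3 const3 g1 f0 f1 f2, subst3 const3 g2 f0 f1 f2)"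

text \<open>
  A triple of forms represents the identity of the projective plane as a rational map iff it is a
  nonzero polynomial multiple of $(x,y,z)$.
\<close>

definition represents_identity :: "'a::field triple \<Rightarrow> bool" where
  "represents_identity F \<longleftrightarrow> (\<exists>h. h \<noteq> 0 \<and> F = (h * X3, h * Y3, h * Z3))"

definition birational :: "'a::field triple \<Rightarrow> bool" where
  "birational F \<longleftrightarrow> (\<exists>e G. forms_triple e G \<and>
     represents_identity (comp_triple G F) \<and> represents_identity (comp_triple F G))"

definition cremona_map :: "nat \<Rightarrow> 'a::field triple \<Rightarrow> bool" where
  "cremona_map d F \<longleftrightarrow>
     forms_triple d F \<and> lin_indep F \<and> no_common_factor F \<and> birational F"

fun linear_system :: "'a::field triple \<Rightarrow> 'a poly3 set" where
  "linear_system (f, g, h) = {const3 a * f + const3 b * g + const3 c * h | a b c. True}"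

abbreviation poly3_ring :: "'a::field poly3 ring" where
  "poly3_ring \<equiv> ring_of_type_algebra"

definition base_ideal :: "'a::field triple \<Rightarrow> 'a poly3 set" where
  "base_ideal F = Idl\<^bsub>poly3_ring\<^esub> (linear_system F)"


section \<open>Proper and infinitely near points, virtual multiplicities\<close>

text \<open>
  Every point of the projective plane has exactly one representative whose first nonzero
  coordinate is 1; the plane is identified with the set of these representatives.
\<close>

definition proj_plane :: "('a::field \<times> 'a \<times> 'a) set" where
  "proj_plane = {(1, b, c) | b c. True} \<union> {(0, 1, c) | c. True} \<union> {(0, 0, 1)}"

text \<open>
  The equation of a plane curve in the affine coordinates $(u,v)$ centred at a point of
  \<open>proj_plane\<close>: the coordinate normalised to 1 is kept equal to 1.
\<close>

fun local_equation :: "'a::field \<times> 'a \<times> 'a \<Rightarrow> 'a poly3 \<Rightarrow> 'a poly2" where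
  "local_equation (a, b, c) f =
     (if a \<noteq> 0 then subst3 const2 f 1 (const2 b + U2) (const2 c + V2)
      else if b \<noteq> 0 then subst3 const2 f U2 1 (const2 c + V2)
      else subst3 const2 f U2 V2 1)"

text \<open>Multiplicity at the origin; only meaningful for nonzero polynomials.\<close>

definition mult_origin :: "'a::field poly2 \<Rightarrow> nat" where
  "mult_origin g = (LEAST m. \<exists>i j. coeff (coeff g j) i \<noteq> 0 \<and> i + j = m)"

definition virt_mult_origin :: "'a::field poly2 set \<Rightarrow> nat" where
  "virt_mult_origin \<Lambda> = (LEAST m. \<exists>g\<in>\<Lambda>. g \<noteq> 0 \<and> mult_origin g = m)"

text \<open>
  The points of the exceptional curve of the blowing up of the $(u,v)$-plane at the origin are the
  tangent directions there: \<open>Some c\<close> stands for the direction of the line $v = cu$, and \<open>None\<close> for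
  that of $u = 0$.  Each of them is the origin of an affine chart $(u',v')$, in which the blowing
  up is $(u,v) = (u', u'(v'+c))$ with exceptional curve $u' = 0$, respectively $(u,v) = (u'v', v')$
  with exceptional curve $v' = 0$.
\<close>

fun chart_pullback :: "'a::field option \<Rightarrow> 'a poly2 \<Rightarrow> 'a poly2" where
  "chart_pullback (Some c) g = subst2 const2 g U2 (U2 * (V2 + const2 c))"
| "chart_pullback None g = subst2 const2 g (U2 * V2) V2"

fun exceptional :: "'a::field option \<Rightarrow> 'a poly2" where
  "exceptional (Some c) = U2"
| "exceptional None = V2"

text \<open>
  The transform of a linear system after blowing up the origin: the pullbacks of all its members
  are divided by the equation of the exceptional curve to the power of the virtual multiplicity.
\<close>

definition blowup_system :: "'a::field option \<Rightarrow> 'a poly2 set \<Rightarrow> 'a poly2 set" where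
  "blowup_system t \<Lambda> =
     {g'. \<exists>g\<in>\<Lambda>. chart_pullback t g = exceptional t ^ virt_mult_origin \<Lambda> * g'}"

text \<open>
  A point that is proper or infinitely near is a pair \<open>(p, ts)\<close>: start at the proper point \<open>p\<close>
  and successively blow up the current point and pass to the point \<open>t\<close> of the new exceptional
  curve, for each \<open>t\<close> in the list \<open>ts\<close>.  The proper points are those with \<open>ts = []\<close>.
  If the virtual multiplicity at a point is zero, it is zero at all points infinitely near to it,
  so base points are infinitely near only to base points.
\<close>

type_synonym 'a bubble_point = "('a \<times> 'a \<times> 'a) \<times> 'a option list"

fun system_at :: "'a::field triple \<Rightarrow> 'a bubble_point \<Rightarrow> 'a poly2 set" where
  "system_at F (p, ts) = fold blowup_system ts (local_equation p ` linear_system F)"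

definition virt_mult :: "'a::field triple \<Rightarrow> 'a bubble_point \<Rightarrow> nat" where
  "virt_mult F q = virt_mult_origin (system_at F q)"

definition base_points :: "'a::field triple \<Rightarrow> 'a bubble_point set" where
  "base_points F = {(p, ts). p \<in> proj_plane \<and> virt_mult F (p, ts) > 0}"

definition has_proper_base_points :: "'a::field triple \<Rightarrow> bool" where
  "has_proper_base_points F \<longleftrightarrow> (\<forall>(p, ts) \<in> base_points F. ts = [])"


section \<open>Homaloidal types\<close>

text \<open>
  A tuple $(d;\mu_1,\ldots,\mu_r)$ up to order is a pair of its degree and a multiset of
  multiplicities, in which zero multiplicities do not occur because they are suppressed.
\<close>

type_synonym htype = "nat \<times> int multiset"

fun homaloidal_type :: "htype \<Rightarrow> bool" where
  "homaloidal_type (d, M) \<longleftrightarrow> 0 \<notin># M \<and>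
     (\<Sum>\<mu>\<in>#M. \<mu>) = 3 * int d - 3 \<and> (\<Sum>\<mu>\<in>#M. \<mu>\<^sup>2) = (int d)\<^sup>2 - 1"

text \<open>
  The set of base points is finite for forms without common factor, so \<open>mset_set\<close> lists each base
  point once.
\<close>

definition has_type :: "'a::field triple \<Rightarrow> htype \<Rightarrow> bool" where
  "has_type F T \<longleftrightarrow> (\<exists>d. cremona_map d F \<and>
     T = (d, image_mset (\<lambda>q. int (virt_mult F q)) (mset_set (base_points F))))"

text \<open>Properness refers to Cremona maps over a given field, which is passed as a type.\<close>

definition proper_homaloidal_type :: "'a::field itself \<Rightarrow> htype \<Rightarrow> bool" where
  "proper_homaloidal_type k T \<longleftrightarrow> homaloidal_type T \<and> (\<exists>F::'a triple. has_type F T)"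


section \<open>Cohen--Macaulay rings\<close>

definition regular_sequence :: "('a, 'b) ring_scheme \<Rightarrow> 'a list \<Rightarrow> bool" where
  "regular_sequence R xs \<longleftrightarrow> set xs \<subseteq> carrier R \<and> Idl\<^bsub>R\<^esub> (set xs) \<noteq> carrier R \<and>
     (\<forall>i < length xs. \<forall>y \<in> carrier R.
        xs ! i \<otimes>\<^bsub>R\<^esub> y \<in> Idl\<^bsub>R\<^esub> (set (take i xs)) \<longrightarrow> y \<in> Idl\<^bsub>R\<^esub> (set (take i xs)))"

definition ideal_depth :: "('a, 'b) ring_scheme \<Rightarrow> 'a set \<Rightarrow> enat" where
  "ideal_depth R P = Sup {enat (length xs) | xs. regular_sequence R xs \<and> set xs \<subseteq> P}"

definition prime_height :: "('a, 'b) ring_scheme \<Rightarrow> 'a set \<Rightarrow> enat" where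
  "prime_height R P = Sup {enat (length Qs - 1) | Qs. Qs \<noteq> [] \<and> last Qs = P \<and>
     (\<forall>Q \<in> set Qs. primeideal Q R) \<and> sorted_wrt (\<subset>) Qs}"

text \<open>
  The definition of Eisenbud (Commutative Algebra, Section 18.2): a Noetherian ring is
  Cohen--Macaulay if the depth of every maximal ideal $P$ equals its codimension.  These two
  numbers are the depth and the Krull dimension of the localisation at $P$.
\<close>

definition cohen_macaulay :: "('a, 'b) ring_scheme \<Rightarrow> bool" where
  "cohen_macaulay R \<longleftrightarrow> cring R \<and> noetherian_ring R \<and>
     (\<forall>P. maximalideal P R \<longrightarrow> ideal_depth R P = prime_height R P)"

end

theory Submission
  imports Defs
begin

text \<open>
  Let \<open>p\<close> be a point of multiplicity \<open>d - 2\<close>, and choose coordinates with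
  \<open>p = (0 : 0 : 1)\<close>. Then the members of the linear system are quadratic polynomials
  \<open>a z\<^sup>2 + b z + c\<close> in \<open>z\<close> whose coefficients are forms of degrees \<open>d - 2\<close>, \<open>d - 1\<close> and \<open>d\<close> in \<open>x, y\<close>.

  As to the type, multiplicities do not increase along infinitely near points, so the highest one occurs
  at a proper point \<open>p\<close>. Restricted to a line through \<open>p\<close>, a member has degree at most two in the parameter
  \<open>z\<close>. If another base point, proper or in the first neighbourhood of \<open>p\<close>, had multiplicity three or
  more, the line through \<open>p\<close> and that point would be a common factor of the linear system
  (\<open>virt_mult_other_points_le_2\<close>). So the remaining multiplicities are ones and twos, and the equations
  of condition determine how many there are.

  As to the base ideal, let \<open>D\<close> be the determinant of the coefficients of \<open>z\<^sup>2, z, 1\<close> in the three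
  generators.
  It is not zero, since otherwise the map would have degree two on a general line through \<open>p\<close>
  (\<open>D_nonzero\<close>). A double point forces \<open>D\<close> to be divisible by the third power of the equation of the
  line that joins it to \<open>p\<close>, and a simple point by the first power. These are
  \<open>3 (d - 2) + 3 = 3 d - 3\<close> linear factors, and \<open>3 d - 3\<close> is the degree of \<open>D\<close>. Hence \<open>D\<close> is their
  product up to a constant (\<open>D_eq\<close>). The same divisibility holds for the numerators in Cramer's rule, when
  one generator is replaced by any polynomial of degree at most two in \<open>z\<close> that has the prescribed
  multiplicities at the double and simple points. So every such polynomial is a combination of the
  generators with coefficients in \<open>k[x,y]\<close> (\<open>admissible_in_Ig\<close>).

  This gives saturation directly. Let \<open>w\<close> be a linear form that is monic in \<open>z\<close> and does not vanish at
  the base points. If \<open>w r\<close> lies in the base ideal, then division of the coefficients by \<open>w\<close> reduces to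
  the case where \<open>w r\<close> has degree at most two in \<open>z\<close> and \<open>r\<close> has degree at most one. Then \<open>r\<close> satisfies
  the same conditions as \<open>w r\<close> at the base points, so it lies in the ideal. The argument also applies to
  \<open>w - a\<close> for every constant \<open>a\<close> (\<open>linear_nonzerodivisor\<close>).

  On the other hand the base ideal contains \<open>D\<close>, so a prime over it contains the equation of one of the
  lines and a linear factor of a generator on that line. The zero set in affine three-space is therefore a
  finite union of lines (\<open>curve_over_Ig\<close>). Chains of primes over the ideal have at most two members, and
  every maximal ideal over it contains some \<open>w - a\<close>, a nonzerodivisor. So depth and height of all maximal
  ideals of the quotient are one (\<open>cohen_macaulay_quotient\<close>).
\<close>


section \<open>Cohen--Macaulay rings of dimension one\<close>

text \<open>
  The elements \<open>s x\<^sup>n\<close> with \<open>s\<close> outside \<open>P\<close> form a multiplicatively closed set. It does not meet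
  \<open>J\<close>, because \<open>x\<close> can be cancelled modulo \<open>J\<close>, and an ideal that is maximal among the ideals
  containing \<open>J\<close> and avoiding this set is prime. This is the step by which a regular sequence
  produces a chain of primes.
\<close>

lemma (in cring) prime_below_excluding_nonzerodivisor:
  assumes noeth: "noetherian_ring R" and J: "ideal J R" and P: "primeideal P R" and JP: "J \<subseteq> P"
    and x: "x \<in> P" and nzd: "\<And>y. y \<in> carrier R \<Longrightarrow> x \<otimes> y \<in> J \<Longrightarrow> y \<in> J"
  shows "\<exists>Q. primeideal Q R \<and> J \<subseteq> Q \<and> Q \<subset> P \<and> x \<notin> Q"
proof -
  interpret P: primeideal P R by (rule P)
  have xc: "x \<in> carrier R" using x P.Icarr by blast
  define T where "T = {s \<otimes> x [^] n | s n. s \<in> carrier R - P \<and> (n::nat) \<in> UNIV}"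
  define C where "C = {K. ideal K R \<and> J \<subseteq> K \<and> K \<inter> T = {}}"
  have powJ: "y \<in> J" if "y \<in> carrier R" "y \<otimes> x [^] n \<in> J" for y and n :: nat
    using that(2)
  proof (induction n)
    case 0 then show ?case using that(1) by simp
  next
    case (Suc n)
    have "x \<otimes> (y \<otimes> x [^] n) = y \<otimes> x [^] Suc n"
      using that(1) xc by (simp add: m_ac)
    with Suc.prems have "y \<otimes> x [^] n \<in> J" using nzd[of "y \<otimes> x [^] n"] that(1) xc by simp
    then show ?case by (rule Suc.IH)
  qed
  have "J \<in> C" unfolding C_def T_def using J powJ JP by auto
  have "\<exists>M\<in>C. \<forall>K\<in>C. M \<subseteq> K \<longrightarrow> K = M"
  proof (rule subset_Zorn_nonempty)
    show "C \<noteq> {}" using \<open>J \<in> C\<close> by blast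
    fix D assume D: "D \<noteq> {}" "subset.chain C D"
    have "subset.chain {I. ideal I R} D"
      using D(2) unfolding subset_chain_def C_def by blast
    then have "\<Union>D \<in> D" using noetherian_ring.ideal_chain_is_trivial[OF noeth D(1)] by blast
    then show "\<Union>D \<in> C" using D(2) unfolding subset_chain_def by blast
  qed
  then obtain Q where QC: "Q \<in> C" and Qm: "\<forall>K\<in>C. Q \<subseteq> K \<longrightarrow> K = Q" by (rule bexE)
  have Q: "ideal Q R" "J \<subseteq> Q" "Q \<inter> T = {}" using QC unfolding C_def by simp_all
  have Qmax: "K = Q" if "ideal K R" "Q \<subseteq> K" "K \<inter> T = {}" for K
  proof -
    have "K \<in> C" unfolding C_def using that Q(2) by simp
    then show ?thesis using Qm that(2) by simp
  qed
  interpret Q: ideal Q R by (rule Q(1))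
  have one_T: "s \<in> T" if "s \<in> carrier R - P" for s
    unfolding T_def using that by (auto intro!: exI[of _ s] exI[of _ "0::nat"])
  have one_nP: "\<one> \<notin> P" using P.I_notcarr P.one_imp_carrier by blast
  have xT: "x \<in> T"
    unfolding T_def using xc one_nP by (auto intro!: exI[of _ "\<one>"] exI[of _ "1::nat"])
  have QP: "Q \<subseteq> P" using Q(3) one_T Q.Icarr by blast
  have T_mult: "s \<otimes> t \<in> T" if st: "s \<in> T" "t \<in> T" for s t
  proof -
    obtain s' n where s: "s = s' \<otimes> x [^] (n::nat)" "s' \<in> carrier R" "s' \<notin> P" using st(1) T_def by auto
    obtain t' m where t: "t = t' \<otimes> x [^] (m::nat)" "t' \<in> carrier R" "t' \<notin> P" using st(2) T_def by auto
    have "s' \<otimes> t' \<notin> P" using s t P.I_prime by blast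
    moreover have "s \<otimes> t = (s' \<otimes> t') \<otimes> x [^] (n + m)"
      using s t xc by (simp add: m_ac nat_pow_mult[symmetric])
    ultimately show ?thesis unfolding T_def using s t by auto
  qed
  have T_carr: "T \<subseteq> carrier R" unfolding T_def using xc by auto
  have meet: "\<exists>q\<in>Q. \<exists>r\<in>carrier R. q \<oplus> r \<otimes> a \<in> T" if a: "a \<in> carrier R" "a \<notin> Q" for a
  proof (rule ccontr)
    assume neg: "\<not> ?thesis"
    have id: "ideal (Q <+>\<^bsub>R\<^esub> PIdl a) R" using add_ideals Q(1) cgenideal_ideal a by blast
    have els: "Q <+>\<^bsub>R\<^esub> PIdl a = {q \<oplus> r \<otimes> a | q r. q \<in> Q \<and> r \<in> carrier R}"
      unfolding set_add_def' cgenideal_def by blast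
    have "Q \<subseteq> Q <+>\<^bsub>R\<^esub> PIdl a"
    proof
      fix q assume q: "q \<in> Q"
      have "q = q \<oplus> \<zero> \<otimes> a" using q Q.Icarr a by simp
      then show "q \<in> Q <+>\<^bsub>R\<^esub> PIdl a" unfolding els using q by blast
    qed
    moreover have "(Q <+>\<^bsub>R\<^esub> PIdl a) \<inter> T = {}" unfolding els using neg by blast
    ultimately have "Q <+>\<^bsub>R\<^esub> PIdl a = Q" using Qmax[OF id] by blast
    moreover have "a = \<zero> \<oplus> \<one> \<otimes> a" using a by simp
    then have "a \<in> Q <+>\<^bsub>R\<^esub> PIdl a" unfolding els using Q.zero_closed by blast
    ultimately show False using a by blast
  qed
  have "primeideal Q R"
  proof (rule primeidealI[OF Q(1) is_cring])
    show "carrier R \<noteq> Q" using QP one_nP one_closed by blast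
    fix a b assume ab: "a \<in> carrier R" "b \<in> carrier R" "a \<otimes> b \<in> Q"
    show "a \<in> Q \<or> b \<in> Q"
    proof (rule ccontr)
      assume "\<not> ?thesis"
      then obtain q r q' r' where h: "q \<in> Q" "r \<in> carrier R" "q \<oplus> r \<otimes> a \<in> T"
         "q' \<in> Q" "r' \<in> carrier R" "q' \<oplus> r' \<otimes> b \<in> T" using meet ab by metis
      have "(q \<oplus> r \<otimes> a) \<otimes> (q' \<oplus> r' \<otimes> b) = (q \<otimes> (q' \<oplus> r' \<otimes> b)) \<oplus> ((r \<otimes> a) \<otimes> q' \<oplus> (r \<otimes> r') \<otimes> (a \<otimes> b))"
        using h ab Q.Icarr by algebra
      moreover have "q \<otimes> (q' \<oplus> r' \<otimes> b) \<in> Q" using h ab Q.Icarr by (simp add: Q.I_r_closed)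
      moreover have "(r \<otimes> a) \<otimes> q' \<in> Q" using h ab by (simp add: Q.I_l_closed)
      moreover have "(r \<otimes> r') \<otimes> (a \<otimes> b) \<in> Q" using h ab by (simp add: Q.I_l_closed)
      ultimately have "(q \<oplus> r \<otimes> a) \<otimes> (q' \<oplus> r' \<otimes> b) \<in> Q" by (simp add: Q.a_closed)
      then show False using T_mult[OF h(3,6)] Q(3) by auto
    qed
  qed
  moreover have "x \<notin> Q" using xT Q(3) by blast
  ultimately show ?thesis using Q(2) QP x by blast
qed

text \<open>
  A nonzerodivisor in \<open>P\<close> is a regular sequence of length one, and there is a prime strictly below
  \<open>P\<close> that omits it. A regular sequence of length two in \<open>P\<close> would give two primes in a chain
  strictly below \<open>P\<close> in the same way. So depth and height of \<open>P\<close> are both equal to one.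
\<close>

lemma cohen_macaulay_dimension_one:
  assumes cr: "cring R" and noeth: "noetherian_ring R"
    and nzd: "\<And>P. maximalideal P R \<Longrightarrow>
       \<exists>x\<in>P. \<forall>y\<in>carrier R. x \<otimes>\<^bsub>R\<^esub> y = \<zero>\<^bsub>R\<^esub> \<longrightarrow> y = \<zero>\<^bsub>R\<^esub>"
    and chain: "\<And>P0 P1 P2. primeideal P0 R \<Longrightarrow> primeideal P1 R \<Longrightarrow> primeideal P2 R \<Longrightarrow>
       P0 \<subset> P1 \<Longrightarrow> P1 \<subset> P2 \<Longrightarrow> False"
  shows "cohen_macaulay R"
  unfolding cohen_macaulay_def
proof (intro conjI allI impI cr noeth)
  fix P assume P: "maximalideal P R"
  interpret cring R by (rule cr)
  interpret P: maximalideal P R by (rule P)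
  have Pp: "primeideal P R" using maximalideal_prime[OF P] .
  have Idl0: "Idl\<^bsub>R\<^esub> {} = {\<zero>\<^bsub>R\<^esub>}"
    using genideal_minimal[OF zeroideal, of "{}"] additive_subgroup.zero_closed[OF ideal.axioms(1)[OF genideal_ideal[of "{}"]]]
    by auto
  obtain x where x: "x \<in> P" "\<And>y. y \<in> carrier R \<Longrightarrow> x \<otimes>\<^bsub>R\<^esub> y = \<zero>\<^bsub>R\<^esub> \<Longrightarrow> y = \<zero>\<^bsub>R\<^esub>"
    using nzd[OF P] by blast
  have xc: "x \<in> carrier R" using x(1) P.Icarr by blast
  have notcarr: "Idl\<^bsub>R\<^esub> (set xs) \<noteq> carrier R" if "set xs \<subseteq> P" for xs
  proof
    assume "Idl\<^bsub>R\<^esub> (set xs) = carrier R"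
    then have "carrier R \<subseteq> P" using genideal_minimal[OF P.is_ideal that] by simp
    then show False using P.I_notcarr P.a_subset by blast
  qed
  have reg1: "regular_sequence R [x]"
    unfolding regular_sequence_def
  proof (intro conjI allI impI ballI)
    show "set [x] \<subseteq> carrier R" using xc by simp
    show "Idl\<^bsub>R\<^esub> (set [x]) \<noteq> carrier R" using notcarr[of "[x]"] x(1) by simp
  next
    fix i y assume "i < length [x]" "y \<in> carrier R" "[x] ! i \<otimes>\<^bsub>R\<^esub> y \<in> Idl\<^bsub>R\<^esub> set (take i [x])"
    then show "y \<in> Idl\<^bsub>R\<^esub> set (take i [x])" using x(2)[of y] Idl0 by simp
  qed
  have len: "length xs \<le> 1" if rs: "regular_sequence R xs" and sub: "set xs \<subseteq> P" for xs
  proof (rule ccontr)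
    assume "\<not> length xs \<le> 1"
    then obtain a b zs where xs: "xs = a # b # zs"
      by (cases xs; cases "tl xs") auto
    have ac: "a \<in> carrier R" "b \<in> carrier R" "a \<in> P" "b \<in> P"
      using xs sub P.Icarr by auto
    have r0: "a \<otimes>\<^bsub>R\<^esub> y \<in> {\<zero>\<^bsub>R\<^esub>} \<Longrightarrow> y \<in> {\<zero>\<^bsub>R\<^esub>}" if "y \<in> carrier R" for y
      using rs that unfolding regular_sequence_def xs by (force simp: Idl0)
    have r1: "b \<otimes>\<^bsub>R\<^esub> y \<in> Idl\<^bsub>R\<^esub> {a} \<Longrightarrow> y \<in> Idl\<^bsub>R\<^esub> {a}" if "y \<in> carrier R" for y
      using rs that unfolding regular_sequence_def xs by (auto dest!: spec[of _ 1])
    have ia: "ideal (Idl\<^bsub>R\<^esub> {a}) R" using genideal_ideal ac by blast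
    have iaP: "Idl\<^bsub>R\<^esub> {a} \<subseteq> P" using genideal_minimal[OF P.is_ideal] ac by blast
    obtain Q where Q: "primeideal Q R" "Idl\<^bsub>R\<^esub> {a} \<subseteq> Q" "Q \<subset> P"
      using prime_below_excluding_nonzerodivisor[OF noeth ia Pp iaP ac(4) r1] by blast
    have aQ: "a \<in> Q" using Q(2) genideal_self'[OF ac(1)] by blast
    have "{\<zero>\<^bsub>R\<^esub>} \<subseteq> Q" using Q(1) additive_subgroup.zero_closed[OF ideal.axioms(1)[OF primeideal.axioms(1)]] by blast
    from prime_below_excluding_nonzerodivisor[OF noeth zeroideal Q(1) this aQ r0]
    obtain Q' where "primeideal Q' R" "Q' \<subset> Q" by blast
    then show False using chain Q Pp by blast
  qed
  have depth: "ideal_depth R P = 1"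
    unfolding ideal_depth_def
  proof (rule antisym)
    show "Sup {enat (length xs) |xs. regular_sequence R xs \<and> set xs \<subseteq> P} \<le> 1"
      using len by (intro Sup_least) (auto simp: one_enat_def)
    show "1 \<le> Sup {enat (length xs) |xs. regular_sequence R xs \<and> set xs \<subseteq> P}"
      using reg1 x(1) by (intro Sup_upper) (auto simp: one_enat_def intro!: exI[of _ "[x]"])
  qed
  have "{\<zero>\<^bsub>R\<^esub>} \<subseteq> P" using P.zero_closed by blast
  from prime_below_excluding_nonzerodivisor[OF noeth zeroideal Pp this x(1)] x(2)
  obtain Q where Q: "primeideal Q R" "Q \<subset> P" by blast
  have "length Qs - 1 \<le> 1" if h: "Qs \<noteq> []" "last Qs = P" "\<forall>Q \<in> set Qs. primeideal Q R" "sorted_wrt (\<subset>) Qs" for Qs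
  proof (rule ccontr)
    assume "\<not> length Qs - 1 \<le> 1"
    then have l: "2 < length Qs" by simp
    have "primeideal (Qs ! i) R" if "i \<le> 2" for i
      using h(3) nth_mem[of i Qs] l that by simp
    then have "primeideal (Qs ! 0) R" "primeideal (Qs ! 1) R" "primeideal (Qs ! 2) R" by simp_all
    moreover have "Qs ! 0 \<subset> Qs ! 1" "Qs ! 1 \<subset> Qs ! 2"
      using sorted_wrt_nth_less[OF h(4)] l by auto
    ultimately show False using chain by blast
  qed
  then have "prime_height R P \<le> 1"
    unfolding prime_height_def by (intro Sup_least) (auto simp: one_enat_def)
  moreover have "1 \<le> prime_height R P"
    unfolding prime_height_def using Q Pp
    by (intro Sup_upper) (auto simp: one_enat_def intro!: exI[of _ "[Q, P]"])
  ultimately show "ideal_depth R P = prime_height R P" using depth by simp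
qed

section \<open>Ring morphisms, ideals and Hilbert's basis theorem\<close>

text \<open>
  Rings given by types have no carrier to respect, so this predicate is lighter than the set of
  homomorphisms between two ring records. All substitutions of polynomials are instances of it.
\<close>

definition ring_morph :: "('a::comm_ring_1 \<Rightarrow> 'b::comm_ring_1) \<Rightarrow> bool" where
  "ring_morph \<phi> \<longleftrightarrow> \<phi> 1 = 1 \<and> (\<forall>x y. \<phi> (x + y) = \<phi> x + \<phi> y) \<and> (\<forall>x y. \<phi> (x * y) = \<phi> x * \<phi> y)"

lemma ring_morphI:
  "\<phi> 1 = 1 \<Longrightarrow> (\<And>x y. \<phi> (x + y) = \<phi> x + \<phi> y) \<Longrightarrow> (\<And>x y. \<phi> (x * y) = \<phi> x * \<phi> y) \<Longrightarrow> ring_morph \<phi>"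
  unfolding ring_morph_def by blast

lemma ring_morph_one: "ring_morph \<phi> \<Longrightarrow> \<phi> 1 = 1"
  and ring_morph_add: "ring_morph \<phi> \<Longrightarrow> \<phi> (x + y) = \<phi> x + \<phi> y"
  and ring_morph_mult: "ring_morph \<phi> \<Longrightarrow> \<phi> (x * y) = \<phi> x * \<phi> y"
  unfolding ring_morph_def by auto

lemma ring_morph_zero: "ring_morph \<phi> \<Longrightarrow> \<phi> 0 = 0"
  using ring_morph_add[of \<phi> 0 0] by simp

lemma ring_morph_uminus: "ring_morph \<phi> \<Longrightarrow> \<phi> (- x) = - \<phi> x"
  using ring_morph_add[of \<phi> x "- x"] ring_morph_zero[of \<phi>] by (simp add: eq_neg_iff_add_eq_0 add.commute)

lemma ring_morph_diff: "ring_morph \<phi> \<Longrightarrow> \<phi> (x - y) = \<phi> x - \<phi> y"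
  using ring_morph_add[of \<phi> x "- y"] ring_morph_uminus[of \<phi> y] by simp

lemma ring_morph_power: "ring_morph \<phi> \<Longrightarrow> \<phi> (x ^ n) = \<phi> x ^ n"
  by (induction n) (simp_all add: ring_morph_one ring_morph_mult)

lemma ring_morph_sum: "ring_morph \<phi> \<Longrightarrow> \<phi> (sum f A) = (\<Sum>a\<in>A. \<phi> (f a))"
  by (induction A rule: infinite_finite_induct) (simp_all add: ring_morph_zero ring_morph_add)

lemmas ring_morph_simps = ring_morph_one ring_morph_zero ring_morph_add ring_morph_mult
  ring_morph_uminus ring_morph_diff ring_morph_power ring_morph_sum

lemma ring_morph_id: "ring_morph (\<lambda>x. x)"
  by (simp add: ring_morph_def)

lemma ring_morph_comp: "ring_morph \<phi> \<Longrightarrow> ring_morph \<psi> \<Longrightarrow> ring_morph (\<lambda>x. \<phi> (\<psi> x))"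
  by (simp add: ring_morph_def)

lemma ring_morph_dvd: "ring_morph \<phi> \<Longrightarrow> x dvd y \<Longrightarrow> \<phi> x dvd \<phi> y"
  by (auto simp: ring_morph_mult elim!: dvdE)

lemma map_poly_add_morph: "ring_morph \<phi> \<Longrightarrow> map_poly \<phi> (p + q) = map_poly \<phi> p + map_poly \<phi> q"
  by (rule poly_eqI) (simp add: coeff_map_poly ring_morph_simps)

lemma map_poly_mult_morph: "ring_morph \<phi> \<Longrightarrow> map_poly \<phi> (p * q) = map_poly \<phi> p * map_poly \<phi> q"
  by (rule poly_eqI) (simp add: coeff_map_poly coeff_mult ring_morph_simps)

lemma ring_morph_eval: "ring_morph \<phi> \<Longrightarrow> ring_morph (\<lambda>p. poly (map_poly \<phi> p) a)"
  by (rule ring_morphI) (simp_all add: map_poly_add_morph map_poly_mult_morph ring_morph_one)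

lemma cring_type_ring: "cring (ring_of_type_algebra :: 'r::comm_ring_1 ring)" by (rule cring_from_type_algebra)

lemma type_ring_simps [simp]:
  "carrier (ring_of_type_algebra :: 'r::comm_ring_1 ring) = UNIV"
  "x \<otimes>\<^bsub>ring_of_type_algebra\<^esub> y = x * (y::'r)"
  "x \<oplus>\<^bsub>ring_of_type_algebra\<^esub> y = x + (y::'r)"
  "\<zero>\<^bsub>ring_of_type_algebra\<^esub> = (0::'r)"
  "\<one>\<^bsub>ring_of_type_algebra\<^esub> = (1::'r)"
  by (simp_all add: ring_of_type_algebra_def)

text \<open>
  Closure under negation is multiplication by \<open>-1\<close>, which makes this shorter list sufficient.
\<close>

lemma ideal_type_ring_iff:
  "ideal I (ring_of_type_algebra :: 'r::comm_ring_1 ring) \<longleftrightarrow>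
     0 \<in> I \<and> (\<forall>a\<in>I. \<forall>b\<in>I. a + b \<in> I) \<and> (\<forall>a\<in>I. \<forall>r. r * a \<in> I)"
proof
  assume "ideal I (ring_of_type_algebra :: 'r ring)"
  then have i: "ideal I (ring_of_type_algebra :: 'r ring)" .
  note ag = ideal.axioms(1)[OF i]
  show "0 \<in> I \<and> (\<forall>a\<in>I. \<forall>b\<in>I. a + b \<in> I) \<and> (\<forall>a\<in>I. \<forall>r. r * a \<in> I)"
  proof (intro conjI ballI allI)
    show "0 \<in> I" using additive_subgroup.zero_closed[OF ag] by (simp only: type_ring_simps)
    fix a r assume a: "a \<in> I"
    show "r * a \<in> I" using ideal.I_l_closed[OF i a, of r] by (simp only: type_ring_simps UNIV_I simp_thms)
    fix b assume "b \<in> I"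
    then show "a + b \<in> I" using additive_subgroup.a_closed[OF ag a, of b] by (simp only: type_ring_simps)
  qed
next
  interpret R: cring "ring_of_type_algebra :: 'r ring" by (rule cring_type_ring)
  assume h: "0 \<in> I \<and> (\<forall>a\<in>I. \<forall>b\<in>I. a + b \<in> I) \<and> (\<forall>a\<in>I. \<forall>r. r * a \<in> I)"
  show "ideal I (ring_of_type_algebra :: 'r ring)"
  proof (rule idealI[OF R.ring_axioms])
    show "subgroup I (add_monoid (ring_of_type_algebra :: 'r ring))"
    proof (rule group.subgroupI)
      show "Group.group (add_monoid (ring_of_type_algebra :: 'r ring))" by (rule R.add.is_group)
      show "I \<subseteq> carrier (add_monoid ring_of_type_algebra)" by simp
      show "I \<noteq> {}" using h by blast
    next
      fix a assume a: "a \<in> I"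
      have "\<ominus>\<^bsub>(ring_of_type_algebra :: 'r ring)\<^esub> a = - a"
        by (rule R.minus_equality) simp_all
      then have "inv\<^bsub>add_monoid (ring_of_type_algebra :: 'r ring)\<^esub> a = - a"
        unfolding a_inv_def .
      then show "inv\<^bsub>add_monoid ring_of_type_algebra\<^esub> a \<in> I"
        using h a by (metis mult_minus1)
    next
      fix a b assume "a \<in> I" "b \<in> I"
      then show "a \<otimes>\<^bsub>add_monoid ring_of_type_algebra\<^esub> b \<in> I" using h by simp
    qed
  qed (use h in \<open>simp_all add: mult.commute\<close>)
qed

lemma primeideal_type_ring_iff:
  "primeideal Q (ring_of_type_algebra :: 'r::comm_ring_1 ring) \<longleftrightarrow>
     ideal Q (ring_of_type_algebra :: 'r ring) \<and> 1 \<notin> Q \<and> (\<forall>a b. a * b \<in> Q \<longrightarrow> a \<in> Q \<or> b \<in> Q)"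
proof
  assume Q: "primeideal Q (ring_of_type_algebra :: 'r ring)"
  interpret primeideal Q "ring_of_type_algebra :: 'r ring" by (rule Q)
  have "1 \<notin> Q" using I_notcarr one_imp_carrier by auto
  then show "ideal Q (ring_of_type_algebra :: 'r ring) \<and> 1 \<notin> Q \<and> (\<forall>a b. a * b \<in> Q \<longrightarrow> a \<in> Q \<or> b \<in> Q)"
    using I_prime[unfolded type_ring_simps] is_ideal by blast
next
  assume "ideal Q (ring_of_type_algebra :: 'r ring) \<and> 1 \<notin> Q \<and> (\<forall>a b. a * b \<in> Q \<longrightarrow> a \<in> Q \<or> b \<in> Q)"
  then show "primeideal Q (ring_of_type_algebra :: 'r ring)"
    by (intro primeidealI cring_type_ring) auto
qed

lemma ideal_type_ring_diff:
  assumes "ideal I (ring_of_type_algebra :: 'r::comm_ring_1 ring)" "a \<in> I" "b \<in> I" shows "a - b \<in> I"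
  using assms unfolding ideal_type_ring_iff by (metis diff_conv_add_uminus mult_minus1)

lemma genideal_type_ring_least:
  assumes "ideal I (ring_of_type_algebra :: 'r::comm_ring_1 ring)" "S \<subseteq> I"
  shows "Idl\<^bsub>ring_of_type_algebra\<^esub> S \<subseteq> I"
  using ring.genideal_minimal[OF cring.axioms(1)[OF cring_type_ring] assms] .

lemma genideal_type_ring_ideal: "ideal (Idl\<^bsub>ring_of_type_algebra\<^esub> S) (ring_of_type_algebra :: 'r::comm_ring_1 ring)"
  using ring.genideal_ideal[OF cring.axioms(1)[OF cring_type_ring]] by simp

lemma genideal_type_ring_superset: "S \<subseteq> Idl\<^bsub>(ring_of_type_algebra :: 'r::comm_ring_1 ring)\<^esub> S"
  using ring.genideal_self[OF cring.axioms(1)[OF cring_type_ring]] by simp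

text \<open>
  The members may have degree less than \<open>n\<close>; so zero is included and the set is an ideal.
\<close>

definition leading_coeffs :: "'r::comm_ring_1 poly set \<Rightarrow> nat \<Rightarrow> 'r set" where
  "leading_coeffs J n = {coeff f n | f. f \<in> J \<and> Polynomial.degree f \<le> n}"

lemma ideal_leading_coeffs:
  assumes "ideal J (ring_of_type_algebra :: 'r::comm_ring_1 poly ring)"
  shows "ideal (leading_coeffs J n) ring_of_type_algebra"
  unfolding ideal_type_ring_iff
proof (intro conjI ballI allI)
  note J = assms[unfolded ideal_type_ring_iff]
  show "0 \<in> leading_coeffs J n" unfolding leading_coeffs_def 
    by (intro CollectI exI[of _ 0]) (simp add: J)
  fix a r assume "a \<in> leading_coeffs J n"
  then obtain f where f: "a = coeff f n" "f \<in> J" "Polynomial.degree f \<le> n" unfolding leading_coeffs_def by auto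
  have "smult r f = [:r:] * f" by simp
  then have "smult r f \<in> J" using J f by metis
  moreover have "Polynomial.degree (smult r f) \<le> n" using f(3) degree_smult_le le_trans by blast
  ultimately show "r * a \<in> leading_coeffs J n" unfolding leading_coeffs_def 
    by (intro CollectI exI[of _ "smult r f"]) (simp add: f(1))
  fix b assume "b \<in> leading_coeffs J n"
  then obtain g where g: "b = coeff g n" "g \<in> J" "Polynomial.degree g \<le> n" unfolding leading_coeffs_def by auto
  show "a + b \<in> leading_coeffs J n" unfolding leading_coeffs_def 
    by (intro CollectI exI[of _ "f + g"]) (use f g J in \<open>simp add: degree_add_le\<close>)
qed

text \<open>
  Multiplication by a power of the variable moves a leading coefficient to a higher degree.
\<close>

lemma leading_coeffs_mono:
  assumes J: "ideal J (ring_of_type_algebra :: 'r::comm_ring_1 poly ring)" and "m \<le> n"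
  shows "leading_coeffs J m \<subseteq> leading_coeffs J n"
proof
  fix c assume "c \<in> leading_coeffs J m"
  then obtain f where f: "c = coeff f m" "f \<in> J" "Polynomial.degree f \<le> m" unfolding leading_coeffs_def by blast
  have "monom 1 (n - m) * f \<in> J" using J[unfolded ideal_type_ring_iff] f(2) by simp
  moreover have "Polynomial.degree (monom 1 (n - m) * f) \<le> n"
    using degree_mult_le[of "monom 1 (n - m)" f] degree_monom_le[of "1::'r" "n - m"] f(3) assms(2) by linarith
  moreover have "coeff (monom 1 (n - m) * f) n = c"
    using assms(2) f(1) by (simp add: coeff_monom_mult)
  ultimately show "c \<in> leading_coeffs J n" unfolding leading_coeffs_def by blast
qed

text \<open>
  Subtracting a member of \<open>K\<close> with the same leading coefficient lowers the degree.
\<close>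

lemma subset_if_leading_coeffs_subset:
  assumes J: "ideal J (ring_of_type_algebra :: 'r::comm_ring_1 poly ring)"
    and K: "ideal K (ring_of_type_algebra :: 'r::comm_ring_1 poly ring)" and KJ: "K \<subseteq> J"
    and lc: "\<And>n. leading_coeffs J n \<subseteq> leading_coeffs K n"
  shows "J \<subseteq> K"
proof
  fix f assume "f \<in> J"
  then show "f \<in> K"
  proof (induction "if f = 0 then 0 else Suc (Polynomial.degree f)" arbitrary: f rule: less_induct)
    case less
    show ?case
    proof (cases "f = 0")
      case True then show ?thesis using K unfolding ideal_type_ring_iff by simp
    next
      case False
      let ?n = "Polynomial.degree f"
      have "coeff f ?n \<in> leading_coeffs J ?n" unfolding leading_coeffs_def using less.prems by blast
      then obtain g where g: "coeff f ?n = coeff g ?n" "g \<in> K" "Polynomial.degree g \<le> ?n"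
        using lc unfolding leading_coeffs_def by blast
      have fg: "f - g \<in> J" using ideal_type_ring_diff[OF J less.prems] g(2) KJ by blast
      have "f - g = 0 \<or> Polynomial.degree (f - g) < ?n"
      proof (rule ccontr)
        assume "\<not> ?thesis"
        then have nz: "f - g \<noteq> 0" and ge: "?n \<le> Polynomial.degree (f - g)" by auto
        have "Polynomial.degree (f - g) \<le> ?n" using g(3) by (intro degree_diff_le) auto
        then have "Polynomial.degree (f - g) = ?n" using ge by simp
        then have "coeff (f - g) ?n \<noteq> 0" using nz by (metis leading_coeff_0_iff)
        then show False using g(1) by simp
      qed
      then have "f - g \<in> K" using less.hyps[of "f - g"] fg False
        by (cases "f - g = 0") auto
      then have "(f - g) + g \<in> K" using g(2) K unfolding ideal_type_ring_iff by blast
      then show ?thesis by simp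
    qed
  qed
qed

text \<open>
  The ideals of leading coefficients increase with the degree and are constant from some degree
  \<open>N\<close> on. Finitely many polynomials realise generators of the first \<open>N + 1\<close> of them, and these
  polynomials generate an ideal with the same leading coefficients.
\<close>

theorem Hilbert_basis:
  assumes noeth: "noetherian_ring (ring_of_type_algebra :: 'r::comm_ring_1 ring)"
  shows "noetherian_ring (ring_of_type_algebra :: 'r poly ring)"
proof (rule ring.noetherian_ringI[OF cring.axioms(1)[OF cring_type_ring]])
  fix J assume J: "ideal J (ring_of_type_algebra :: 'r poly ring)"
  have "subset.chain {I. ideal I (ring_of_type_algebra :: 'r ring)} (range (leading_coeffs J))"
    unfolding subset_chain_def using ideal_leading_coeffs[OF J] leading_coeffs_mono[OF J]
    by (auto, metis nat_le_linear subsetD)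
  then have "\<Union>(range (leading_coeffs J)) \<in> range (leading_coeffs J)"
    using noetherian_ring.ideal_chain_is_trivial[OF noeth, of "range (leading_coeffs J)"] by blast
  then obtain N where N: "\<And>n. leading_coeffs J n \<subseteq> leading_coeffs J N" by auto
  have "\<exists>A. finite A \<and> leading_coeffs J n = Idl\<^bsub>ring_of_type_algebra\<^esub> A" for n
    using noetherian_ring.finetely_gen[OF noeth ideal_leading_coeffs[OF J]] by blast
  then obtain A where A: "\<And>n. finite (A n)" "\<And>n. leading_coeffs J n = Idl\<^bsub>ring_of_type_algebra\<^esub> (A n)" by metis
  have AL: "A n \<subseteq> leading_coeffs J n" for n using A(2) genideal_type_ring_superset by blast
  have "\<exists>f. f \<in> J \<and> Polynomial.degree f \<le> n \<and> coeff f n = a" if "a \<in> A n" for n a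
    using AL that unfolding leading_coeffs_def by blast
  note ex = this
  define F where "F n a = (SOME f. f \<in> J \<and> Polynomial.degree f \<le> n \<and> coeff f n = a)" for n a
  have F: "F n a \<in> J \<and> Polynomial.degree (F n a) \<le> n \<and> coeff (F n a) n = a" if "a \<in> A n" for n a
    unfolding F_def by (rule someI_ex[OF ex[OF that]])
  define G where "G = (\<Union>n\<le>N. F n ` A n)"
  let ?K = "Idl\<^bsub>ring_of_type_algebra\<^esub> G"
  have G: "finite G" "G \<subseteq> J"
    unfolding G_def by (intro finite_UN_I finite_imageI finite_atMost A(1)) (use F in blast)
  have K: "ideal ?K (ring_of_type_algebra :: 'r poly ring)" by (rule genideal_type_ring_ideal)
  have KJ: "?K \<subseteq> J" using genideal_type_ring_least[OF J G(2)] .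
  have small: "leading_coeffs J n \<subseteq> leading_coeffs ?K n" if "n \<le> N" for n
  proof -
    have "a \<in> leading_coeffs ?K n" if a: "a \<in> A n" for a
    proof -
      have "F n a \<in> ?K" using genideal_type_ring_superset[of G] a \<open>n \<le> N\<close> unfolding G_def by blast
      then show ?thesis unfolding leading_coeffs_def 
        by (intro CollectI exI[of _ "F n a"]) (simp add: F[OF a])
    qed
    then show ?thesis unfolding A(2) by (intro genideal_type_ring_least ideal_leading_coeffs K) auto
  qed
  have "leading_coeffs J n \<subseteq> leading_coeffs ?K n" for n
  proof (cases "n \<le> N")
    case False
    then show ?thesis using N[of n] small[of N] leading_coeffs_mono[OF K, of N n] by simp
  qed (rule small)
  then have "J = ?K" using subset_if_leading_coeffs_subset[OF J K KJ] KJ by blast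
  then show "\<exists>A\<subseteq>carrier ring_of_type_algebra. finite A \<and> J = Idl\<^bsub>ring_of_type_algebra\<^esub> A" using G(1) by auto
qed

lemma noetherian_field: "noetherian_ring (ring_of_type_algebra :: 'a::field ring)"
proof (rule ring.noetherian_ringI[OF cring.axioms(1)[OF cring_type_ring]])
  interpret field "ring_of_type_algebra :: 'a ring" by (rule field_from_type_algebra)
  fix J assume "ideal J (ring_of_type_algebra :: 'a ring)"
  then have "J \<in> {I. ideal I (ring_of_type_algebra :: 'a ring)}" by blast
  then have "J = {0} \<or> J = UNIV" unfolding all_ideals by auto
  then show "\<exists>A\<subseteq>carrier ring_of_type_algebra. finite A \<and> J = Idl\<^bsub>ring_of_type_algebra\<^esub> A"
    using genideal_zero genideal_one by (elim disjE) (auto intro: exI[of _ "{0}"] exI[of _ "{1}"])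
qed

lemma (in ring) noetherian_quotient:
  assumes noeth: "noetherian_ring R" and I: "ideal I R"
  shows "noetherian_ring (R Quot I)"
proof (rule ring.noetherian_ringI)
  interpret I: ideal I R by (rule I)
  interpret h: ring_hom_ring R "R Quot I" "(+>) I" by (rule I.rcos_ring_hom_ring)
  show Q: "ring (R Quot I)" by (rule I.quotient_is_ring)
  fix J assume J: "ideal J (R Quot I)"
  have surj: "\<exists>r\<in>carrier R. j = I +> r" if "j \<in> carrier (R Quot I)" for j
    using that unfolding FactRing_def A_RCOSETS_def' by auto
  let ?V = "{r \<in> carrier R. I +> r \<in> J}"
  have "ideal ?V R" using h.ideal_vimage[OF J] .
  then obtain A where A: "A \<subseteq> carrier R" "finite A" "?V = Idl A"
    using noetherian_ring.finetely_gen[OF noeth] by blast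
  have AV: "A \<subseteq> ?V" unfolding A(3) by (rule genideal_self[OF A(1)])
  let ?A = "(+>) I ` A"
  have Ac: "?A \<subseteq> carrier (R Quot I)" using A(1) h.hom_closed by blast
  have K: "ideal (Idl\<^bsub>R Quot I\<^esub> ?A) (R Quot I)" using ring.genideal_ideal[OF Q Ac] .
  have "Idl\<^bsub>R Quot I\<^esub> ?A \<subseteq> J" using ring.genideal_minimal[OF Q J] AV by blast
  moreover have "J \<subseteq> Idl\<^bsub>R Quot I\<^esub> ?A"
  proof
    fix j assume j: "j \<in> J"
    then have "j \<in> carrier (R Quot I)" using ideal.Icarr[OF J] by blast
    then obtain r where r: "r \<in> carrier R" "j = I +> r" using surj by blast
    have "Idl A \<subseteq> {r \<in> carrier R. I +> r \<in> Idl\<^bsub>R Quot I\<^esub> ?A}"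
      using ring.genideal_self[OF Q Ac] A(1) by (intro genideal_minimal h.ideal_vimage[OF K]) auto
    moreover have "r \<in> Idl A" using r j A(3) by blast
    ultimately show "j \<in> Idl\<^bsub>R Quot I\<^esub> ?A" using r by blast
  qed
  ultimately show "\<exists>A\<subseteq>carrier (R Quot I). finite A \<and> J = Idl\<^bsub>R Quot I\<^esub> A" using A(2) Ac by blast
qed

section \<open>Quotients supported on affine lines\<close>

text \<open>
  The polynomial \<open>p\<close> is a product of linear factors, one of which lies in the prime when evaluated
  at \<open>w\<close>.
\<close>

lemma linear_factor_in_prime:
  fixes \<kappa> :: "'a::alg_closed_field \<Rightarrow> 'r::comm_ring_1"
  assumes \<kappa>: "ring_morph \<kappa>" and Q: "primeideal Q ring_of_type_algebra"
  shows "p \<noteq> 0 \<Longrightarrow> poly (map_poly \<kappa> p) w \<in> Q \<Longrightarrow> \<exists>a. w - \<kappa> a \<in> Q"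
proof (induction "Polynomial.degree p" arbitrary: p)
  case 0
  obtain c where c: "p = [:c:]" using 0(1) by (metis degree_eq_zeroE)
  have "poly (map_poly \<kappa> p) w = \<kappa> c" using c \<kappa> by (simp add: map_poly_pCons ring_morph_zero)
  then have "\<kappa> (inverse c) * \<kappa> c \<in> Q" using 0(3) Q unfolding primeideal_type_ring_iff ideal_type_ring_iff by metis
  moreover have "\<kappa> (inverse c) * \<kappa> c = 1"
    using c 0(2) \<kappa> by (simp add: ring_morph_mult[symmetric] ring_morph_one)
  ultimately show ?case using Q unfolding primeideal_type_ring_iff by simp
next
  case (Suc n)
  then obtain a where "poly p a = 0" using alg_closed_imp_poly_has_root[of p] by auto
  then obtain q where q: "p = [:- a, 1:] * q" unfolding poly_eq_0_iff_dvd by (elim dvdE)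
  have "q \<noteq> 0" using q Suc.prems by auto
  then have deg: "n = Polynomial.degree q" using Suc(2) unfolding q by (subst (asm) degree_mult_eq) auto
  have "poly (map_poly \<kappa> p) w = (w - \<kappa> a) * poly (map_poly \<kappa> q) w"
    unfolding q using \<kappa>
    by (subst ring_morph_mult[OF ring_morph_eval[OF \<kappa>]])
       (simp add: map_poly_pCons ring_morph_zero ring_morph_uminus ring_morph_one)
  then have "w - \<kappa> a \<in> Q \<or> poly (map_poly \<kappa> q) w \<in> Q"
    using Suc.prems(2) Q unfolding primeideal_type_ring_iff by metis
  then show ?case using Suc.hyps(1)[OF deg \<open>q \<noteq> 0\<close>] by blast
qed

lemma residue_constant:
  fixes \<kappa> :: "'a::field \<Rightarrow> 'r::comm_ring_1"
  assumes \<kappa>: "ring_morph \<kappa>" and Q: "ideal Q ring_of_type_algebra"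
    and w: "\<And>r. \<exists>p. r - poly (map_poly \<kappa> p) w \<in> Q" and a: "w - \<kappa> a \<in> Q"
  shows "\<exists>c. r - \<kappa> c \<in> Q"
proof -
  note Qi = Q[unfolded ideal_type_ring_iff]
  obtain p where p: "r - poly (map_poly \<kappa> p) w \<in> Q" using w by blast
  have "poly (p - [:poly p a:]) a = 0" by simp
  then obtain q where q: "p - [:poly p a:] = [:- a, 1:] * q" unfolding poly_eq_0_iff_dvd by (elim dvdE)
  note ev = ring_morph_eval[OF \<kappa>, of w]
  have "poly (map_poly \<kappa> p) w - \<kappa> (poly p a) = poly (map_poly \<kappa> (p - [:poly p a:])) w"
    by (subst ring_morph_diff[OF ev]) (simp add: map_poly_pCons ring_morph_zero \<kappa>)
  also have "\<dots> = poly (map_poly \<kappa> q) w * (w - \<kappa> a)"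
    unfolding q by (subst ring_morph_mult[OF ev])
       (simp add: map_poly_pCons ring_morph_zero ring_morph_uminus ring_morph_one \<kappa> mult.commute)
  also have "\<dots> \<in> Q" using Qi a by blast
  finally have "(r - poly (map_poly \<kappa> p) w) + (poly (map_poly \<kappa> p) w - \<kappa> (poly p a)) \<in> Q" using Qi p by blast
  then show ?thesis by (intro exI[of _ "poly p a"]) simp
qed

text \<open>
  The last hypothesis says that modulo every prime over \<open>I\<close> the ring is generated by a single
  element over the field: the irreducible closed subsets of the zero set of \<open>I\<close> are affine lines and
  points. Hence chains of primes over \<open>I\<close> have at most two members, and every maximal ideal
  over \<open>I\<close> has the field as its residue field; it therefore contains \<open>u - a\<close> for some \<open>a\<close>, which
  is a nonzerodivisor by hypothesis.
\<close>

theorem cohen_macaulay_quotient: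
  fixes \<kappa> :: "'a::alg_closed_field \<Rightarrow> 'r::comm_ring_1" and I :: "'r set"
  assumes \<kappa>: "ring_morph \<kappa>" and noeth: "noetherian_ring (ring_of_type_algebra :: 'r ring)"
    and I: "ideal I ring_of_type_algebra"
    and nzd: "\<And>a r. (u - \<kappa> a) * r \<in> I \<Longrightarrow> r \<in> I"
    and curve: "\<And>Q. primeideal Q ring_of_type_algebra \<Longrightarrow> I \<subseteq> Q \<Longrightarrow>
        \<exists>w. \<forall>r. \<exists>p. r - poly (map_poly \<kappa> p) w \<in> Q"
  shows "cohen_macaulay (ring_of_type_algebra Quot I)"
proof (rule cohen_macaulay_dimension_one)
  let ?R = "ring_of_type_algebra :: 'r ring"
  let ?A = "?R Quot I"
  interpret R: cring ?R by (rule cring_type_ring)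
  interpret I: ideal I ?R by (rule I)
  interpret A: cring ?A by (rule I.quotient_is_cring[OF cring_type_ring])
  interpret h: ring_hom_ring ?R ?A "(+>\<^bsub>?R\<^esub>) I" by (rule I.rcos_ring_hom_ring)
  define \<pi> where "\<pi> = (+>\<^bsub>?R\<^esub>) I"
  have \<pi>_carr: "\<pi> r \<in> carrier ?A" for r unfolding \<pi>_def using h.hom_closed by simp
  have \<pi>_mult: "\<pi> (r * s) = \<pi> r \<otimes>\<^bsub>?A\<^esub> \<pi> s" for r s unfolding \<pi>_def using h.hom_mult[of r s] by simp
  have \<pi>_add: "\<pi> (r + s) = \<pi> r \<oplus>\<^bsub>?A\<^esub> \<pi> s" for r s unfolding \<pi>_def using h.hom_add[of r s] by simp
  have \<pi>_one: "\<pi> 1 = \<one>\<^bsub>?A\<^esub>" unfolding \<pi>_def using h.hom_one by simp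
  have \<pi>_zero: "\<pi> r = \<zero>\<^bsub>?A\<^esub> \<longleftrightarrow> r \<in> I" for r
  proof
    assume "\<pi> r = \<zero>\<^bsub>?A\<^esub>"
    then have "I +>\<^bsub>?R\<^esub> r = I" unfolding \<pi>_def FactRing_def by simp
    then show "r \<in> I" using I.rcos_const_imp_mem by simp
  next
    assume "r \<in> I"
    then show "\<pi> r = \<zero>\<^bsub>?A\<^esub>" unfolding \<pi>_def FactRing_def using R.a_rcos_zero[OF I] by simp
  qed
  have surj: "\<exists>r. x = \<pi> r" if "x \<in> carrier ?A" for x
    using that unfolding FactRing_def \<pi>_def A_RCOSETS_def' by auto
  show "cring ?A" by (rule A.is_cring)
  show "noetherian_ring ?A" by (rule R.noetherian_quotient[OF noeth I])
  have pre: "primeideal {r. \<pi> r \<in> P} ?R" "I \<subseteq> {r. \<pi> r \<in> P}" if P: "primeideal P ?A" for P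
  proof -
    interpret P: primeideal P ?A by (rule P)
    have "ideal {r. \<pi> r \<in> P} ?R" using h.ideal_vimage[OF P.is_ideal] unfolding \<pi>_def by simp
    moreover have "1 \<notin> {r. \<pi> r \<in> P}" using \<pi>_one P.one_imp_carrier P.I_notcarr by auto
    moreover have "a \<in> {r. \<pi> r \<in> P} \<or> b \<in> {r. \<pi> r \<in> P}" if "a * b \<in> {r. \<pi> r \<in> P}" for a b
      using that P.I_prime[OF \<pi>_carr \<pi>_carr] \<pi>_mult by auto
    ultimately show "primeideal {r. \<pi> r \<in> P} ?R" unfolding primeideal_type_ring_iff by blast
    show "I \<subseteq> {r. \<pi> r \<in> P}" 
    proof
      fix r assume "r \<in> I"
      then have "\<pi> r = \<zero>\<^bsub>?A\<^esub>" using \<pi>_zero by blast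
      then show "r \<in> {r. \<pi> r \<in> P}" using P.zero_closed by simp
    qed
  qed
  show "\<exists>x\<in>P. \<forall>y\<in>carrier ?A. x \<otimes>\<^bsub>?A\<^esub> y = \<zero>\<^bsub>?A\<^esub> \<longrightarrow> y = \<zero>\<^bsub>?A\<^esub>" if P: "maximalideal P ?A" for P
  proof -
    interpret P: maximalideal P ?A by (rule P)
    have Pp: "primeideal P ?A" using A.maximalideal_prime[OF P] .
    let ?Q = "{r. \<pi> r \<in> P}"
    have Qp: "primeideal ?Q ?R" by (rule pre(1)[OF Pp])
    then have Qi: "ideal ?Q ?R" by (rule primeideal.axioms(1))
    obtain w where w: "\<And>r. \<exists>p. r - poly (map_poly \<kappa> p) w \<in> ?Q" using curve[OF pre[OF Pp]] by blast
    \<comment> \<open>If \<open>w\<close> has an inverse modulo \<open>P\<close>, it is a polynomial \<open>p(w)\<close>, and \<open>1 - t p(t)\<close> has \<open>w\<close> as a root modulo \<open>P\<close>.\<close>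
    have "\<exists>a. w - \<kappa> a \<in> ?Q"
    proof (cases "w \<in> ?Q")
      case True
      then show ?thesis using ring_morph_zero[OF \<kappa>] by (intro exI[of _ 0]) simp
    next
      case False
      let ?J = "P <+>\<^bsub>?A\<^esub> PIdl\<^bsub>?A\<^esub> (\<pi> w)"
      have els: "?J = {q \<oplus>\<^bsub>?A\<^esub> r \<otimes>\<^bsub>?A\<^esub> \<pi> w | q r. q \<in> P \<and> r \<in> carrier ?A}"
        unfolding set_add_def' cgenideal_def by blast
      have J: "ideal ?J ?A" by (rule A.add_ideals[OF P.is_ideal A.cgenideal_ideal[OF \<pi>_carr]])
      have "P \<subseteq> ?J"
      proof
        fix q assume q: "q \<in> P"
        have "q = q \<oplus>\<^bsub>?A\<^esub> \<zero>\<^bsub>?A\<^esub> \<otimes>\<^bsub>?A\<^esub> \<pi> w" using q P.Icarr \<pi>_carr by simp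
        then show "q \<in> ?J" unfolding els using q by blast
      qed
      moreover have "?J \<noteq> P"
      proof -
        have "\<pi> w = \<zero>\<^bsub>?A\<^esub> \<oplus>\<^bsub>?A\<^esub> \<one>\<^bsub>?A\<^esub> \<otimes>\<^bsub>?A\<^esub> \<pi> w" using \<pi>_carr by simp
        then have "\<pi> w \<in> ?J" unfolding els using P.zero_closed by blast
        then show ?thesis using False by blast
      qed
      moreover have "?J \<subseteq> carrier ?A" using ideal.Icarr[OF J] by blast
      ultimately have "?J = carrier ?A" using P.I_maximal[OF J] by blast
      then have "\<one>\<^bsub>?A\<^esub> \<in> ?J" by simp
      then obtain q r' where qr: "q \<in> P" "r' \<in> carrier ?A" "\<one>\<^bsub>?A\<^esub> = q \<oplus>\<^bsub>?A\<^esub> r' \<otimes>\<^bsub>?A\<^esub> \<pi> w" unfolding els by blast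
      obtain r where r: "r' = \<pi> r" using surj qr(2) by blast
      obtain s where s: "q = \<pi> s" using surj P.Icarr qr(1) by blast
      have "\<pi> (1 - r * w - s) = \<zero>\<^bsub>?A\<^esub>"
      proof -
        have "\<pi> (1 - r * w - s) \<oplus>\<^bsub>?A\<^esub> \<pi> (s + r * w) = \<zero>\<^bsub>?A\<^esub> \<oplus>\<^bsub>?A\<^esub> \<pi> (s + r * w)"
          unfolding \<pi>_add[symmetric] using qr(3) \<pi>_carr by (simp add: \<pi>_one r s \<pi>_add \<pi>_mult)
        then show ?thesis using \<pi>_carr by (meson A.add.right_cancel A.zero_closed)
      qed
      then have "1 - r * w - s \<in> ?Q" using pre(2)[OF Pp] \<pi>_zero by blast
      moreover have "s \<in> ?Q" using s qr(1) by blast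
      ultimately have "(1 - r * w - s) + s \<in> ?Q" using Qi[unfolded ideal_type_ring_iff] by blast
      then have 1: "1 - r * w \<in> ?Q" by simp
      obtain p where p: "r - poly (map_poly \<kappa> p) w \<in> ?Q" using w by blast
      have "w * (r - poly (map_poly \<kappa> p) w) \<in> ?Q" using p Qi[unfolded ideal_type_ring_iff] by blast
      then have "(1 - r * w) + w * (r - poly (map_poly \<kappa> p) w) \<in> ?Q" using 1 Qi[unfolded ideal_type_ring_iff] by blast
      then have "1 - w * poly (map_poly \<kappa> p) w \<in> ?Q" by (simp add: algebra_simps)
      moreover have "poly (map_poly \<kappa> (1 - pCons 0 p)) w = 1 - w * poly (map_poly \<kappa> p) w"
        by (subst ring_morph_diff[OF ring_morph_eval[OF \<kappa>]])
           (simp add: map_poly_pCons \<kappa> ring_morph_simps)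
      moreover have "1 - pCons 0 p \<noteq> 0"
      proof
        assume "1 - pCons 0 p = 0"
        then have "coeff (1 - pCons 0 p) 0 = 0" by (simp only: coeff_0)
        then show False by simp
      qed
      ultimately show ?thesis using linear_factor_in_prime[OF \<kappa> Qp, of "1 - pCons 0 p" w] by simp
    qed
    then obtain a where "w - \<kappa> a \<in> ?Q" by blast
    then obtain c where c: "u - \<kappa> c \<in> ?Q" using residue_constant[OF \<kappa> Qi w, of a u] by blast
    have "y = \<zero>\<^bsub>?A\<^esub>" if y: "y \<in> carrier ?A" "\<pi> (u - \<kappa> c) \<otimes>\<^bsub>?A\<^esub> y = \<zero>\<^bsub>?A\<^esub>" for y
    proof -
      obtain r where r: "y = \<pi> r" using surj y(1) by blast
      have "(u - \<kappa> c) * r \<in> I" using y(2) unfolding r \<pi>_mult[symmetric] \<pi>_zero .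
      then show ?thesis using nzd r \<pi>_zero by blast
    qed
    then show ?thesis using c by blast
  qed
  show False if P: "primeideal P0 ?A" "primeideal P1 ?A" "primeideal P2 ?A" "P0 \<subset> P1" "P1 \<subset> P2" for P0 P1 P2
  proof -
    define Q where "Q P = {r. \<pi> r \<in> P}" for P
    have Q: "primeideal (Q P0) ?R" "primeideal (Q P1) ?R" "primeideal (Q P2) ?R" "I \<subseteq> Q P0"
      unfolding Q_def using pre P(1-3) by auto
    have sub: "\<exists>r. r \<in> Q P' \<and> r \<notin> Q P" if "P \<subset> P'" "primeideal P' ?A" for P P'
    proof -
      obtain x where x: "x \<in> P'" "x \<notin> P" using \<open>P \<subset> P'\<close> by blast
      then have "x \<in> carrier ?A" using that(2) by (meson ideal.Icarr primeideal.axioms(1))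
      then obtain r where "x = \<pi> r" using surj by blast
      then show ?thesis using x unfolding Q_def by blast
    qed
    have le: "Q P0 \<subseteq> Q P1" "Q P1 \<subseteq> Q P2" unfolding Q_def using P by auto
    have i: "ideal (Q P0) ?R" "ideal (Q P1) ?R" "ideal (Q P2) ?R" using Q by (auto dest: primeideal.axioms(1))
    obtain w where w: "\<And>r. \<exists>p. r - poly (map_poly \<kappa> p) w \<in> Q P0" using curve[OF Q(1,4)] by blast
    \<comment> \<open>An element of the second prime that is not in the first gives some \<open>w - a\<close>; then the quotient by the second prime is the field.\<close>
    obtain f where f: "f \<in> Q P1" "f \<notin> Q P0" using sub P by blast
    obtain p where p: "f - poly (map_poly \<kappa> p) w \<in> Q P0" using w by blast
    have "p \<noteq> 0" using p f(2) by auto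
    moreover have "poly (map_poly \<kappa> p) w \<in> Q P1"
    proof -
      have "f - (f - poly (map_poly \<kappa> p) w) \<in> Q P1" using ideal_type_ring_diff[OF i(2) f(1)] p le by blast
      then show ?thesis by simp
    qed
    ultimately obtain a where a: "w - \<kappa> a \<in> Q P1" using linear_factor_in_prime[OF \<kappa> Q(2)] by blast
    obtain g where g: "g \<in> Q P2" "g \<notin> Q P1" using sub P by blast
    have w1: "\<And>r. \<exists>p. r - poly (map_poly \<kappa> p) w \<in> Q P1" using w le by blast
    obtain c where c: "g - \<kappa> c \<in> Q P1" using residue_constant[OF \<kappa> i(2) w1 a, of g] by blast
    have "c \<noteq> 0" using c g(2) ring_morph_zero[OF \<kappa>] by auto
    have "g - (g - \<kappa> c) \<in> Q P2" using ideal_type_ring_diff[OF i(3) g(1)] c le by blast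
    then have "\<kappa> (inverse c) * \<kappa> c \<in> Q P2" using i(3)[unfolded ideal_type_ring_iff] by simp
    then have "1 \<in> Q P2" using \<open>c \<noteq> 0\<close> ring_morph_mult[OF \<kappa>, of "inverse c" c] ring_morph_one[OF \<kappa>] by simp
    then show False using Q(3) unfolding primeideal_type_ring_iff by blast
  qed
qed

section \<open>Substitution and forms\<close>

lemma ring_morph_const: "ring_morph (\<lambda>c::'a::comm_ring_1. [:c:])"
  by (rule ring_morphI) (simp_all add: one_pCons)

lemma ring_morph_const2: "ring_morph (const2 :: 'a::comm_ring_1 \<Rightarrow> _)"
  using ring_morph_comp[OF ring_morph_const ring_morph_const[where 'a='a]] by (simp add: const2_def[abs_def])

lemma ring_morph_const3: "ring_morph (const3 :: 'a::comm_ring_1 \<Rightarrow> _)"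
  using ring_morph_comp[OF ring_morph_const ring_morph_comp[OF ring_morph_const ring_morph_const[where 'a='a]]]
  by (simp add: const3_def[abs_def])

lemma ring_morph_subst2: "ring_morph \<phi> \<Longrightarrow> ring_morph (\<lambda>f. subst2 \<phi> f a b)"
  unfolding subst2_def by (intro ring_morph_eval)

lemma ring_morph_subst3: "ring_morph \<phi> \<Longrightarrow> ring_morph (\<lambda>f. subst3 \<phi> f a b c)"
  unfolding subst3_def by (intro ring_morph_eval ring_morph_subst2)

lemma poly_map_poly_const: "ring_morph \<phi> \<Longrightarrow> poly (map_poly \<phi> [:c:]) a = \<phi> c"
  by (simp add: map_poly_pCons ring_morph_zero)

lemma poly_map_poly_var: "ring_morph \<phi> \<Longrightarrow> poly (map_poly \<phi> [:0, 1:]) a = a"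
  by (simp add: map_poly_pCons ring_morph_zero ring_morph_one)

lemma subst2_const2: "ring_morph \<phi> \<Longrightarrow> subst2 \<phi> (const2 k) a b = \<phi> k"
  and subst2_U2: "ring_morph \<phi> \<Longrightarrow> subst2 \<phi> U2 a b = a"
  and subst2_V2: "ring_morph \<phi> \<Longrightarrow> subst2 \<phi> V2 a b = b"
  unfolding subst2_def const2_def U2_def V2_def
  by (simp_all add: poly_map_poly_const poly_map_poly_var ring_morph_eval del: poly_pCons)

lemma subst3_const: "ring_morph \<phi> \<Longrightarrow> subst3 \<phi> [:p:] a b c = subst2 \<phi> p a b"
  unfolding subst3_def by (simp add: poly_map_poly_const ring_morph_subst2)

lemma subst3_const3: "ring_morph \<phi> \<Longrightarrow> subst3 \<phi> (const3 k) a b c = \<phi> k"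
  and subst3_X3: "ring_morph \<phi> \<Longrightarrow> subst3 \<phi> X3 a b c = a"
  and subst3_Y3: "ring_morph \<phi> \<Longrightarrow> subst3 \<phi> Y3 a b c = b"
  and subst3_Z3: "ring_morph \<phi> \<Longrightarrow> subst3 \<phi> Z3 a b c = c"
  using subst2_const2[of \<phi> k a b] subst2_U2[of \<phi> a b] subst2_V2[of \<phi> a b]
  unfolding const3_def X3_def Y3_def Z3_def const2_def U2_def V2_def
  by (simp_all add: subst3_const) (simp add: subst3_def poly_map_poly_var ring_morph_subst2 del: poly_pCons)

lemma morph_eq_poly:
  assumes "ring_morph \<Phi>" "ring_morph \<Psi>" "\<And>c. \<Phi> [:c:] = \<Psi> [:c:]" "\<Phi> [:0, 1:] = \<Psi> [:0, 1:]"
  shows "\<Phi> p = \<Psi> p"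
proof (induction p)
  case 0 then show ?case using assms by (simp add: ring_morph_zero)
next
  case (pCons c p)
  have eq: "pCons c p = [:c:] + [:0, 1:] * p" by simp
  show ?case
    unfolding eq by (simp only: ring_morph_add[OF assms(1)] ring_morph_add[OF assms(2)]
      ring_morph_mult[OF assms(1)] ring_morph_mult[OF assms(2)] assms(3,4) pCons(2))
qed

lemma morph_eq_poly2:
  assumes m: "ring_morph \<Phi>" "ring_morph \<Psi>"
    and c: "\<And>c. \<Phi> (const2 c) = \<Psi> (const2 c)" and U: "\<Phi> U2 = \<Psi> U2" and V: "\<Phi> V2 = \<Psi> V2"
  shows "\<Phi> p = \<Psi> p"
proof (rule morph_eq_poly[OF m])
  fix g
  show "\<Phi> [:g:] = \<Psi> [:g:]"
  proof (rule morph_eq_poly[of "\<lambda>g. \<Phi> [:g:]" "\<lambda>g. \<Psi> [:g:]"])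
    show "ring_morph (\<lambda>g. \<Phi> [:g:])" "ring_morph (\<lambda>g. \<Psi> [:g:])"
      by (intro ring_morph_comp[OF _ ring_morph_const] m)+
  qed (use c U in \<open>simp_all add: const2_def U2_def\<close>)
qed (use V in \<open>simp add: V2_def\<close>)

text \<open>
  Identities between substitutions are proved by comparing both sides on constants and variables.
\<close>

lemma morph_eq_poly3:
  assumes m: "ring_morph \<Phi>" "ring_morph \<Psi>"
    and c: "\<And>c. \<Phi> (const3 c) = \<Psi> (const3 c)"
    and X: "\<Phi> X3 = \<Psi> X3" and Y: "\<Phi> Y3 = \<Psi> Y3" and Z: "\<Phi> Z3 = \<Psi> Z3"
  shows "\<Phi> p = \<Psi> p"
proof (rule morph_eq_poly[OF m])
  fix g
  show "\<Phi> [:g:] = \<Psi> [:g:]"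
  proof (rule morph_eq_poly2[of "\<lambda>g. \<Phi> [:g:]" "\<lambda>g. \<Psi> [:g:]"])
    show "ring_morph (\<lambda>g. \<Phi> [:g:])" "ring_morph (\<lambda>g. \<Psi> [:g:])"
      by (intro ring_morph_comp[OF _ ring_morph_const] m)+
  qed (use c X Y in \<open>simp_all add: const2_def U2_def V2_def const3_def X3_def Y3_def\<close>)
qed (use Z in \<open>simp add: Z3_def\<close>)

lemma morph_subst3:
  assumes "ring_morph \<Phi>" "ring_morph \<phi>"
  shows "\<Phi> (subst3 \<phi> f a b c) = subst3 (\<lambda>x. \<Phi> (\<phi> x)) f (\<Phi> a) (\<Phi> b) (\<Phi> c)"
  by (rule morph_eq_poly3[of "\<lambda>f. \<Phi> (subst3 \<phi> f a b c)"])
     (simp_all add: assms ring_morph_comp[OF assms] ring_morph_comp[OF assms(1) ring_morph_subst3[OF assms(2)]] ring_morph_subst3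
      subst3_const3 subst3_X3 subst3_Y3 subst3_Z3)

lemma subst3_id: "subst3 const3 f X3 Y3 Z3 = f"
  by (rule morph_eq_poly3[of "\<lambda>f. subst3 const3 f X3 Y3 Z3" "\<lambda>f. f"])
     (simp_all add: ring_morph_subst3 ring_morph_const3 ring_morph_id subst3_const3 subst3_X3 subst3_Y3 subst3_Z3)

lemma morph_as_subst3:
  "ring_morph \<Phi> \<Longrightarrow> \<Phi> f = subst3 (\<lambda>c. \<Phi> (const3 c)) f (\<Phi> X3) (\<Phi> Y3) (\<Phi> Z3)"
  using morph_subst3[of \<Phi> const3 f X3 Y3 Z3] by (simp add: ring_morph_const3 subst3_id)

abbreviation coeff3 :: "'a::comm_ring_1 poly3 \<Rightarrow> nat \<Rightarrow> nat \<Rightarrow> nat \<Rightarrow> 'a" where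
  "coeff3 f i j l \<equiv> coeff (coeff (coeff f l) j) i"

lemma poly_as_sum: "p = (\<Sum>i\<le>Polynomial.degree p. [:coeff p i:] * [:0, 1:] ^ i)"
proof -
  have "[:c:] * [:0, 1:] ^ i = monom c i" for c :: 'a and i by (simp add: monom_altdef)
  then show ?thesis using poly_as_sum_of_monoms[of p] by simp
qed

text \<open>
  An additive statement about \<open>f\<close> only has to be checked on the monomials that occur in \<open>f\<close>. The
  degree conditions on forms and on members of a linear system are used through this rule.
\<close>

lemma poly3_monomial_induct:
  fixes f :: "'a::comm_ring_1 poly3"
  assumes zero: "P 0" and add: "\<And>f g. P f \<Longrightarrow> P g \<Longrightarrow> P (f + g)"
    and mono: "\<And>i j l. coeff3 f i j l \<noteq> 0 \<Longrightarrow> P (const3 (coeff3 f i j l) * X3 ^ i * Y3 ^ j * Z3 ^ l)"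
  shows "P f"
proof -
  have sums: "finite A \<Longrightarrow> (\<And>a. a \<in> A \<Longrightarrow> P (h a)) \<Longrightarrow> P (sum h A)" for h and A :: "nat set"
    by (induction A rule: finite_induct) (use zero add in auto)
  have summand: "P (const3 (coeff3 f i j l) * X3 ^ i * Y3 ^ j * Z3 ^ l)" for i j l
    using mono[of l j i] zero by (cases "coeff3 f i j l = 0") (auto simp: const3_def)
  note c = ring_morph_const
  have 2: "[:[:p:]:] = (\<Sum>i\<le>Polynomial.degree p. const3 (coeff p i) * X3 ^ i)" for p :: "'a poly"
    using arg_cong[OF poly_as_sum[of p], of "\<lambda>p. [:[:p:]:]"]
    by (simp only: ring_morph_simps[OF ring_morph_comp[OF c c]] const3_def X3_def)
  have 1: "[:p:] = (\<Sum>j\<le>Polynomial.degree p. [:[:coeff p j:]:] * Y3 ^ j)" for p :: "'a poly2"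
    using arg_cong[OF poly_as_sum[of p], of "\<lambda>p. [:p:]"]
    by (simp only: ring_morph_simps[OF c] Y3_def)
  have 12: "[:p:] = (\<Sum>j\<le>Polynomial.degree p. \<Sum>i\<le>Polynomial.degree (coeff p j).
      const3 (coeff (coeff p j) i) * X3 ^ i * Y3 ^ j)" for p :: "'a poly2"
    using 1[of p] by (simp only: 2 sum_distrib_right)
  have "f = (\<Sum>l\<le>Polynomial.degree f. [:coeff f l:] * Z3 ^ l)"
    using poly_as_sum[of f] by (simp only: Z3_def)
  also have "\<dots> = (\<Sum>l\<le>Polynomial.degree f. \<Sum>j\<le>Polynomial.degree (coeff f l).
      \<Sum>i\<le>Polynomial.degree (coeff (coeff f l) j). const3 (coeff3 f i j l) * X3 ^ i * Y3 ^ j * Z3 ^ l)"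
    by (simp only: 12 sum_distrib_right)
  finally have eq: "f = \<dots>" .
  show ?thesis by (subst eq) (intro sums summand finite_atMost)
qed

lemma is_form_zero: "is_form d 0" by (simp add: is_form_def)

lemma is_form_add: "is_form d f \<Longrightarrow> is_form d g \<Longrightarrow> is_form d (f + g)"
  unfolding is_form_def by (metis add.right_neutral coeff_add)

lemma is_form_mult:
  assumes "is_form m f" "is_form n g"
  shows "is_form (m + n) (f * g)"
  unfolding is_form_def
proof (intro allI impI)
  fix i j l assume "coeff3 (f * g) i j l \<noteq> 0"
  then have "(\<Sum>r\<le>l. \<Sum>s\<le>j. \<Sum>t\<le>i. coeff3 f t s r * coeff3 g (i - t) (j - s) (l - r)) \<noteq> 0"
    by (simp add: coeff_mult coeff_sum)
  then obtain r s t where "r \<le> l" "s \<le> j" "t \<le> i" "coeff3 f t s r * coeff3 g (i - t) (j - s) (l - r) \<noteq> 0"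
    by (metis (no_types, lifting) atMost_iff sum.neutral)
  moreover from this have "coeff3 f t s r \<noteq> 0" "coeff3 g (i - t) (j - s) (l - r) \<noteq> 0" by auto
  then have "t + s + r = m" "(i - t) + (j - s) + (l - r) = n"
    using assms unfolding is_form_def by blast+
  ultimately show "i + j + l = m + n" by linarith
qed

lemma is_form_const3: "is_form 0 (const3 c)"
  by (auto simp: is_form_def const3_def coeff_pCons split: nat.splits)

lemma is_form_X3: "is_form 1 X3" and is_form_Y3: "is_form 1 Y3" and is_form_Z3: "is_form 1 Z3"
  by (auto simp: is_form_def X3_def Y3_def Z3_def coeff_pCons one_pCons split: nat.splits if_splits)

lemma is_form_power: "is_form m f \<Longrightarrow> is_form (m * n) (f ^ n)"
proof (induction n)
  case 0 then show ?case using is_form_const3[of 1] by (simp add: const3_def one_pCons)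
next
  case (Suc n) then show ?case using is_form_mult[of m f "m * n" "f ^ n"] by simp
qed

lemma form_monomial_induct:
  assumes f: "is_form d f" and zero: "P 0" and add: "\<And>f g. P f \<Longrightarrow> P g \<Longrightarrow> P (f + g)"
    and mono: "\<And>c i j l. i + j + l = d \<Longrightarrow> P (const3 c * X3 ^ i * Y3 ^ j * Z3 ^ l)"
  shows "P f"
proof (rule poly3_monomial_induct)
  fix i j l assume "coeff3 f i j l \<noteq> 0"
  then have "i + j + l = d" using f unfolding is_form_def by blast
  then show "P (const3 (coeff3 f i j l) * X3 ^ i * Y3 ^ j * Z3 ^ l)" by (rule mono)
qed (fact zero add)+

lemmas subst3_simps = ring_morph_simps[OF ring_morph_subst3] subst3_const3 subst3_X3 subst3_Y3 subst3_Z3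

lemma is_form_subst3:
  assumes g: "is_form e g" and a: "is_form d a" "is_form d b" "is_form d c"
  shows "is_form (e * d) (subst3 const3 g a b c)"
  using g
proof (rule form_monomial_induct)
  fix k i j l assume "i + j + l = e"
  then have eq: "e * d = 0 + d * i + d * j + d * l" by (auto simp: algebra_simps)
  show "is_form (e * d) (subst3 const3 (const3 k * X3 ^ i * Y3 ^ j * Z3 ^ l) a b c)"
    unfolding eq by (simp only: subst3_simps ring_morph_const3) (intro is_form_mult is_form_power is_form_const3 a)
qed (simp_all add: subst3_simps ring_morph_const3 is_form_zero is_form_add)

lemma form_subst3_scale:
  assumes g: "is_form e g" and \<phi>: "ring_morph \<phi>"
  shows "subst3 \<phi> g (s * a) (s * b) (s * c) = s ^ e * subst3 \<phi> g a b c"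
  using g
proof (rule form_monomial_induct)
  fix k i j l assume "i + j + l = e"
  then have e: "e = i + j + l" by simp
  show "subst3 \<phi> (const3 k * X3 ^ i * Y3 ^ j * Z3 ^ l) (s * a) (s * b) (s * c) =
    s ^ e * subst3 \<phi> (const3 k * X3 ^ i * Y3 ^ j * Z3 ^ l) a b c"
    unfolding e by (simp only: subst3_simps \<phi> power_mult_distrib power_add) (simp only: mult_ac)
qed (simp_all only: subst3_simps \<phi> distrib_left mult_zero_right)

text \<open>
  The monomials of \<open>g\<close> have degree at least \<open>m\<close> in the first two variables, because their degree in
  the third one is at most \<open>d - m\<close>.
\<close>

lemma form_subst3_order:
  assumes g: "is_form d g" and deg: "\<And>l. d < l + m \<Longrightarrow> coeff g l = 0" and \<phi>: "ring_morph \<phi>"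
  shows "\<pi> ^ m dvd subst3 \<phi> g (\<pi> * a) (\<pi> * b) c"
proof (rule poly3_monomial_induct[of _ g])
  fix i j l assume nz: "coeff3 g i j l \<noteq> 0"
  then have "i + j + l = d" using g[unfolded is_form_def] by blast
  moreover have "\<not> d < l + m" using deg[of l] nz by (metis coeff_0)
  ultimately have "m \<le> i + j" by linarith
  then have "\<pi> ^ m dvd \<pi> ^ i * \<pi> ^ j" unfolding power_add[symmetric] by (rule le_imp_power_dvd)
  then have "\<pi> ^ m dvd (\<pi> ^ i * \<pi> ^ j) * (\<phi> (coeff3 g i j l) * a ^ i * b ^ j * c ^ l)"
    by (rule dvd_mult2)
  then show "\<pi> ^ m dvd subst3 \<phi> (const3 (coeff3 g i j l) * X3 ^ i * Y3 ^ j * Z3 ^ l) (\<pi> * a) (\<pi> * b) c"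
    by (simp only: subst3_simps \<phi> power_mult_distrib) (simp only: mult_ac)
qed (simp_all only: subst3_simps \<phi> dvd_add dvd_0_right)

lemma subst2_id: "subst2 const2 f U2 V2 = f"
  by (rule morph_eq_poly2[of "\<lambda>f. subst2 const2 f U2 V2" "\<lambda>f. f"])
     (simp_all add: ring_morph_subst2 ring_morph_const2 ring_morph_id subst2_const2 subst2_U2 subst2_V2)

lemma subst3_dehomogenize: "subst3 const2 f U2 V2 1 = poly f 1"
  unfolding subst3_def by (simp add: subst2_id)

text \<open>
  Setting \<open>z = 1\<close> in a form causes no cancellation, since the exponent of \<open>z\<close> is determined by the
  other two.
\<close>

lemma coeff_dehomogenize:
  assumes "is_form d f"
  shows "coeff (coeff (poly f 1) j) i = (if i + j \<le> d then coeff3 f i j (d - i - j) else 0)"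
proof -
  have "coeff (coeff (poly f 1) j) i = (\<Sum>l\<le>Polynomial.degree f. coeff3 f i j l)"
    by (simp add: poly_altdef coeff_sum)
  also have "\<dots> = (\<Sum>l\<le>Polynomial.degree f. if l = d - i - j \<and> i + j \<le> d then coeff3 f i j l else 0)"
  proof (rule sum.cong[OF refl])
    fix l
    have "l = d - i - j \<and> i + j \<le> d" if nz: "coeff3 f i j l \<noteq> 0"
    proof -
      have "i + j + l = d" using nz assms[unfolded is_form_def] by blast
      then show ?thesis by linarith
    qed
    then show "coeff3 f i j l = (if l = d - i - j \<and> i + j \<le> d then coeff3 f i j l else 0)"
      by (cases "coeff3 f i j l = 0") (simp_all only: if_cancel simp_thms if_True)
  qed
  also have "\<dots> = (if i + j \<le> d then coeff3 f i j (d - i - j) else 0)"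
    by (auto simp: sum.delta' coeff_eq_0)
  finally show ?thesis .
qed

section \<open>Multiplicities under blowing up\<close>

lemma poly2_monomial_induct:
  fixes f :: "'a::comm_ring_1 poly2"
  assumes zero: "P 0" and add: "\<And>f g. P f \<Longrightarrow> P g \<Longrightarrow> P (f + g)"
    and mono: "\<And>i j. coeff (coeff f j) i \<noteq> 0 \<Longrightarrow> P (const2 (coeff (coeff f j) i) * U2 ^ i * V2 ^ j)"
  shows "P f"
proof -
  have sums: "finite A \<Longrightarrow> (\<And>a. a \<in> A \<Longrightarrow> P (h a)) \<Longrightarrow> P (sum h A)" for h and A :: "nat set"
    by (induction A rule: finite_induct) (use zero add in auto)
  have summand: "P (const2 (coeff (coeff f j) i) * U2 ^ i * V2 ^ j)" for i j
    using mono[of j i] zero by (cases "coeff (coeff f j) i = 0") (auto simp: const2_def)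
  note c = ring_morph_const
  have 1: "[:p:] = (\<Sum>i\<le>Polynomial.degree p. const2 (coeff p i) * U2 ^ i)" for p :: "'a poly"
    using arg_cong[OF poly_as_sum[of p], of "\<lambda>p. [:p:]"]
    by (simp only: ring_morph_simps[OF c] const2_def U2_def)
  have "f = (\<Sum>j\<le>Polynomial.degree f. [:coeff f j:] * V2 ^ j)"
    using poly_as_sum[of f] by (simp only: V2_def)
  also have "\<dots> = (\<Sum>j\<le>Polynomial.degree f. \<Sum>i\<le>Polynomial.degree (coeff f j).
      const2 (coeff (coeff f j) i) * U2 ^ i * V2 ^ j)"
    by (simp only: 1 sum_distrib_right)
  finally have eq: "f = \<dots>" .
  show ?thesis by (subst eq) (intro sums summand finite_atMost)
qed

lemmas subst2_simps = ring_morph_simps[OF ring_morph_subst2] subst2_const2 subst2_U2 subst2_V2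

lemma coeff2_monomial:
  fixes k :: "'a::comm_ring_1"
  shows
  "coeff (coeff (const2 k * U2 ^ i * V2 ^ j) b) a = (if a = i \<and> b = j then k else 0)"
proof -
  have "const2 k * U2 ^ i * V2 ^ j = monom (monom k i) j"
  proof -
    have "U2 ^ i = ([:monom 1 i:] :: 'a poly2)"
      unfolding U2_def by (simp add: monom_altdef ring_morph_power[OF ring_morph_const, symmetric])
    moreover have "V2 ^ j = (monom 1 j :: 'a poly2)" unfolding V2_def by (simp add: monom_altdef)
    ultimately show ?thesis by (simp add: const2_def smult_monom mult.commute)
  qed
  then show ?thesis by (simp add: coeff_monom)
qed

text \<open>The homogeneous part of degree \<open>n\<close>, at \<open>u = 1\<close> and at \<open>v = 1\<close>.\<close>

definition hom_part_u :: "nat \<Rightarrow> 'a::comm_ring_1 poly2 \<Rightarrow> 'a poly" where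
  "hom_part_u n g = (\<Sum>j\<le>n. monom (coeff (coeff g j) (n - j)) j)"

definition hom_part_v :: "nat \<Rightarrow> 'a::comm_ring_1 poly2 \<Rightarrow> 'a poly" where
  "hom_part_v n g = (\<Sum>i\<le>n. monom (coeff (coeff g (n - i)) i) i)"

lemma coeff_hom_part_u: "coeff (hom_part_u n g) j = (if j \<le> n then coeff (coeff g j) (n - j) else 0)"
  by (simp add: hom_part_u_def coeff_sum coeff_monom)

lemma coeff_hom_part_v: "coeff (hom_part_v n g) i = (if i \<le> n then coeff (coeff g (n - i)) i else 0)"
  by (simp add: hom_part_v_def coeff_sum coeff_monom)

lemma hom_part_u_add: "hom_part_u n (f + g) = hom_part_u n f + hom_part_u n g"
  and hom_part_v_add: "hom_part_v n (f + g) = hom_part_v n f + hom_part_v n g"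
  by (simp_all add: hom_part_u_def hom_part_v_def add_monom[symmetric] sum.distrib)

lemma hom_part_zero: "hom_part_u n 0 = 0" "hom_part_v n 0 = 0"
  by (simp_all add: hom_part_u_def hom_part_v_def)

lemma hom_part_u_monomial:
  "hom_part_u n (const2 k * U2 ^ i * V2 ^ j) = (if i + j = n then monom k j else 0)"
  by (rule poly_eqI) (auto simp: coeff_hom_part_u coeff2_monomial coeff_monom)

lemma hom_part_v_monomial:
  "hom_part_v n (const2 k * U2 ^ i * V2 ^ j) = (if i + j = n then monom k i else 0)"
  by (rule poly_eqI) (auto simp: coeff_hom_part_v coeff2_monomial coeff_monom)

text \<open>
  On the homogeneous part of degree \<open>n\<close> the pullback is \<open>u\<^sup>n\<close> times the value of that part at
  \<open>(1, v + c)\<close>, and division by \<open>u\<^sup>m\<close> leaves \<open>u\<^bsup>n - m\<^esup>\<close>. The initial part governs the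
  multiplicities on the exceptional curve. The two parts after it are needed for the intersection
  with the line of direction \<open>c\<close>.
\<close>

lemma chart_pullback_Some:
  fixes g :: "'a::field poly2"
  assumes "\<And>i j. i + j < m \<Longrightarrow> coeff (coeff g j) i = 0"
  shows "\<exists>g'. chart_pullback (Some c) g = U2 ^ m * g' \<and>
    (\<forall>e a. coeff (coeff g' a) e = coeff (pcompose (hom_part_u (m + e) g) [:c, 1:]) a)"
proof (rule poly2_monomial_induct[of _ g])
  show "\<exists>g'. chart_pullback (Some c) 0 = U2 ^ m * g' \<and>
    (\<forall>e a. coeff (coeff g' a) e = coeff (pcompose (hom_part_u (m + e) 0) [:c, 1:]) a)"
    by (intro exI[of _ 0]) (simp add: hom_part_zero subst2_simps ring_morph_const2)
next
  fix f g :: "'a poly2"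
  assume f: "\<exists>g'. chart_pullback (Some c) f = U2 ^ m * g' \<and>
    (\<forall>e a. coeff (coeff g' a) e = coeff (pcompose (hom_part_u (m + e) f) [:c, 1:]) a)"
  assume g: "\<exists>g'. chart_pullback (Some c) g = U2 ^ m * g' \<and>
    (\<forall>e a. coeff (coeff g' a) e = coeff (pcompose (hom_part_u (m + e) g) [:c, 1:]) a)"
  from f g obtain f' g' where "chart_pullback (Some c) f = U2 ^ m * f'" "chart_pullback (Some c) g = U2 ^ m * g'"
    "\<forall>e a. coeff (coeff f' a) e = coeff (pcompose (hom_part_u (m + e) f) [:c, 1:]) a"
    "\<forall>e a. coeff (coeff g' a) e = coeff (pcompose (hom_part_u (m + e) g) [:c, 1:]) a"
    by (elim exE conjE)
  then show "\<exists>g'. chart_pullback (Some c) (f + g) = U2 ^ m * g' \<and>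
    (\<forall>e a. coeff (coeff g' a) e = coeff (pcompose (hom_part_u (m + e) (f + g)) [:c, 1:]) a)"
    by (intro exI[of _ "f' + g'"]) (simp add: hom_part_u_add subst2_simps ring_morph_const2 pcompose_add distrib_left)
next
  fix i j
  let ?k = "coeff (coeff g j) i"
  assume "?k \<noteq> 0"
  then have ij: "m \<le> i + j" using assms by (meson not_less)
  let ?g' = "const2 ?k * U2 ^ (i + j - m) * (V2 + const2 c) ^ j"
  have "chart_pullback (Some c) (const2 ?k * U2 ^ i * V2 ^ j) = const2 ?k * U2 ^ (i + j) * (V2 + const2 c) ^ j"
    by (simp add: subst2_simps ring_morph_const2 power_mult_distrib power_add mult.assoc)
  also have "U2 ^ (i + j) = U2 ^ m * (U2 ^ (i + j - m) :: 'a poly2)"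
    using ij by (simp flip: power_add)
  finally have 1: "chart_pullback (Some c) (const2 ?k * U2 ^ i * V2 ^ j) = U2 ^ m * ?g'"
    by (simp only: mult_ac)
  have V: "(V2 + const2 c) ^ j = map_poly (\<lambda>c. [:c:]) ([:c, 1:] ^ j)"
  proof -
    have "ring_morph (\<lambda>p. map_poly (\<lambda>c::'a. [:c:]) p)"
      by (rule ring_morphI) (rule map_poly_1', rule ring_morph_one[OF ring_morph_const],
          simp_all only: map_poly_add_morph map_poly_mult_morph ring_morph_const)
    from ring_morph_power[OF this, of "[:c, 1:]" j] show ?thesis
      by (simp add: map_poly_pCons V2_def const2_def one_pCons)
  qed
  have U: "const2 ?k * U2 ^ n = [:monom ?k n:]" for n
    using ring_morph_power[OF ring_morph_const, of "[:0, 1:] :: 'a poly" n, symmetric]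
    by (simp add: const2_def U2_def monom_altdef)
  have "coeff (coeff ?g' a) e = coeff (pcompose (hom_part_u (m + e) (const2 ?k * U2 ^ i * V2 ^ j)) [:c, 1:]) a" for a e
  proof -
    have "coeff (coeff ?g' a) e = coeff (monom ?k (i + j - m)) e * coeff ([:c, 1:] ^ j) a"
      unfolding U V by (simp add: coeff_map_poly mult.commute)
    moreover have "pcompose (monom ?k j) [:c, 1:] = smult ?k ([:c, 1:] ^ j)"
    proof -
      have "ring_morph (\<lambda>p. pcompose p [:c, 1:])"
        by (rule ring_morphI) (simp_all add: pcompose_add pcompose_mult one_pCons pcompose_pCons)
      from ring_morph_power[OF this, of "[:0, 1:]" j] show ?thesis
        by (simp add: monom_altdef pcompose_smult pcompose_pCons)
    qed
    ultimately show ?thesis using ij by (auto simp: hom_part_u_monomial coeff_monom)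
  qed
  with 1 show "\<exists>g'. chart_pullback (Some c) (const2 ?k * U2 ^ i * V2 ^ j) = U2 ^ m * g' \<and>
    (\<forall>e a. coeff (coeff g' a) e = coeff (pcompose (hom_part_u (m + e) (const2 ?k * U2 ^ i * V2 ^ j)) [:c, 1:]) a)"
    by blast
qed

text \<open>
  In the chart of the direction \<open>u = 0\<close>, the part of degree \<open>n\<close> becomes \<open>v\<^sup>n\<close> times its value at
  \<open>(u, 1)\<close>.
\<close>

lemma chart_pullback_None:
  fixes g :: "'a::field poly2"
  assumes "\<And>i j. i + j < m \<Longrightarrow> coeff (coeff g j) i = 0"
  shows "\<exists>g'. chart_pullback None g = V2 ^ m * g' \<and> (\<forall>e. coeff g' e = hom_part_v (m + e) g)"
proof (rule poly2_monomial_induct[of _ g])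
  show "\<exists>g'. chart_pullback None 0 = V2 ^ m * g' \<and> (\<forall>e. coeff g' e = hom_part_v (m + e) 0)"
    by (intro exI[of _ 0]) (simp add: hom_part_zero subst2_simps ring_morph_const2)
next
  fix f g :: "'a poly2"
  assume "\<exists>g'. chart_pullback None f = V2 ^ m * g' \<and> (\<forall>e. coeff g' e = hom_part_v (m + e) f)"
    "\<exists>g'. chart_pullback None g = V2 ^ m * g' \<and> (\<forall>e. coeff g' e = hom_part_v (m + e) g)"
  then obtain f' g' where "chart_pullback None f = V2 ^ m * f'" "chart_pullback None g = V2 ^ m * g'"
    "\<forall>e. coeff f' e = hom_part_v (m + e) f" "\<forall>e. coeff g' e = hom_part_v (m + e) g"
    by (elim exE conjE)
  then show "\<exists>g'. chart_pullback None (f + g) = V2 ^ m * g' \<and> (\<forall>e. coeff g' e = hom_part_v (m + e) (f + g))"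
    by (intro exI[of _ "f' + g'"]) (simp add: hom_part_v_add subst2_simps ring_morph_const2 distrib_left)
next
  fix i j
  let ?k = "coeff (coeff g j) i"
  assume "?k \<noteq> 0"
  then have ij: "m \<le> i + j" using assms by (meson not_less)
  let ?g' = "const2 ?k * U2 ^ i * V2 ^ (i + j - m)"
  have "chart_pullback None (const2 ?k * U2 ^ i * V2 ^ j) = const2 ?k * U2 ^ i * V2 ^ (i + j)"
    by (simp add: subst2_simps ring_morph_const2 power_mult_distrib power_add mult.assoc)
  also have "V2 ^ (i + j) = V2 ^ m * (V2 ^ (i + j - m) :: 'a poly2)"
    using ij by (simp flip: power_add)
  finally have 1: "chart_pullback None (const2 ?k * U2 ^ i * V2 ^ j) = V2 ^ m * ?g'"
    by (simp only: mult_ac)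
  have "coeff ?g' e = hom_part_v (m + e) (const2 ?k * U2 ^ i * V2 ^ j)" for e
    using ij by (intro poly_eqI) (auto simp: coeff2_monomial hom_part_v_monomial coeff_monom)
  with 1 show "\<exists>g'. chart_pullback None (const2 ?k * U2 ^ i * V2 ^ j) = V2 ^ m * g' \<and>
     (\<forall>e. coeff g' e = hom_part_v (m + e) (const2 ?k * U2 ^ i * V2 ^ j))"
    by blast
qed

lemma ex_coeff2_nonzero: "g \<noteq> 0 \<Longrightarrow> \<exists>i j. coeff (coeff g j) i \<noteq> 0"
  by (metis coeff_0 poly_eqI)

lemma virt_mult_origin_coeff:
  assumes "g \<in> \<Lambda>" "i + j < virt_mult_origin \<Lambda>"
  shows "coeff (coeff g j) i = 0"
proof (rule ccontr)
  assume nz: "coeff (coeff g j) i \<noteq> 0"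
  then have "g \<noteq> 0" by auto
  then have "virt_mult_origin \<Lambda> \<le> mult_origin g"
    unfolding virt_mult_origin_def using assms(1) by (intro Least_le) blast
  moreover have "mult_origin g \<le> i + j" unfolding mult_origin_def using nz by (intro Least_le) blast
  ultimately show False using assms(2) by simp
qed

lemma virt_mult_origin_le: "g \<in> \<Lambda> \<Longrightarrow> coeff (coeff g j) i \<noteq> 0 \<Longrightarrow> virt_mult_origin \<Lambda> \<le> i + j"
  using virt_mult_origin_coeff[of g \<Lambda> i j] by (meson not_less)

lemma virt_mult_origin_attained:
  assumes "g0 \<in> \<Lambda>" "g0 \<noteq> 0"
  shows "\<exists>g\<in>\<Lambda>. \<exists>i j. coeff (coeff g j) i \<noteq> 0 \<and> i + j = virt_mult_origin \<Lambda>"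
proof -
  have "\<exists>g\<in>\<Lambda>. g \<noteq> 0 \<and> mult_origin g = virt_mult_origin \<Lambda>"
    unfolding virt_mult_origin_def by (rule LeastI_ex) (use assms in blast)
  then obtain g where g: "g \<in> \<Lambda>" "g \<noteq> 0" "mult_origin g = virt_mult_origin \<Lambda>" by blast
  have "\<exists>i j. coeff (coeff g j) i \<noteq> 0 \<and> i + j = mult_origin g"
    unfolding mult_origin_def by (rule LeastI_ex) (use ex_coeff2_nonzero[OF g(2)] in blast)
  then show ?thesis using g by auto
qed

text \<open>
  On the exceptional curve the transform of a member of minimal multiplicity \<open>m\<close> is its initial form,
  a nonzero polynomial of degree at most \<open>m\<close> in the coordinate of that curve. It cannot vanish to an
  order exceeding \<open>m\<close> at any point. The nonzero member that is found along the way keeps the virtual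
  multiplicity meaningful at the next blowing up.
\<close>

lemma virt_mult_origin_blowup:
  fixes \<Lambda> :: "'a::field poly2 set"
  assumes "g0 \<in> \<Lambda>" "g0 \<noteq> 0"
  shows "(\<exists>g'\<in>blowup_system t \<Lambda>. g' \<noteq> 0) \<and> virt_mult_origin (blowup_system t \<Lambda>) \<le> virt_mult_origin \<Lambda>"
proof -
  let ?m = "virt_mult_origin \<Lambda>"
  obtain g i j where g: "g \<in> \<Lambda>" "coeff (coeff g j) i \<noteq> 0" "i + j = ?m"
    using virt_mult_origin_attained[OF assms] by blast
  have "\<exists>g'\<in>blowup_system t \<Lambda>. \<exists>a b. coeff (coeff g' b) a \<noteq> 0 \<and> a + b \<le> ?m"
  proof (cases t)
    case None
    obtain g' where g': "chart_pullback None g = V2 ^ ?m * g'" "\<And>e. coeff g' e = hom_part_v (?m + e) g"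
      using chart_pullback_None[OF virt_mult_origin_coeff[OF g(1)]] by blast
    have "g' \<in> blowup_system t \<Lambda>" unfolding blowup_system_def None using g(1) g'(1) by auto
    moreover have "coeff (coeff g' 0) i \<noteq> 0" 
    proof -
      have "i \<le> ?m" "?m - i = j" using g(3) by linarith+
      then show ?thesis using g(2) g'(2)[of 0] by (simp add: coeff_hom_part_v)
    qed
    ultimately show ?thesis using g(3) by (intro bexI[of _ g'] exI[of _ i] exI[of _ 0]) auto
  next
    case (Some c)
    obtain g' where g': "chart_pullback (Some c) g = U2 ^ ?m * g'"
      "\<And>e a. coeff (coeff g' a) e = coeff (pcompose (hom_part_u (?m + e) g) [:c, 1:]) a"
      using chart_pullback_Some[OF virt_mult_origin_coeff[OF g(1)]] by blast
    have in_b: "g' \<in> blowup_system t \<Lambda>" unfolding blowup_system_def Some using g(1) g'(1) by auto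
    let ?h = "hom_part_u ?m g"
    let ?q = "pcompose ?h [:c, 1:]"
    have "coeff ?h j \<noteq> 0" 
    proof -
      have "j \<le> ?m" "?m - j = i" using g(3) by linarith+
      then show ?thesis using g(2) by (simp add: coeff_hom_part_u)
    qed
    then have "?q \<noteq> 0" using pcompose_eq_0[of ?h "[:c, 1:]"] by auto
    moreover have "Polynomial.degree ?q \<le> ?m"
    proof -
      have "Polynomial.degree ?h \<le> ?m" by (rule degree_le) (auto simp: coeff_hom_part_u)
      then show ?thesis by (simp add: degree_pcompose)
    qed
    ultimately have "coeff (coeff g' (Polynomial.degree ?q)) 0 \<noteq> 0" "Polynomial.degree ?q \<le> ?m"
      using g'(2)[of "Polynomial.degree ?q" 0] by simp_all
    then show ?thesis using in_b by (intro bexI[of _ g'] exI[of _ 0] exI[of _ "Polynomial.degree ?q"]) auto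
  qed
  then obtain g' a b where g': "g' \<in> blowup_system t \<Lambda>" "coeff (coeff g' b) a \<noteq> 0" "a + b \<le> ?m" by blast
  then have "g' \<noteq> 0" by auto
  then show ?thesis using g' virt_mult_origin_le[OF g'(1,2)] by fastforce
qed

lemma virt_mult_infinitely_near_le:
  fixes F :: "'a::field triple"
  assumes "g0 \<in> system_at F (p, ts)" "g0 \<noteq> 0"
  shows "virt_mult F (p, ts @ us) \<le> virt_mult F (p, ts) \<and> (\<exists>g\<in>system_at F (p, ts @ us). g \<noteq> 0)"
proof (induction us rule: rev_induct)
  case Nil then show ?case using assms by auto
next
  case (snoc u us)
  then obtain g where g: "g \<in> system_at F (p, ts @ us)" "g \<noteq> 0" by blast
  have "system_at F (p, ts @ us @ [u]) = blowup_system u (system_at F (p, ts @ us))" by simp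
  then show ?case using snoc virt_mult_origin_blowup[OF g, of u] unfolding virt_mult_def by auto
qed

text \<open>
  Frames of the plane. In the frame of \<open>p\<close> this point is \<open>(0, 0, 1)\<close>, and setting \<open>z = 1\<close> gives the
  affine coordinates used for local equations. The shear by \<open>\<nu>\<close> serves to move the line \<open>x = 0\<close>
  through \<open>p\<close> away from finitely many other points. The scalars enter through \<open>\<phi>\<close>, so that one formula
  applies to points over the field and to triples of polynomials.
\<close>

section \<open>Frames of the plane\<close>

fun to_std :: "('a::field \<Rightarrow> 'b::comm_ring_1) \<Rightarrow> 'a \<times> 'a \<times> 'a \<Rightarrow> 'a \<Rightarrow> 'b \<times> 'b \<times> 'b \<Rightarrow> 'b \<times> 'b \<times> 'b" where
  "to_std \<phi> (a, b, c) \<nu> (x, y, z) =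
     (if a \<noteq> 0 then (z, \<phi> b * z + (x - \<phi> \<nu> * y), \<phi> c * z + y)
      else if b \<noteq> 0 then (x - \<phi> \<nu> * y, z, \<phi> c * z + y)
      else (x - \<phi> \<nu> * y, y, z))"

fun from_std :: "('a::field \<Rightarrow> 'b::comm_ring_1) \<Rightarrow> 'a \<times> 'a \<times> 'a \<Rightarrow> 'a \<Rightarrow> 'b \<times> 'b \<times> 'b \<Rightarrow> 'b \<times> 'b \<times> 'b" where
  "from_std \<phi> (a, b, c) \<nu> (x, y, z) =
     (if a \<noteq> 0 then (y - \<phi> b * x + \<phi> \<nu> * (z - \<phi> c * x), z - \<phi> c * x, x)
      else if b \<noteq> 0 then (x + \<phi> \<nu> * (z - \<phi> c * y), z - \<phi> c * y, y)
      else (x + \<phi> \<nu> * y, y, z))"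

fun subst_at :: "('a::comm_ring_1 \<Rightarrow> 'b::comm_ring_1) \<Rightarrow> 'a poly3 \<Rightarrow> 'b \<times> 'b \<times> 'b \<Rightarrow> 'b" where
  "subst_at \<phi> f (a, b, c) = subst3 \<phi> f a b c"

fun map_triple :: "('b \<Rightarrow> 'c) \<Rightarrow> 'b \<times> 'b \<times> 'b \<Rightarrow> 'c \<times> 'c \<times> 'c" where
  "map_triple h (a, b, c) = (h a, h b, h c)"

lemma from_std_to_std: "from_std \<phi> p \<nu> (to_std \<phi> p \<nu> P) = P"
  by (cases p; cases P) simp

lemma to_std_from_std: "to_std \<phi> p \<nu> (from_std \<phi> p \<nu> P) = P"
  by (cases p; cases P) simp

lemma map_to_std:
  "ring_morph h \<Longrightarrow> map_triple h (to_std \<phi> p \<nu> P) = to_std (\<lambda>x. h (\<phi> x)) p \<nu> (map_triple h P)"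
  by (cases p; cases P) (simp add: ring_morph_simps)

lemma map_from_std:
  "ring_morph h \<Longrightarrow> map_triple h (from_std \<phi> p \<nu> P) = from_std (\<lambda>x. h (\<phi> x)) p \<nu> (map_triple h P)"
  by (cases p; cases P) (simp add: ring_morph_simps)

lemma ring_morph_subst_at: "ring_morph \<phi> \<Longrightarrow> ring_morph (\<lambda>f. subst_at \<phi> f P)"
  by (cases P) (simp add: ring_morph_subst3)

lemma morph_subst_at:
  "ring_morph \<Phi> \<Longrightarrow> ring_morph \<phi> \<Longrightarrow> \<Phi> (subst_at \<phi> f P) = subst_at (\<lambda>x. \<Phi> (\<phi> x)) f (map_triple \<Phi> P)"
  by (cases P) (simp add: morph_subst3)

lemma map_subst_XYZ: "ring_morph \<phi> \<Longrightarrow> map_triple (\<lambda>f. subst_at \<phi> f P) (X3, Y3, Z3) = P"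
  by (cases P) (simp add: subst3_simps)

definition coord :: "'a::field \<times> 'a \<times> 'a \<Rightarrow> 'a \<Rightarrow> 'a poly3 \<Rightarrow> 'a poly3" where
  "coord p \<nu> f = subst_at const3 f (to_std const3 p \<nu> (X3, Y3, Z3))"

definition uncoord :: "'a::field \<times> 'a \<times> 'a \<Rightarrow> 'a \<Rightarrow> 'a poly3 \<Rightarrow> 'a poly3" where
  "uncoord p \<nu> f = subst_at const3 f (from_std const3 p \<nu> (X3, Y3, Z3))"

lemma ring_morph_coord: "ring_morph (coord p \<nu>)"
  unfolding coord_def[abs_def] by (intro ring_morph_subst_at ring_morph_const3)

lemma ring_morph_uncoord: "ring_morph (uncoord p \<nu>)"
  unfolding uncoord_def[abs_def] by (intro ring_morph_subst_at ring_morph_const3)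

lemma subst_at_const3: "ring_morph \<phi> \<Longrightarrow> subst_at \<phi> (const3 k) P = \<phi> k"
  by (cases P) (simp add: subst3_simps)

text \<open>
  A change of variables in the equation is a change of coordinates of the point.
\<close>

lemma subst_at_coord:
  assumes "ring_morph \<phi>" shows "subst_at \<phi> (coord p \<nu> f) P = subst_at \<phi> f (to_std \<phi> p \<nu> P)"
  unfolding coord_def morph_subst_at[OF ring_morph_subst_at[OF assms] ring_morph_const3]
    map_to_std[OF ring_morph_subst_at[OF assms]] subst_at_const3[OF assms] map_subst_XYZ[OF assms] ..

lemma subst_at_uncoord:
  assumes "ring_morph \<phi>" shows "subst_at \<phi> (uncoord p \<nu> f) P = subst_at \<phi> f (from_std \<phi> p \<nu> P)"
  unfolding uncoord_def morph_subst_at[OF ring_morph_subst_at[OF assms] ring_morph_const3]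
    map_from_std[OF ring_morph_subst_at[OF assms]] subst_at_const3[OF assms] map_subst_XYZ[OF assms] ..

lemma subst_at_id: "subst_at const3 f (X3, Y3, Z3) = f"
  by (simp add: subst3_id)

lemma coord_uncoord: "coord p \<nu> (uncoord p \<nu> f) = f"
  using subst_at_uncoord[OF ring_morph_const3, of p \<nu> f "to_std const3 p \<nu> (X3, Y3, Z3)"]
  by (simp only: coord_def from_std_to_std subst_at_id)

lemma uncoord_coord: "uncoord p \<nu> (coord p \<nu> f) = f"
  using subst_at_coord[OF ring_morph_const3, of p \<nu> f "from_std const3 p \<nu> (X3, Y3, Z3)"]
  by (simp only: uncoord_def to_std_from_std subst_at_id)

lemma coord_const3: "coord p \<nu> (const3 k) = const3 k"
  and uncoord_const3: "uncoord p \<nu> (const3 k) = const3 k"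
  by (simp_all add: coord_def uncoord_def subst_at_const3 ring_morph_const3)

lemma is_form_uminus: "is_form d f \<Longrightarrow> is_form d (- f)"
  unfolding is_form_def by simp

lemma is_form_diff: "is_form d f \<Longrightarrow> is_form d g \<Longrightarrow> is_form d (f - g)"
  using is_form_add[of d f "- g"] is_form_uminus[of d g] by simp

lemma is_form_const_mult: "is_form d f \<Longrightarrow> is_form d (const3 c * f)"
  using is_form_mult[OF is_form_const3] by fastforce

lemma is_form_coord:
  assumes "is_form d f" shows "is_form d (coord p \<nu> f)"
proof -
  obtain A B C where P: "to_std const3 p \<nu> (X3, Y3, Z3) = (A, B, C)" by (metis prod_cases3)
  have "is_form 1 A \<and> is_form 1 B \<and> is_form 1 C"
    using P by (cases p) (auto split: if_splits intro!: is_form_add is_form_diff is_form_const_mult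
      is_form_X3[unfolded One_nat_def] is_form_Y3[unfolded One_nat_def] is_form_Z3[unfolded One_nat_def])
  then show ?thesis using is_form_subst3[OF assms, of 1 A B C] by (simp add: coord_def P)
qed

text \<open>
  This turns multiplicities into degrees: for a form of degree \<open>d\<close>, multiplicity at least \<open>m\<close> at \<open>p\<close>
  means degree at most \<open>d - m\<close> in \<open>z\<close> in the frame of \<open>p\<close>.
\<close>

lemma local_equation_coord: "local_equation p f = poly (coord p 0 f) 1"
proof -
  have "poly (coord p 0 f) 1 = subst_at const2 (coord p 0 f) (U2, V2, 1)"
    by (simp add: subst3_dehomogenize)
  also have "\<dots> = subst_at const2 f (to_std const2 p 0 (U2, V2, 1))"
    by (rule subst_at_coord[OF ring_morph_const2])
  also have "\<dots> = local_equation p f"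
    by (cases p) (simp add: ring_morph_zero ring_morph_const2)
  finally show ?thesis ..
qed

lemma coeff_local_equation:
  assumes "is_form d f" "coeff3 (coord p 0 f) i j l \<noteq> 0"
  shows "coeff (coeff (local_equation p f) j) i = coeff3 (coord p 0 f) i j l" "i + j + l = d"
proof -
  have fm: "is_form d (coord p 0 f)" using assms(1) by (rule is_form_coord)
  show d: "i + j + l = d" using fm assms(2) unfolding is_form_def by blast
  then have "i + j \<le> d" "d - i - j = l" by linarith+
  then show "coeff (coeff (local_equation p f) j) i = coeff3 (coord p 0 f) i j l"
    using coeff_dehomogenize[OF fm, of j i] by (simp only: local_equation_coord if_True)
qed

lemma local_equation_nonzero:
  assumes "is_form d f" "f \<noteq> 0" shows "local_equation p f \<noteq> 0"
proof -
  have "coord p 0 f \<noteq> 0"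
    using assms(2) uncoord_coord[of p 0 f] ring_morph_zero[OF ring_morph_uncoord] by metis
  then obtain i j l where nz: "coeff3 (coord p 0 f) i j l \<noteq> 0" by (metis coeff_0 poly_eqI)
  then have "coeff (coeff (local_equation p f) j) i \<noteq> 0"
    by (simp only: coeff_local_equation(1)[OF assms(1) nz] not_False_eq_True)
  then show ?thesis by (metis coeff_0)
qed

lemma coord_coeff_zero:
  assumes f: "is_form d f" and m: "\<And>i j. i + j < m \<Longrightarrow> coeff (coeff (local_equation p f) j) i = 0"
    and l: "d < l + m"
  shows "coeff (coord p 0 f) l = 0"
proof (rule ccontr)
  assume "coeff (coord p 0 f) l \<noteq> 0"
  then obtain i j where nz: "coeff3 (coord p 0 f) i j l \<noteq> 0" by (metis coeff_0 poly_eqI)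
  show False using coeff_local_equation[OF f nz] m[of i j] nz l by auto
qed

text \<open>
  In the frame of \<open>q\<close> the first two coordinates of a point \<open>s q + \<pi> v\<close> are divisible by \<open>\<pi>\<close>. The
  target ring is arbitrary. It is later the ring of polynomials on a line, where this is the usual
  order of contact, and the ring \<open>k[x,y,z]\<close>, with the equation of a line through \<open>q\<close> as \<open>\<pi>\<close>.
\<close>

lemma order_at_point:
  fixes q :: "'a::field \<times> 'a \<times> 'a"
  assumes f: "is_form d f" and m: "\<And>i j. i + j < m \<Longrightarrow> coeff (coeff (local_equation q f) j) i = 0"
    and q: "q \<in> proj_plane" "q = (q0, q1, q2)" and \<phi>: "ring_morph \<phi>"
  shows "\<pi> ^ m dvd subst_at \<phi> f (s * \<phi> q0 + \<pi> * v0, s * \<phi> q1 + \<pi> * v1, s * \<phi> q2 + \<pi> * v2)"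
    (is "_ dvd subst_at \<phi> f ?P")
proof -
  have "\<exists>a b c. from_std \<phi> q 0 ?P = (\<pi> * a, \<pi> * b, c)"
  proof -
    consider (a) "q0 = 1" | (b) "q0 = 0" "q1 = 1" | (c) "q0 = 0" "q1 = 0"
      using q unfolding proj_plane_def by auto
    then show ?thesis
    proof cases
      case a
      have "from_std \<phi> q 0 ?P = (\<pi> * (v1 - \<phi> q1 * v0), \<pi> * (v2 - \<phi> q2 * v0), s * \<phi> q0 + \<pi> * v0)"
        using a \<phi> by (simp add: q(2) ring_morph_simps algebra_simps)
      then show ?thesis by blast
    next
      case b
      have "from_std \<phi> q 0 ?P = (\<pi> * v0, \<pi> * (v2 - \<phi> q2 * v1), s * \<phi> q1 + \<pi> * v1)"
        using b \<phi> by (simp add: q(2) ring_morph_simps algebra_simps)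
      then show ?thesis by blast
    next
      case c
      have "from_std \<phi> q 0 ?P = (\<pi> * v0, \<pi> * v1, s * \<phi> q2 + \<pi> * v2)"
        using c \<phi> by (simp add: q(2) ring_morph_simps)
      then show ?thesis by blast
    qed
  qed
  then obtain a b c where abc: "from_std \<phi> q 0 ?P = (\<pi> * a, \<pi> * b, c)" by blast
  have "subst_at \<phi> f ?P = subst_at \<phi> (coord q 0 f) (\<pi> * a, \<pi> * b, c)"
    by (simp only: subst_at_coord[OF \<phi>] abc[symmetric] to_std_from_std)
  then show ?thesis
    using form_subst3_order[OF is_form_coord[OF f] coord_coeff_zero[OF f m] \<phi>, where m = m] by simp
qed

text \<open>
  The shear leaves \<open>z\<close> alone and acts on the coefficient of each power of \<open>z\<close> separately.
\<close>

lemma coeff_coord_shift: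
  "coeff (coord p \<nu> f) l = subst2 const2 (coeff (coord p 0 f) l) (U2 - const2 \<nu> * V2) V2"
proof -
  have "coord p \<nu> f = subst_at const3 (coord p 0 f) (X3 - const3 \<nu> * Y3, Y3, Z3)"
    unfolding subst_at_coord[OF ring_morph_const3] unfolding coord_def
    by (cases p) (simp add: ring_morph_zero ring_morph_const3)
  also have "\<dots> = subst3 const3 (coord p 0 f) [:U2 - const2 \<nu> * V2:] [:V2:] Z3"
    by (simp add: X3_def Y3_def U2_def V2_def const3_def const2_def)
  also have "\<dots> = map_poly (\<lambda>g. subst2 const2 g (U2 - const2 \<nu> * V2) V2) (coord p 0 f)" (is "_ = map_poly ?\<psi> _")
  proof -
    have \<psi>: "ring_morph ?\<psi>" by (intro ring_morph_subst2 ring_morph_const2)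
    have c: "subst2 const3 g [:A:] [:B:] = [:subst2 const2 g A B:]" for g :: "'a poly2" and A B
      by (rule morph_eq_poly2[of "\<lambda>g. subst2 const3 g [:A:] [:B:]" "\<lambda>g. [:subst2 const2 g A B:]"])
         (simp_all add: ring_morph_subst2 ring_morph_const3 ring_morph_const2 ring_morph_comp[OF ring_morph_const]
          subst2_simps, simp add: const3_def const2_def)
    have mm: "ring_morph (map_poly ?\<psi>)"
      by (rule ring_morphI) (rule map_poly_1', rule ring_morph_one[OF \<psi>],
          simp_all only: map_poly_add_morph map_poly_mult_morph \<psi>)
    show ?thesis
    proof (rule morph_eq_poly[OF ring_morph_subst3[OF ring_morph_const3] mm])
      show "subst3 const3 [:g:] [:U2 - const2 \<nu> * V2:] [:V2:] Z3 = map_poly ?\<psi> [:g:]" for g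
        by (simp add: subst3_const ring_morph_const3 c map_poly_pCons ring_morph_zero[OF \<psi>])
      show "subst3 const3 [:0, 1:] [:U2 - const2 \<nu> * V2:] [:V2:] Z3 = map_poly ?\<psi> [:0, 1:]"
        using subst3_Z3[OF ring_morph_const3, of "[:U2 - const2 \<nu> * V2:]" "[:V2:]" Z3]
        by (simp add: Z3_def[symmetric]) (simp add: Z3_def map_poly_pCons ring_morph_zero[OF \<psi>] ring_morph_one[OF \<psi>])
    qed
  qed
  finally show ?thesis by (simp add: coeff_map_poly ring_morph_zero[OF ring_morph_subst2] ring_morph_const2)
qed

lemma proj_plane_eqI:
  assumes "(a, b, c) \<in> proj_plane" "(s * a, s * b, s * c) \<in> proj_plane"
  shows "s = 1"
  using assms unfolding proj_plane_def by auto

lemma proj_plane_normalise: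
  fixes a b c :: "'a::field"
  assumes "(a, b, c) \<noteq> (0, 0, 0)"
  shows "\<exists>s q0 q1 q2. s \<noteq> 0 \<and> (q0, q1, q2) \<in> proj_plane \<and> (a, b, c) = (s * q0, s * q1, s * q2)"
proof -
  consider (a) "a \<noteq> 0" | (b) "a = 0" "b \<noteq> 0" | (c) "a = 0" "b = 0" "c \<noteq> 0" using assms by auto
  then show ?thesis
  proof cases
    case a then show ?thesis
      by (intro exI[of _ a] exI[of _ 1] exI[of _ "b / a"] exI[of _ "c / a"]) (simp add: proj_plane_def)
  next
    case b then show ?thesis
      by (intro exI[of _ b] exI[of _ 0] exI[of _ 1] exI[of _ "c / b"]) (simp add: proj_plane_def)
  next
    case c then show ?thesis
      by (intro exI[of _ c] exI[of _ 0] exI[of _ 0] exI[of _ 1]) (simp add: proj_plane_def)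
  qed
qed

section \<open>Pencils of quadratic polynomials\<close>

text \<open>
  Over a finite field \<open>1 + \<Prod>a. (x - a)\<close> has no root.
\<close>

lemma infinite_UNIV_alg_closed: "infinite (UNIV :: 'a::alg_closed_field set)"
proof
  assume fin: "finite (UNIV :: 'a set)"
  let ?p = "(\<Prod>a\<in>UNIV. [:- a, 1:]) :: 'a poly"
  have "Polynomial.degree ?p = (\<Sum>a\<in>(UNIV::'a set). Polynomial.degree [:- a, 1:])"
    by (rule degree_prod_sum_eq) simp
  then have "Polynomial.degree ?p = card (UNIV :: 'a set)" by simp
  then have dp: "Polynomial.degree ?p > 0" using fin by (simp add: card_gt_0_iff)
  have "Polynomial.degree (?p + 1) = Polynomial.degree ?p" using dp by (intro degree_add_eq_left) simp
  then obtain x where x: "poly (?p + 1) x = 0" using alg_closed_imp_poly_has_root[of "?p + 1"] dp by auto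
  have "poly ?p x = 0" unfolding poly_prod using fin by (intro prod_zero bexI[of _ x]) simp_all
  then show False using x by simp
qed

lemma poly2_nonvanishing_point:
  fixes \<Phi> :: "'a::alg_closed_field poly2"
  assumes "\<Phi> \<noteq> 0"
  shows "\<exists>x y. poly (poly \<Phi> [:y:]) x \<noteq> 0"
proof -
  have "finite ((\<lambda>y. [:y:]) -` {q. poly \<Phi> q = 0})"
    by (intro finite_vimageI poly_roots_finite assms) (simp add: inj_def)
  then obtain y where "y \<notin> (\<lambda>y. [:y:]) -` {q. poly \<Phi> q = 0}"
    using infinite_UNIV_alg_closed by (metis ex_new_if_finite)
  then have "poly \<Phi> [:y:] \<noteq> 0" by simp
  then have "finite {x. poly (poly \<Phi> [:y:]) x = 0}" by (rule poly_roots_finite)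
  then obtain x where "x \<notin> {x. poly (poly \<Phi> [:y:]) x = 0}"
    using infinite_UNIV_alg_closed by (metis ex_new_if_finite)
  then show ?thesis by blast
qed

text \<open>
  Monic linear polynomials over a domain are prime.
\<close>

lemma linear_power_dvd_cancel:
  fixes a :: "'b::idom"
  shows "[:- a, 1:] ^ n dvd p * q \<Longrightarrow> poly p a \<noteq> 0 \<Longrightarrow> [:- a, 1:] ^ n dvd q"
proof (induction n arbitrary: q)
  case 0 then show ?case by simp
next
  case (Suc n)
  have "[:- a, 1:] dvd p * q" using Suc.prems(1) by (metis dvd_mult_left power_Suc)
  then have "poly q a = 0" using Suc.prems(2) unfolding poly_eq_0_iff_dvd[symmetric] by simp
  then obtain q' where q': "q = [:- a, 1:] * q'" unfolding poly_eq_0_iff_dvd by (elim dvdE)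
  have "[:- a, 1:] * [:- a, 1:] ^ n dvd [:- a, 1:] * (p * q')"
    using Suc.prems(1) unfolding q' power_Suc by (simp only: mult.left_commute)
  then have "[:- a, 1:] ^ n dvd p * q'" unfolding dvd_mult_cancel_left by simp
  then have "[:- a, 1:] ^ n dvd q'" using Suc by blast
  then show ?case unfolding q' power_Suc by (rule mult_dvd_mono[OF dvd_refl])
qed

text \<open>
  The base ring is only a domain, since the lemma is needed over \<open>k[x]\<close>; the factors are then not
  comaximal and are split off one after the other.
\<close>

lemma prod_linear_powers_dvd:
  fixes a :: "'i \<Rightarrow> 'b::idom"
  assumes "finite T" "inj_on a T" "\<And>t. t \<in> T \<Longrightarrow> [:- a t, 1:] ^ E t dvd D"
  shows "(\<Prod>t\<in>T. [:- a t, 1:] ^ E t) dvd D"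
  using assms
proof (induction T rule: finite_induct)
  case empty then show ?case by simp
next
  case (insert t T)
  have "(\<Prod>t\<in>T. [:- a t, 1:] ^ E t) dvd D" using insert by (auto intro: inj_on_subset)
  then obtain Q where Q: "D = (\<Prod>t\<in>T. [:- a t, 1:] ^ E t) * Q" by (elim dvdE)
  have nz: "poly (\<Prod>t\<in>T. [:- a t, 1:] ^ E t) (a t) \<noteq> 0"
    unfolding poly_prod prod_zero_iff[OF insert(1)] using insert(2) insert.prems(1) by (auto simp: inj_on_def)
  have "[:- a t, 1:] ^ E t dvd (\<Prod>t\<in>T. [:- a t, 1:] ^ E t) * Q" using insert.prems(2) Q by blast
  then have "[:- a t, 1:] ^ E t dvd Q" using linear_power_dvd_cancel nz by blast
  then have "(\<Prod>t\<in>T. [:- a t, 1:] ^ E t) * [:- a t, 1:] ^ E t dvd D" unfolding Q by (rule mult_dvd_mono[OF dvd_refl])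
  then show ?case unfolding prod.insert[OF insert(1,2)] by (simp only: mult.commute)
qed

lemma degree_prod_linear_powers:
  fixes a :: "'i \<Rightarrow> 'b::idom"
  shows "finite T \<Longrightarrow> Polynomial.degree (\<Prod>t\<in>T. [:- a t, 1:] ^ E t) = (\<Sum>t\<in>T. E t)"
  by (subst degree_prod_sum_eq) (auto simp: degree_power_eq)

lemma lead_coeff_prod_linear_powers:
  fixes a :: "'i \<Rightarrow> 'b::idom"
  shows "Polynomial.lead_coeff (\<Prod>t\<in>T. [:- a t, 1:] ^ E t) = 1"
  by (simp add: lead_coeff_prod lead_coeff_power)

text \<open>
  The roots of \<open>v\<close> are removed from \<open>v\<close> and \<open>c\<close> one at a time.
\<close>

lemma dvd_no_common_root:
  fixes u v :: "'a::alg_closed_field poly"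
  assumes "v \<noteq> 0" "\<And>r. poly v r = 0 \<Longrightarrow> poly u r \<noteq> 0" "v dvd c * u ^ n"
  shows "v dvd c"
  using assms
proof (induction "Polynomial.degree v" arbitrary: v c)
  case 0
  then have "is_unit v" by (simp add: is_unit_iff_degree)
  then show ?case by (rule unit_imp_dvd)
next
  case (Suc k)
  obtain r where r: "poly v r = 0" using alg_closed_imp_poly_has_root[of v] Suc(2) by auto
  then obtain v' where v': "v = [:- r, 1:] * v'" unfolding poly_eq_0_iff_dvd by (elim dvdE)
  have nz: "v' \<noteq> 0" using v' Suc.prems(1) by auto
  have dg: "k = Polynomial.degree v'" using Suc(2) nz unfolding v' by (subst (asm) degree_mult_eq) auto
  have "[:- r, 1:] dvd c * u ^ n" using Suc.prems(3) v' dvd_mult_left by blast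
  then have "poly c r = 0" using Suc.prems(2)[OF r] unfolding poly_eq_0_iff_dvd[symmetric] by simp
  then obtain c' where c': "c = [:- r, 1:] * c'" unfolding poly_eq_0_iff_dvd by (elim dvdE)
  have "[:- r, 1:] * v' dvd [:- r, 1:] * (c' * u ^ n)" using Suc.prems(3) unfolding v' c' by (simp only: mult.assoc)
  then have "v' dvd c' * u ^ n" unfolding dvd_mult_cancel_left by simp
  moreover have "poly u r' \<noteq> 0" if "poly v' r' = 0" for r' using that Suc.prems(2)[of r'] v' by simp
  ultimately have "v' dvd c'" using Suc.hyps(1)[OF dg nz] by blast
  then show ?case unfolding v' c' by (rule mult_dvd_mono[OF dvd_refl])
qed

text \<open>
  Forms of degree \<open>e\<close> in \<open>u\<close> and \<open>v\<close>, arranged such that reduction modulo \<open>v\<close> leaves a multiple of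
  \<open>u\<^sup>e\<close>.
\<close>

fun binary_forms :: "nat \<Rightarrow> 'a::comm_ring_1 poly \<Rightarrow> 'a poly \<Rightarrow> 'a poly set" where
  "binary_forms 0 u v = range (\<lambda>c. [:c:])"
| "binary_forms (Suc e) u v = {smult q (u ^ Suc e) + v * w | q w. w \<in> binary_forms e u v}"

lemma binary_forms_zero: "0 \<in> binary_forms e u v"
proof (induction e)
  case 0 then show ?case by (auto intro!: image_eqI[of _ _ 0])
next
  case (Suc e) then show ?case unfolding binary_forms.simps by (intro CollectI exI[of _ 0]) simp
qed

lemma binary_forms_add: "w1 \<in> binary_forms e u v \<Longrightarrow> w2 \<in> binary_forms e u v \<Longrightarrow> w1 + w2 \<in> binary_forms e u v"
proof (induction e arbitrary: w1 w2)
  case 0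
  then obtain a b where "w1 = [:a:]" "w2 = [:b:]" by auto
  then show ?case by (auto intro!: image_eqI[of _ _ "a + b"])
next
  case (Suc e)
  obtain q1 w1' where 1: "w1 = smult q1 (u ^ Suc e) + v * w1'" "w1' \<in> binary_forms e u v"
    using Suc.prems(1) unfolding binary_forms.simps by blast
  obtain q2 w2' where 2: "w2 = smult q2 (u ^ Suc e) + v * w2'" "w2' \<in> binary_forms e u v"
    using Suc.prems(2) unfolding binary_forms.simps by blast
  have "w1 + w2 = smult (q1 + q2) (u ^ Suc e) + v * (w1' + w2')"
    unfolding 1 2 by (simp add: smult_add_left distrib_left)
  then show ?case using Suc.IH[OF 1(2) 2(2)] unfolding binary_forms.simps by blast
qed

lemma binary_forms_smult: "w \<in> binary_forms e u v \<Longrightarrow> smult c w \<in> binary_forms e u v"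
proof (induction e arbitrary: w)
  case 0 then show ?case by auto
next
  case (Suc e)
  obtain q w' where 1: "w = smult q (u ^ Suc e) + v * w'" "w' \<in> binary_forms e u v"
    using Suc.prems unfolding binary_forms.simps by blast
  have "smult c w = smult (c * q) (u ^ Suc e) + v * smult c w'" unfolding 1 by (simp add: smult_add_right)
  then show ?case using Suc.IH[OF 1(2)] unfolding binary_forms.simps by blast
qed

lemma binary_forms_mult_v: "w \<in> binary_forms e u v \<Longrightarrow> v * w \<in> binary_forms (Suc e) u v"
  unfolding binary_forms.simps by (intro CollectI exI[of _ 0] exI[of _ w]) simp

lemma binary_forms_mult_u: "w \<in> binary_forms e u v \<Longrightarrow> u * w \<in> binary_forms (Suc e) u v"
proof (induction e arbitrary: w)
  case 0
  then obtain a where "w = [:a:]" by auto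
  then show ?case using binary_forms_zero[of 0 u v] unfolding binary_forms.simps(2)
    by (intro CollectI exI[of _ a] exI[of _ 0]) simp
next
  case (Suc e)
  obtain q w' where 1: "w = smult q (u ^ Suc e) + v * w'" "w' \<in> binary_forms e u v"
    using Suc.prems unfolding binary_forms.simps by blast
  have "u * w = smult q (u ^ Suc (Suc e)) + v * (u * w')" unfolding 1 by (simp add: distrib_left mult.left_commute)
  then show ?case using Suc.IH[OF 1(2)] unfolding binary_forms.simps(2)[of "Suc e"] by blast
qed

lemma form_in_binary_forms:
  fixes G :: "'a::comm_ring_1 poly3"
  assumes G: "is_form e G"
    and w: "\<And>w. w \<in> {w0, w1, w2} \<Longrightarrow> \<exists>\<rho> \<sigma>. w = smult \<rho> u + smult \<sigma> v"
  shows "subst3 (\<lambda>c. [:c:]) G w0 w1 w2 \<in> binary_forms e u v"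
  using G
proof (rule form_monomial_induct)
  note simps = subst3_simps ring_morph_const
  have pow: "y \<in> binary_forms n u v \<Longrightarrow> x ^ i * y \<in> binary_forms (i + n) u v" if x: "x \<in> {w0, w1, w2}" for x y i n
  proof (induction i)
    case 0 then show ?case by simp
  next
    case (Suc i)
    obtain \<rho> \<sigma> where rs: "x = smult \<rho> u + smult \<sigma> v" using w[OF x] by blast
    have "x ^ Suc i * y = smult \<rho> (u * (x ^ i * y)) + smult \<sigma> (v * (x ^ i * y))"
      by (subst power_Suc, subst (1) rs) (simp add: distrib_right mult.assoc)
    then show ?case using Suc by (simp add: binary_forms_add binary_forms_smult binary_forms_mult_u binary_forms_mult_v del: binary_forms.simps)
  qed
  fix c i j l assume e: "i + j + l = e"
  have "[:c:] \<in> binary_forms 0 u v" by simp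
  then have "w0 ^ i * (w1 ^ j * (w2 ^ l * [:c:])) \<in> binary_forms (i + (j + (l + 0))) u v"
    by (intro pow) simp_all
  then show "subst3 (\<lambda>c. [:c:]) (const3 c * X3 ^ i * Y3 ^ j * Z3 ^ l) w0 w1 w2 \<in> binary_forms e u v"
    using e by (simp add: simps mult.assoc add.assoc mult_ac)
qed (simp_all add: subst3_simps ring_morph_const binary_forms_zero binary_forms_add)

text \<open>
  The map \<open>t \<mapsto> (u(t) : v(t))\<close> has degree two, so \<open>t\<close> is not a rational function of \<open>u / v\<close>; a quotient
  \<open>w2 / w1 = t / x0\<close> would exhibit it as one. Modulo \<open>v\<close> the relation between the two forms says that
  \<open>v\<close> divides a polynomial of degree at most one times a power of \<open>u\<close>. As \<open>u\<close> and \<open>v\<close> have no common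
  root, this polynomial vanishes, and the relation can be divided by \<open>v\<close>.
\<close>

lemma no_quadratic_pencil_inverse:
  fixes u v :: "'a::alg_closed_field poly"
  assumes deg: "Polynomial.degree v = 2" and root: "\<And>r. poly v r = 0 \<Longrightarrow> poly u r \<noteq> 0"
  shows "w1 \<in> binary_forms e u v \<Longrightarrow> w2 \<in> binary_forms e u v \<Longrightarrow> smult x0 w2 = [:0, 1:] * w1 \<Longrightarrow> w1 = 0"
proof (induction e arbitrary: w1 w2)
  case 0 then show ?case by auto
next
  case (Suc e)
  obtain q w1' where 1: "w1 = smult q (u ^ Suc e) + v * w1'" "w1' \<in> binary_forms e u v"
    using Suc.prems(1) unfolding binary_forms.simps by blast
  obtain p w2' where 2: "w2 = smult p (u ^ Suc e) + v * w2'" "w2' \<in> binary_forms e u v"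
    using Suc.prems(2) unfolding binary_forms.simps by blast
  have v0: "v \<noteq> 0" using deg by auto
  have eq: "[:x0 * p, - q:] * u ^ Suc e = v * ([:0, 1:] * w1' - smult x0 w2')"
  proof -
    have "[:x0 * p, - q:] = smult x0 [:p:] - [:0, 1:] * [:q:]" by simp
    then have "[:x0 * p, - q:] * u ^ Suc e = smult x0 (smult p (u ^ Suc e)) - [:0, 1:] * smult q (u ^ Suc e)"
      by (simp add: left_diff_distrib)
    also have "\<dots> = v * ([:0, 1:] * w1' - smult x0 w2')"
      using Suc.prems(3) unfolding 1 2 by (simp add: algebra_simps smult_add_right)
    finally show ?thesis .
  qed
  then have "v dvd [:x0 * p, - q:]"
    using dvd_no_common_root[OF v0 root, of "[:x0 * p, - q:]" "Suc e"] by (metis dvd_triv_left)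
  have z: "[:x0 * p, - q:] = 0"
  proof (rule ccontr)
    assume nz: "[:x0 * p, - q:] \<noteq> 0"
    have "Polynomial.degree v \<le> Polynomial.degree [:x0 * p, - q:]" using \<open>v dvd _\<close> nz by (rule dvd_imp_degree_le)
    also have "\<dots> \<le> 1" by simp
    finally show False using deg by simp
  qed
  then have "v * ([:0, 1:] * w1' - smult x0 w2') = 0" using eq unfolding z by simp
  then have "smult x0 w2' = [:0, 1:] * w1'" using v0 by simp
  then have "w1' = 0" using Suc.IH[OF 1(2) 2(2)] by blast
  then show ?case using z unfolding 1 by simp
qed

text \<open>
  The arguments are the columns of the matrix in the application: the coefficients of \<open>z\<^sup>2\<close>, \<open>z\<close> and
  \<open>1\<close> of three quadratic polynomials.
\<close>

definition det3 :: "'b::comm_ring_1 \<times> 'b \<times> 'b \<Rightarrow> 'b \<times> 'b \<times> 'b \<Rightarrow> 'b \<times> 'b \<times> 'b \<Rightarrow> 'b" where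
  "det3 = (\<lambda>(a0, b0, c0) (a1, b1, c1) (a2, b2, c2).
     a0 * (b1 * c2 - b2 * c1) - a1 * (b0 * c2 - b2 * c0) + a2 * (b0 * c1 - b1 * c0))"

text \<open>
  A nonzero cross product of the first row with another row is orthogonal to these two, and it is
  orthogonal to the third one by the vanishing of the determinant.
\<close>

lemma orthogonal_vector:
  fixes a0 a1 a2 :: "'a::field"
  assumes a: "(a0, a1, a2) \<noteq> (0, 0, 0)" and det: "det3 (a0, b0, c0) (a1, b1, c1) (a2, b2, c2) = 0"
  shows "\<exists>k0 k1 k2. (k0, k1, k2) \<noteq> (0, 0, 0) \<and> k0 * a0 + k1 * a1 + k2 * a2 = 0 \<and>
    k0 * b0 + k1 * b1 + k2 * b2 = 0 \<and> k0 * c0 + k1 * c1 + k2 * c2 = 0"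
proof (cases "(a1 * b2 - a2 * b1, a2 * b0 - a0 * b2, a0 * b1 - a1 * b0) = (0, 0, 0)")
  case False
  show ?thesis
    using False det unfolding det3_def
    by (intro exI[of _ "a1 * b2 - a2 * b1"] exI[of _ "a2 * b0 - a0 * b2"] exI[of _ "a0 * b1 - a1 * b0"])
       (simp add: algebra_simps)
next
  case ab: True
  show ?thesis
  proof (cases "(a1 * c2 - a2 * c1, a2 * c0 - a0 * c2, a0 * c1 - a1 * c0) = (0, 0, 0)")
    case False
    show ?thesis
      using False det unfolding det3_def
      by (intro exI[of _ "a1 * c2 - a2 * c1"] exI[of _ "a2 * c0 - a0 * c2"] exI[of _ "a0 * c1 - a1 * c0"])
         (simp add: algebra_simps)
  next
    case ac: True
    \<comment> \<open>All three rows are proportional to the first.\<close>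
    obtain k0 k1 k2 where k: "(k0, k1, k2) \<noteq> (0, 0, 0)" "k0 * a0 + k1 * a1 + k2 * a2 = 0"
    proof (cases "a0 = 0 \<and> a1 = 0")
      case True then show ?thesis using that[of 1 0 0] by simp
    next
      case False then show ?thesis using that[of a1 "- a0" 0] by (auto simp: mult.commute)
    qed
    have orth: "k0 * b0 + k1 * b1 + k2 * b2 = 0"
      if "a1 * b2 - a2 * b1 = 0" "a2 * b0 - a0 * b2 = 0" "a0 * b1 - a1 * b0 = 0" for b0 b1 b2
    proof -
      have 0: "a0 * (k0 * b0 + k1 * b1 + k2 * b2) = 0"
      proof -
        have "a0 * (k0 * b0 + k1 * b1 + k2 * b2) = b0 * (k0 * a0 + k1 * a1 + k2 * a2) + k1 * (a0 * b1 - a1 * b0) - k2 * (a2 * b0 - a0 * b2)"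
          by (simp add: algebra_simps)
        then show ?thesis using that k(2) by simp
      qed
      have 1: "a1 * (k0 * b0 + k1 * b1 + k2 * b2) = 0"
      proof -
        have "a1 * (k0 * b0 + k1 * b1 + k2 * b2) = b1 * (k0 * a0 + k1 * a1 + k2 * a2) + k2 * (a1 * b2 - a2 * b1) - k0 * (a0 * b1 - a1 * b0)"
          by (simp add: algebra_simps)
        then show ?thesis using that k(2) by simp
      qed
      have 2: "a2 * (k0 * b0 + k1 * b1 + k2 * b2) = 0"
      proof -
        have "a2 * (k0 * b0 + k1 * b1 + k2 * b2) = b2 * (k0 * a0 + k1 * a1 + k2 * a2) + k0 * (a2 * b0 - a0 * b2) - k1 * (a1 * b2 - a2 * b1)"
          by (simp add: algebra_simps)
        then show ?thesis using that k(2) by simp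
      qed
      show ?thesis using 0 1 2 a by auto
    qed
    show ?thesis using k orth[of b2 b1 b0] orth[of c2 c1 c0] ab ac by blast
  qed
qed

text \<open>
  A linear relation expresses one of the polynomials by the other two, and one of these two has
  degree two because otherwise none of the three would.
\<close>

lemma quadratic_pencil_of_dependent:
  fixes w0 w1 w2 :: "'a::field poly"
  assumes deg: "\<And>w. w \<in> {w0, w1, w2} \<Longrightarrow> Polynomial.degree w \<le> 2"
    and quad: "\<exists>w\<in>{w0, w1, w2}. coeff w 2 \<noteq> 0"
    and k: "(k0, k1, k2) \<noteq> (0, 0, 0)" "smult k0 w0 + smult k1 w1 + smult k2 w2 = 0"
  shows "\<exists>u\<in>{w0, w1, w2}. \<exists>v\<in>{w0, w1, w2}. Polynomial.degree v = 2 \<and>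
    (\<forall>w\<in>{w0, w1, w2}. \<exists>\<rho> \<sigma>. w = smult \<rho> u + smult \<sigma> v)"
proof -
  have last: "\<exists>u\<in>{w0, w1, w2}. \<exists>v\<in>{w0, w1, w2}. Polynomial.degree v = 2 \<and>
    (\<forall>w\<in>{w0, w1, w2}. \<exists>\<rho> \<sigma>. w = smult \<rho> u + smult \<sigma> v)"
    if deg: "\<And>w. w \<in> {w0, w1, w2} \<Longrightarrow> Polynomial.degree w \<le> 2"
      and quad: "\<exists>w\<in>{w0, w1, w2}. coeff w 2 \<noteq> 0"
      and k: "k2 \<noteq> 0" "smult k0 w0 + smult k1 w1 + smult k2 w2 = 0" for w0 w1 w2 :: "'a poly" and k0 k1 k2
  proof -
    have w2: "w2 = smult (- k0 / k2) w0 + smult (- k1 / k2) w1"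
    proof -
      have "smult k2 w2 = - (smult k0 w0 + smult k1 w1)" using k(2) by (metis add.commute eq_neg_iff_add_eq_0)
      then have "smult (inverse k2) (smult k2 w2) = smult (inverse k2) (- (smult k0 w0 + smult k1 w1))" by simp
      then show ?thesis using k(1) by (simp add: smult_add_right smult_diff_right divide_inverse mult.commute)
    qed
    have "coeff w0 2 \<noteq> 0 \<or> coeff w1 2 \<noteq> 0"
    proof (rule ccontr)
      assume "\<not> ?thesis"
      moreover from this have "coeff w2 2 = 0" unfolding w2 by simp
      ultimately show False using quad by auto
    qed
    then show ?thesis
    proof
      assume c: "coeff w1 2 \<noteq> 0"
      have d1: "Polynomial.degree w1 = 2" using le_degree[OF c] deg[of w1] by simp
      have "w0 = smult 1 w0 + smult 0 w1" "w1 = smult 0 w0 + smult 1 w1" by simp_all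
      then have "\<forall>w\<in>{w0, w1, w2}. \<exists>\<rho> \<sigma>. w = smult \<rho> w0 + smult \<sigma> w1" using w2 by blast
      then show ?thesis using d1 by blast
    next
      assume c: "coeff w0 2 \<noteq> 0"
      have d0: "Polynomial.degree w0 = 2" using le_degree[OF c] deg[of w0] by simp
      have "w0 = smult 0 w1 + smult 1 w0" "w1 = smult 1 w1 + smult 0 w0"
        "w2 = smult (- k1 / k2) w1 + smult (- k0 / k2) w0" using w2 by (simp_all add: add.commute)
      then have "\<forall>w\<in>{w0, w1, w2}. \<exists>\<rho> \<sigma>. w = smult \<rho> w1 + smult \<sigma> w0" by blast
      then show ?thesis using d0 by blast
    qed
  qed
  consider "k2 \<noteq> 0" | "k1 \<noteq> 0" | "k0 \<noteq> 0" using k(1) by auto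
  then show ?thesis
  proof cases
    case 1 show ?thesis by (rule last[OF deg quad 1 k(2)])
  next
    case 2
    have p: "{w0, w2, w1} = {w0, w1, w2}" by blast
    have e: "smult k0 w0 + smult k2 w2 + smult k1 w1 = 0" using k(2) by (simp add: ac_simps)
    show ?thesis using last[of w0 w2 w1, unfolded p, OF deg quad 2 e] .
  next
    case 3
    have p: "{w1, w2, w0} = {w0, w1, w2}" by blast
    have e: "smult k1 w1 + smult k2 w2 + smult k0 w0 = 0" using k(2) by (simp add: ac_simps)
    show ?thesis using last[of w1 w2 w0, unfolded p, OF deg quad 3 e] .
  qed
qed

section \<open>Fat points and determinants\<close>

text \<open>
  The equation \<open>y - t x\<close> of the line of slope \<open>t\<close> through \<open>(0, 0, 1)\<close>, as a monic linear polynomial in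
  \<open>y\<close> over \<open>k[x]\<close>.
\<close>

definition ell :: "'a::comm_ring_1 \<Rightarrow> 'a poly2" where "ell t = [:- [:0, t:], 1:]"

text \<open>
  The restriction of \<open>g\<close> to a line through \<open>(0, 0, 1)\<close>, on which \<open>z\<close> is the parameter.
\<close>

definition slice :: "'a::comm_ring_1 \<Rightarrow> 'a \<Rightarrow> 'a poly3 \<Rightarrow> 'a poly" where
  "slice x y g = map_poly (\<lambda>p. poly (poly p [:y:]) x) g"

lemma ring_morph_poly_eval: "ring_morph (\<lambda>p. poly p a)"
  by (rule ring_morphI) simp_all

lemma ring_morph_eval2: "ring_morph (\<lambda>p. poly (poly p [:y:]) x)"
  by (rule ring_morph_comp[OF ring_morph_poly_eval ring_morph_poly_eval])

lemma ring_morph_map_poly: "ring_morph \<psi> \<Longrightarrow> ring_morph (map_poly \<psi>)"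
  by (rule ring_morphI) (rule map_poly_1', erule ring_morph_one,
      simp_all only: map_poly_add_morph map_poly_mult_morph)

lemma ring_morph_slice: "ring_morph (slice x y)"
  unfolding slice_def[abs_def] by (intro ring_morph_map_poly ring_morph_eval2)

lemma coeff_slice: "coeff (slice x y g) l = poly (poly (coeff g l) [:y:]) x"
  unfolding slice_def by (simp add: coeff_map_poly)

lemma slice_eq_subst3: "slice x y g = subst3 (\<lambda>c. [:c:]) g [:x:] [:y:] [:0, 1:]"
proof -
  have "slice x y g = subst3 (\<lambda>c. slice x y (const3 c)) g (slice x y X3) (slice x y Y3) (slice x y Z3)"
    by (rule morph_as_subst3[OF ring_morph_slice])
  moreover have "slice x y (const3 c) = [:c:]" for c
    unfolding slice_def const3_def by (simp add: map_poly_pCons)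
  moreover have "slice x y X3 = [:x:]" "slice x y Y3 = [:y:]" "slice x y Z3 = [:0, 1:]"
    unfolding slice_def X3_def Y3_def Z3_def by (simp_all add: map_poly_pCons)
  ultimately show ?thesis by simp
qed

lemma degree_slice_le: "Polynomial.degree g \<le> n \<Longrightarrow> Polynomial.degree (slice x y g) \<le> n"
  by (rule degree_le) (simp add: coeff_slice coeff_eq_0)

text \<open>
  Bezout's theorem for a curve and a line.
\<close>

lemma sum_multiplicities_le_degree:
  fixes u :: "'a::idom poly"
  assumes "finite Q" "inj_on \<sigma> Q" "\<And>q. q \<in> Q \<Longrightarrow> [:- \<sigma> q, 1:] ^ m q dvd u" "u \<noteq> 0"
  shows "(\<Sum>q\<in>Q. m q) \<le> Polynomial.degree u"
  using dvd_imp_degree_le[OF prod_linear_powers_dvd[OF assms(1-3)] assms(4)] degree_prod_linear_powers[OF assms(1), of \<sigma> m]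
  by simp

definition quad_coeffs :: "'b::comm_ring_1 poly \<Rightarrow> 'b \<times> 'b \<times> 'b" where
  "quad_coeffs g = (coeff g 2, coeff g 1, coeff g 0)"

lemma quadratic_eq: "Polynomial.degree g \<le> 2 \<Longrightarrow> g = [:coeff g 0, coeff g 1, coeff g 2:]"
  by (rule poly_eqI) (auto simp: coeff_pCons coeff_eq_0 split: nat.splits simp flip: One_nat_def numeral_2_eq_2)

text \<open>
  Cramer's rule for expressing \<open>g\<close> by three quadratic polynomials.
\<close>

lemma cramer:
  assumes "Polynomial.degree g0 \<le> 2" "Polynomial.degree g1 \<le> 2" "Polynomial.degree g2 \<le> 2" "Polynomial.degree g \<le> 2"
  shows "[:det3 (quad_coeffs g0) (quad_coeffs g1) (quad_coeffs g2):] * g =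
    [:det3 (quad_coeffs g) (quad_coeffs g1) (quad_coeffs g2):] * g0 + [:det3 (quad_coeffs g0) (quad_coeffs g) (quad_coeffs g2):] * g1 + [:det3 (quad_coeffs g0) (quad_coeffs g1) (quad_coeffs g):] * g2"
proof -
  obtain a0 b0 c0 a1 b1 c1 a2 b2 c2 a b c where
    g: "g0 = [:c0, b0, a0:]" "g1 = [:c1, b1, a1:]" "g2 = [:c2, b2, a2:]" "g = [:c, b, a:]"
    using assms[THEN quadratic_eq] by blast
  show ?thesis unfolding g quad_coeffs_def det3_def by (simp add: numeral_2_eq_2 algebra_simps)
qed

text \<open>
  Written as \<open>a (z - s)\<^sup>2 + b (z - s) + c\<close>, the polynomial \<open>g\<close> has \<open>c\<close> divisible by \<open>\<pi>\<^sup>m\<close> and \<open>b\<close> by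
  \<open>\<pi>\<^bsup>m - 1\<^esup>\<close>. For \<open>m \<le> 2\<close> this is membership in the power \<open>m\<close> of the ideal \<open>(\<pi>, z - s)\<close> of a
  point. The expressions for \<open>b\<close> and \<open>c\<close> are linear in \<open>g\<close>.
\<close>

definition fat_conds :: "'b::comm_ring_1 \<Rightarrow> 'b \<Rightarrow> nat \<Rightarrow> 'b poly \<Rightarrow> bool" where
  "fat_conds \<pi> s m g \<longleftrightarrow> \<pi> ^ m dvd coeff g 0 + s * coeff g 1 + s * s * coeff g 2 \<and>
     \<pi> ^ (m - 1) dvd coeff g 1 + 2 * s * coeff g 2"

text \<open>
  The coefficients after the substitution of \<open>s + \<pi> z\<close> for \<open>z\<close> are \<open>c\<close>, \<open>\<pi> b\<close> and \<open>\<pi>\<^sup>2 a\<close>.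
\<close>

lemma fat_conds_of_order:
  fixes \<pi> :: "'b::idom"
  assumes deg: "Polynomial.degree g \<le> 2" and ord: "[:\<pi>:] ^ m dvd pcompose g [:s, \<pi>:]" and \<pi>: "\<pi> \<noteq> 0"
  shows "fat_conds \<pi> s m g"
proof -
  obtain a b c where g: "g = [:c, b, a:]" using quadratic_eq[OF deg] by blast
  have p: "pcompose g [:s, \<pi>:] = [:c + s * b + s * s * a, \<pi> * (b + 2 * s * a), \<pi> * \<pi> * a:]"
    unfolding g by (simp add: pcompose_pCons algebra_simps)
  have "[:\<pi> ^ m:] dvd [:c + s * b + s * s * a, \<pi> * (b + 2 * s * a), \<pi> * \<pi> * a:]"
    using ord unfolding p ring_morph_power[OF ring_morph_const] .
  then have "\<pi> ^ m dvd coeff [:c + s * b + s * s * a, \<pi> * (b + 2 * s * a), \<pi> * \<pi> * a:] n" for n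
    unfolding const_poly_dvd_iff by blast
  from this[of 0] this[of 1] have 1: "\<pi> ^ m dvd c + s * b + s * s * a" "\<pi> ^ m dvd \<pi> * (b + 2 * s * a)" by simp_all
  have 2: "\<pi> ^ (m - 1) dvd b + 2 * s * a"
  proof (cases m)
    case 0 then show ?thesis by simp
  next
    case (Suc n) then show ?thesis using 1(2) \<pi> unfolding Suc power_Suc dvd_mult_cancel_left by simp
  qed
  show ?thesis using 1(1) 2 unfolding fat_conds_def g by (simp add: numeral_2_eq_2)
qed

text \<open>
  The determinant does not change if the basis \<open>z\<^sup>2, z, 1\<close> is replaced by another basis of monic
  polynomials of these degrees.
\<close>

lemma det3_shear:
  "det3 (a0, b0, c0) (a1, b1, c1) (a2, b2, c2) =
   det3 (a0, b0 + t * a0, c0 + s * b0 + r * a0) (a1, b1 + t * a1, c1 + s * b1 + r * a1) (a2, b2 + t * a2, c2 + s * b2 + r * a2)"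
  unfolding det3_def by (simp add: algebra_simps)

lemma det3_dvd:
  assumes "x dvd b0" "x dvd b1" "x dvd b2" "y dvd c0" "y dvd c1" "y dvd c2"
  shows "x * y dvd det3 (a0, b0, c0) (a1, b1, c1) (a2, b2, c2)"
  unfolding det3_def prod.case using assms
  by (intro dvd_add dvd_diff dvd_mult[of _ _ a0] dvd_mult[of _ _ a1] dvd_mult[of _ _ a2] mult_dvd_mono)

lemma det3_dvd_fat:
  assumes "fat_conds \<pi> s m g0" "fat_conds \<pi> s m g1" "fat_conds \<pi> s m g2" "m > 0"
  shows "\<pi> ^ (2 * m - 1) dvd det3 (quad_coeffs g0) (quad_coeffs g1) (quad_coeffs g2)"
proof -
  have "\<pi> ^ (2 * m - 1) = \<pi> ^ (m - 1) * \<pi> ^ m" 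
    unfolding power_add[symmetric] using assms(4) by (intro arg_cong[of _ _ "power \<pi>"]) simp
  moreover have "\<pi> ^ (m - 1) * \<pi> ^ m dvd det3 (quad_coeffs g0) (quad_coeffs g1) (quad_coeffs g2)"
    unfolding quad_coeffs_def
    using assms(1-3) unfolding fat_conds_def
    by (subst det3_shear[where t = "2 * s" and s = s and r = "s * s"]) (intro det3_dvd; blast)
  ultimately show ?thesis by simp
qed

text \<open>
  Two simple points on the line \<open>\<pi> = 0\<close>. Modulo \<open>\<pi>\<close> all three polynomials are multiples of
  \<open>(z - s) (z - t)\<close>, so with respect to the basis \<open>(z - s) (z - t), z, 1\<close> two rows are divisible
  by \<open>\<pi>\<close>.
\<close>

lemma det3_dvd_two_simple:
  fixes a :: "'b::idom"
  assumes s: "\<And>g. g \<in> {g0, g1, g2} \<Longrightarrow> fat_conds [:- a, 1:] s 1 g"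
    and t: "\<And>g. g \<in> {g0, g1, g2} \<Longrightarrow> fat_conds [:- a, 1:] t 1 g"
    and st: "poly (s - t) a \<noteq> 0"
  shows "[:- a, 1:] ^ 2 dvd det3 (quad_coeffs g0) (quad_coeffs g1) (quad_coeffs g2)"
proof -
  let ?\<pi> = "[:- a, 1:]"
  have 1: "?\<pi> dvd coeff g 1 + (s + t) * coeff g 2" if g: "g \<in> {g0, g1, g2}" for g
  proof -
    have "?\<pi> dvd (coeff g 0 + s * coeff g 1 + s * s * coeff g 2) - (coeff g 0 + t * coeff g 1 + t * t * coeff g 2)"
      using s[OF g] t[OF g] unfolding fat_conds_def by (intro dvd_diff) simp_all
    also have "\<dots> = (s - t) * (coeff g 1 + (s + t) * coeff g 2)" by (simp add: algebra_simps)
    finally have "?\<pi> ^ 1 dvd (s - t) * (coeff g 1 + (s + t) * coeff g 2)" by (simp only: power_one_right)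
    then have "?\<pi> ^ 1 dvd coeff g 1 + (s + t) * coeff g 2" using st by (rule linear_power_dvd_cancel)
    then show ?thesis by (simp only: power_one_right)
  qed
  have 2: "?\<pi> dvd coeff g 0 + 0 * coeff g 1 + (- s * t) * coeff g 2" if g: "g \<in> {g0, g1, g2}" for g
  proof -
    have "coeff g 0 + 0 * coeff g 1 + (- s * t) * coeff g 2 =
      (coeff g 0 + s * coeff g 1 + s * s * coeff g 2) - s * (coeff g 1 + (s + t) * coeff g 2)"
      by (simp add: algebra_simps)
    then show ?thesis using s[OF g] 1[OF g] unfolding fat_conds_def by (metis dvd_diff dvd_mult power_one_right)
  qed
  show ?thesis
    unfolding quad_coeffs_def power2_eq_square
    by (subst det3_shear[where t = "s + t" and s = 0 and r = "- s * t"]) (intro det3_dvd; use 1 2 in blast)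
qed

text \<open>
  The factor \<open>z - c\<close> does not vanish at the point, so the conditions pass to the cofactor. This is
  where the general choice of a linear form is used.
\<close>

lemma fat_conds_linear_factor:
  fixes a :: "'b::idom"
  assumes deg: "Polynomial.degree g \<le> 1" and sc: "poly (s - c) a \<noteq> 0" and m: "m \<in> {1, 2}"
    and f: "fat_conds [:- a, 1:] s m ([:- c, 1:] * g)"
  shows "fat_conds [:- a, 1:] s m g"
proof -
  let ?\<pi> = "[:- a, 1:]"
  obtain \<alpha> \<beta> where g: "g = [:\<beta>, \<alpha>:]"
  proof
    show "g = [:coeff g 0, coeff g 1:]"
      using deg by (intro poly_eqI) (auto simp: coeff_pCons coeff_eq_0 split: nat.splits simp flip: One_nat_def)
  qed
  have co: "coeff ([:- c, 1:] * g) 0 = - c * \<beta>" "coeff ([:- c, 1:] * g) 1 = \<beta> - c * \<alpha>" "coeff ([:- c, 1:] * g) 2 = \<alpha>"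
    unfolding g by (simp_all add: numeral_2_eq_2)
  have "?\<pi> ^ m dvd - c * \<beta> + s * (\<beta> - c * \<alpha>) + s * s * \<alpha>"
    using f unfolding fat_conds_def co by blast
  also have "\<dots> = (s - c) * (\<beta> + s * \<alpha>)" by (simp add: algebra_simps)
  finally have 1: "?\<pi> ^ m dvd \<beta> + s * \<alpha>" using linear_power_dvd_cancel sc by blast
  have 2: "?\<pi> ^ (m - 1) dvd \<alpha>"
  proof -
    have "?\<pi> ^ (m - 1) dvd \<beta> - c * \<alpha> + 2 * s * \<alpha>" using f unfolding fat_conds_def co by blast
    moreover have "?\<pi> ^ (m - 1) dvd \<beta> + s * \<alpha>" using 1 by (rule power_le_dvd) simp
    ultimately have "?\<pi> ^ (m - 1) dvd (\<beta> - c * \<alpha> + 2 * s * \<alpha>) - (\<beta> + s * \<alpha>)" by (rule dvd_diff)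
    also have "\<dots> = (s - c) * \<alpha>" by (simp add: algebra_simps)
    finally show ?thesis using linear_power_dvd_cancel sc by blast
  qed
  show ?thesis using 1 2 unfolding fat_conds_def g by (simp add: numeral_2_eq_2)
qed

lemma pcompose_eq_subst3: "subst3 const3 g X3 Y3 W = pcompose g W"
proof -
  have "subst2 const3 p X3 Y3 = [:p:]" for p :: "'a poly2"
    by (rule morph_eq_poly2[of "\<lambda>p. subst2 const3 p X3 Y3" "\<lambda>p. [:p:]"])
       (simp_all add: ring_morph_subst2 ring_morph_const3 ring_morph_const subst2_simps,
        simp_all add: const3_def const2_def X3_def U2_def Y3_def V2_def)
  then show ?thesis unfolding subst3_def pcompose_altdef by simp
qed

section \<open>Cremona maps that are quadratic in one variable\<close>

text \<open>
  Three forms of degree \<open>d\<close> that define a Cremona map with multiplicity exactly \<open>d - 2\<close> at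
  \<open>(0, 0, 1)\<close>, hence of degree two in \<open>z\<close>. The other base points \<open>q\<close> in \<open>B\<close> have coordinates
  \<open>(1, \<tau> q, \<sigma> q)\<close> and multiplicity \<open>m q\<close>. The multiplicity is used in two forms: as an order of
  divisibility on the line through \<open>(0, 0, 1)\<close> and \<open>q\<close>, and after the substitution of
  \<open>\<sigma> q x + (y - \<tau> q x) z\<close> for \<open>z\<close>. The forms \<open>Gx\<close> and \<open>Gz\<close> are the coordinates \<open>x\<close> and \<open>z\<close> of the
  inverse map.
\<close>

locale quadratic_cremona =
  fixes d :: nat and g0 g1 g2 :: "'a::alg_closed_field poly3"
    and B :: "'i set" and \<tau> \<sigma> :: "'i \<Rightarrow> 'a" and m :: "'i \<Rightarrow> nat"
    and e :: nat and Gx Gz h :: "'a poly3"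
  assumes d: "d \<ge> 2"
    and form: "g \<in> {g0, g1, g2} \<Longrightarrow> is_form d g"
    and deg: "g \<in> {g0, g1, g2} \<Longrightarrow> Polynomial.degree g \<le> 2"
    and quad: "\<exists>g\<in>{g0, g1, g2}. coeff g 2 \<noteq> 0"
    and finB: "finite B"
    and inj: "q \<in> B \<Longrightarrow> q' \<in> B \<Longrightarrow> \<tau> q = \<tau> q' \<Longrightarrow> \<sigma> q = \<sigma> q' \<Longrightarrow> q = q'"
    and m: "q \<in> B \<Longrightarrow> m q \<in> {1, 2}"
    and msum: "(\<Sum>q\<in>B. 2 * m q - 1) = 3 * d - 3"
    and order: "q \<in> B \<Longrightarrow> g \<in> {g0, g1, g2} \<Longrightarrow> [:ell (\<tau> q):] ^ m q dvd pcompose g [:[:[:0, \<sigma> q:]:], ell (\<tau> q):]"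
    and order_slice: "q \<in> B \<Longrightarrow> g \<in> {g0, g1, g2} \<Longrightarrow> [:- \<sigma> q, 1:] ^ m q dvd slice 1 (\<tau> q) g"
    and common_zero: "x \<noteq> 0 \<Longrightarrow> (\<And>g. g \<in> {g0, g1, g2} \<Longrightarrow> poly (slice x y g) z = 0) \<Longrightarrow> \<exists>q\<in>B. y = \<tau> q * x"
    and no_line: "\<exists>g\<in>{g0, g1, g2}. slice 1 t g \<noteq> 0"
    and formG: "is_form e Gx" "is_form e Gz"
    and inverse: "subst3 const3 Gx g0 g1 g2 = h * X3" "subst3 const3 Gz g0 g1 g2 = h * Z3" "h \<noteq> 0"
begin

definition D :: "'a poly2" where "D = det3 (quad_coeffs g0) (quad_coeffs g1) (quad_coeffs g2)"

text \<open>
  If the determinant vanished, the three forms, restricted to a general line through \<open>(0, 0, 1)\<close>, would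
  lie in a pencil spanned by two quadratic polynomials. These have no common root, because the line
  contains no other base point. So the restriction of the map to the line would have degree two onto
  its image, and the parameter of the line could not be recovered by \<open>Gx\<close> and \<open>Gz\<close>.
\<close>

lemma D_nonzero: "D \<noteq> 0"
proof
  assume D0: "D = 0"
  obtain g where g: "g \<in> {g0, g1, g2}" "coeff g 2 \<noteq> 0" using quad by blast
  obtain l where l: "coeff h l \<noteq> 0" using inverse(3) by (metis coeff_0 poly_eqI)
  \<comment> \<open>Conditions for a general line: \<open>x \<noteq> 0\<close>, no base point besides \<open>(0, 0, 1)\<close>, some generator stays quadratic, and \<open>h\<close> does not vanish on it.\<close>
  let ?\<Phi> = "U2 * (\<Prod>q\<in>B. ell (\<tau> q)) * (coeff g 2 * coeff h l)"
  have "?\<Phi> \<noteq> 0"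
  proof -
    have "(\<Prod>q\<in>B. ell (\<tau> q)) \<noteq> 0" using finB by (simp add: ell_def)
    then show ?thesis using g(2) l by (simp add: U2_def)
  qed
  then obtain x y where xy: "poly (poly ?\<Phi> [:y:]) x \<noteq> 0" using poly2_nonvanishing_point by blast
  have x: "x \<noteq> 0" and ell: "poly (poly (\<Prod>q\<in>B. ell (\<tau> q)) [:y:]) x \<noteq> 0"
    and c2: "poly (poly (coeff g 2) [:y:]) x \<noteq> 0" and hl: "poly (poly (coeff h l) [:y:]) x \<noteq> 0"
    using xy by (auto simp: U2_def)
  have y: "y \<noteq> \<tau> q * x" if "q \<in> B" for q
  proof
    assume "y = \<tau> q * x"
    then have "\<exists>q\<in>B. poly (poly (ell (\<tau> q)) [:y:]) x = 0" using that by (intro bexI[of _ q]) (simp_all add: ell_def mult.commute)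
    then have "(\<Prod>q\<in>B. poly (poly (ell (\<tau> q)) [:y:]) x) = 0" using finB by (simp add: prod_zero_iff)
    then show False using ell by (simp add: poly_prod)
  qed
  define w where "w = slice x y"
  have nz: "\<exists>g\<in>{g0, g1, g2}. poly (w g) z \<noteq> 0" for z
    using common_zero[OF x, of y z] y unfolding w_def by blast
  have wdeg: "Polynomial.degree v \<le> 2" if "v \<in> {w g0, w g1, w g2}" for v
    using that degree_slice_le deg unfolding w_def by blast
  have wquad: "\<exists>v\<in>{w g0, w g1, w g2}. coeff v 2 \<noteq> 0"
    using g(1) c2 unfolding w_def by (intro bexI[of _ "slice x y g"]) (auto simp: coeff_slice)
  note ev = ring_morph_eval2[of y x]
  have det: "det3 (coeff (w g0) 2, coeff (w g0) 1, coeff (w g0) 0) (coeff (w g1) 2, coeff (w g1) 1, coeff (w g1) 0)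
      (coeff (w g2) 2, coeff (w g2) 1, coeff (w g2) 0) = poly (poly D [:y:]) x"
    unfolding D_def w_def det3_def quad_coeffs_def coeff_slice prod.case by (simp only: ring_morph_simps[OF ev])
  have quad0: "coeff (w g2) 2 \<noteq> 0 \<or> coeff (w g1) 2 \<noteq> 0 \<or> coeff (w g0) 2 \<noteq> 0" using wquad by blast
  obtain k0 k1 k2 where k: "(k0, k1, k2) \<noteq> (0, 0, 0)"
    "k0 * coeff (w g0) 2 + k1 * coeff (w g1) 2 + k2 * coeff (w g2) 2 = 0"
    "k0 * coeff (w g0) 1 + k1 * coeff (w g1) 1 + k2 * coeff (w g2) 1 = 0"
    "k0 * coeff (w g0) 0 + k1 * coeff (w g1) 0 + k2 * coeff (w g2) 0 = 0"
    using orthogonal_vector[OF _ det[unfolded D0, simplified]] quad0 by auto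
  have "smult k0 (w g0) + smult k1 (w g1) + smult k2 (w g2) = 0"
  proof (rule poly_eqI)
    fix n :: nat
    consider "n = 0" | "n = 1" | "n = 2" | "n > 2" by linarith
    then show "coeff (smult k0 (w g0) + smult k1 (w g1) + smult k2 (w g2)) n = coeff 0 n"
    proof cases
      case 4
      then have "coeff (w g0) n = 0" "coeff (w g1) n = 0" "coeff (w g2) n = 0"
        using wdeg[of "w g0"] wdeg[of "w g1"] wdeg[of "w g2"] by (simp_all add: coeff_eq_0)
      then show ?thesis by simp
    qed (use k(2-4) in simp_all)
  qed
  from quadratic_pencil_of_dependent[OF wdeg wquad k(1) this]
  obtain u v where v: "Polynomial.degree v = 2" and span: "\<And>r. r \<in> {w g0, w g1, w g2} \<Longrightarrow> \<exists>\<rho> \<sigma>. r = smult \<rho> u + smult \<sigma> v"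
    by blast
  have root: "poly u z \<noteq> 0" if "poly v z = 0" for z
  proof
    assume "poly u z = 0"
    then have "poly r z = 0" if "r \<in> {w g0, w g1, w g2}" for r
      using span[OF that] \<open>poly v z = 0\<close> by auto
    then show False using nz[of z] by blast
  qed
  note sm = ring_morph_slice[of x y]
  have push: "w (subst3 const3 G g0 g1 g2) \<in> binary_forms e u v" if "is_form e G" for G
  proof -
    have "w (subst3 const3 G g0 g1 g2) = subst3 (\<lambda>c. w (const3 c)) G (w g0) (w g1) (w g2)"
      unfolding w_def by (rule morph_subst3[OF sm ring_morph_const3])
    moreover have "(\<lambda>c. w (const3 c)) = (\<lambda>c. [:c:])"
      unfolding w_def slice_def const3_def by (simp add: map_poly_pCons)
    ultimately show ?thesis using form_in_binary_forms[OF that span] by simp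
  qed
  have X: "w X3 = [:x:]" and Z: "w Z3 = [:0, 1:]"
    unfolding w_def slice_def X3_def Z3_def by (simp_all add: map_poly_pCons)
  have Gx: "w (subst3 const3 Gx g0 g1 g2) = smult x (w h)" and Gz: "w (subst3 const3 Gz g0 g1 g2) = [:0, 1:] * w h"
    unfolding inverse X[symmetric] Z[symmetric] using X unfolding w_def ring_morph_mult[OF sm] by (simp_all add: mult.commute)
  have "smult x (w h) = 0"
    using no_quadratic_pencil_inverse[OF v root push[OF formG(1)] push[OF formG(2)], of x] unfolding Gx Gz by simp
  then have "coeff (w h) l = 0" using x by simp
  then show False using hl unfolding w_def coeff_slice by simp
qed

text \<open>
  The slopes of the lines from \<open>(0, 0, 1)\<close> to the other base points. A point of multiplicity \<open>m\<close>
  contributes \<open>2 m - 1\<close> to the order of the determinant along its line: \<open>m\<close> from the row of constant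
  terms and \<open>m - 1\<close> from the row of linear terms.
\<close>

definition T :: "'a set" where "T = \<tau> ` B"
definition E :: "'a \<Rightarrow> nat" where "E t = (\<Sum>q\<in>{q \<in> B. \<tau> q = t}. 2 * m q - 1)"
definition admissible :: "'a poly3 \<Rightarrow> bool" where
  "admissible g \<longleftrightarrow> Polynomial.degree g \<le> 2 \<and> (\<forall>q\<in>B. fat_conds (ell (\<tau> q)) [:[:0, \<sigma> q:]:] (m q) g)"

lemma finT: "finite T" unfolding T_def using finB by simp

lemma sum_E: "(\<Sum>t\<in>T. E t) = 3 * d - 3"
  unfolding E_def T_def msum[symmetric] by (rule sum.image_gen[OF finB, symmetric])

lemma generators_admissible: "g \<in> {g0, g1, g2} \<Longrightarrow> admissible g"
  unfolding admissible_def using fat_conds_of_order[OF deg order] deg by (auto simp: ell_def)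

text \<open>
  The restriction of a generator to the line of slope \<open>t\<close> has degree at most two, which bounds the sum
  of the multiplicities on the line. Two simple points can lie on one line.
\<close>

lemma fibre:
  assumes "t \<in> T"
  shows "(\<exists>q\<in>B. {q \<in> B. \<tau> q = t} = {q}) \<or>
    (\<exists>q\<in>B. \<exists>q'\<in>B. q \<noteq> q' \<and> {q \<in> B. \<tau> q = t} = {q, q'} \<and> m q = 1 \<and> m q' = 1)"
proof -
  let ?Q = "{q \<in> B. \<tau> q = t}"
  have fin: "finite ?Q" using finB by simp
  obtain g where g: "g \<in> {g0, g1, g2}" "slice 1 t g \<noteq> 0" using no_line by blast
  have "(\<Sum>q\<in>?Q. m q) \<le> Polynomial.degree (slice 1 t g)"
  proof (rule sum_multiplicities_le_degree[OF fin])
    show "inj_on \<sigma> ?Q" using inj by (auto simp: inj_on_def)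
    show "[:- \<sigma> q, 1:] ^ m q dvd slice 1 t g" if "q \<in> ?Q" for q using order_slice[OF _ g(1), of q] that by simp
  qed (rule g(2))
  also have "\<dots> \<le> 2" using degree_slice_le deg[OF g(1)] by blast
  finally have le2: "(\<Sum>q\<in>?Q. m q) \<le> 2" .
  obtain q where q: "q \<in> ?Q" using assms unfolding T_def by auto
  show ?thesis
  proof (cases "?Q = {q}")
    case True then show ?thesis using q by blast
  next
    case False
    then obtain q' where q': "q' \<in> ?Q" "q' \<noteq> q" using q by blast
    have m1: "m r \<ge> 1" if "r \<in> B" for r using m[OF that] by auto
    have "?Q = {q, q'}"
    proof (rule ccontr)
      assume "?Q \<noteq> {q, q'}"
      then obtain q'' where q'': "q'' \<in> ?Q" "q'' \<noteq> q" "q'' \<noteq> q'" using q q' by blast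
      have "(\<Sum>r\<in>{q, q', q''}. m r) \<le> (\<Sum>q\<in>?Q. m q)" using q q' q'' fin by (intro sum_mono2) auto
      then have "m q + m q' + m q'' \<le> 2" using q' q'' le2 by simp
      then show False using m1[of q] m1[of q'] m1[of q''] q q' q'' by simp
    qed
    moreover from this have "m q + m q' \<le> 2" using le2 q'(2) by simp
    then have "m q = 1" "m q' = 1" using m1[of q] m1[of q'] q q' by auto
    ultimately show ?thesis using q q' by blast
  qed
qed

lemma ell_power_dvd:
  assumes t: "t \<in> T" and adm: "admissible f0" "admissible f1" "admissible f2"
  shows "ell t ^ E t dvd det3 (quad_coeffs f0) (quad_coeffs f1) (quad_coeffs f2)"
  using fibre[OF t]
proof
  assume "\<exists>q\<in>B. {q \<in> B. \<tau> q = t} = {q}"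
  then obtain q where q: "q \<in> B" "{q \<in> B. \<tau> q = t} = {q}" by blast
  have tq: "\<tau> q = t" using q(2) by blast
  have "E t = 2 * m q - 1" unfolding E_def q(2) by simp
  moreover have "m q > 0" using m[OF q(1)] by auto
  ultimately show ?thesis using det3_dvd_fat[of "ell t" "[:[:0, \<sigma> q:]:]" "m q" f0 f1 f2] adm q(1) tq
    unfolding admissible_def by auto
next
  assume "\<exists>q\<in>B. \<exists>q'\<in>B. q \<noteq> q' \<and> {q \<in> B. \<tau> q = t} = {q, q'} \<and> m q = 1 \<and> m q' = 1"
  then obtain q q' where q: "q \<in> B" "q' \<in> B" "q \<noteq> q'" "{q \<in> B. \<tau> q = t} = {q, q'}" "m q = 1" "m q' = 1" by blast
  have tq: "\<tau> q = t" "\<tau> q' = t" using q(4) by blast+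
  have Et: "E t = 2" unfolding E_def q(4) using q(3,5,6) by simp
  have s: "\<sigma> q \<noteq> \<sigma> q'" using inj[OF q(1,2)] tq q(3) by auto
  show ?thesis unfolding Et ell_def
  proof (rule det3_dvd_two_simple)
    show "fat_conds [:- [:0, t:], 1:] [:[:0, \<sigma> q:]:] 1 g" if "g \<in> {f0, f1, f2}" for g
      using that adm q(1,5) tq unfolding admissible_def ell_def by fastforce
    show "fat_conds [:- [:0, t:], 1:] [:[:0, \<sigma> q':]:] 1 g" if "g \<in> {f0, f1, f2}" for g
      using that adm q(2,6) tq unfolding admissible_def ell_def by fastforce
    show "poly ([:[:0, \<sigma> q:]:] - [:[:0, \<sigma> q':]:]) [:0, t:] \<noteq> 0" using s by simp
  qed
qed

definition L :: "'a poly2" where "L = (\<Prod>t\<in>T. ell t ^ E t)"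

lemma L_dvd_det: "admissible f0 \<Longrightarrow> admissible f1 \<Longrightarrow> admissible f2 \<Longrightarrow> L dvd det3 (quad_coeffs f0) (quad_coeffs f1) (quad_coeffs f2)"
  unfolding L_def
  by (rule prod_linear_powers_dvd[OF finT, of "\<lambda>t. [:0, t:]", folded ell_def]) (simp_all add: inj_on_def ell_power_dvd)

text \<open>
  Both sides have degree \<open>3 d - 3 = (d - 2) + (d - 1) + d\<close>. The quotient has degree zero in \<open>y\<close> because
  the product of lines is monic in \<open>y\<close>, and it is free of \<open>x\<close> because the determinant is a form.
\<close>

lemma D_eq: "\<exists>c. c \<noteq> 0 \<and> D = L * const2 c"
proof -
  have "L dvd D" unfolding D_def by (intro L_dvd_det generators_admissible) simp_all
  then obtain K where K: "D = L * K" by (elim dvdE)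
  have K0: "K \<noteq> 0" "L \<noteq> 0" using D_nonzero K by auto
  have degL: "Polynomial.degree L = 3 * d - 3"
    unfolding L_def ell_def degree_prod_linear_powers[OF finT] by (rule sum_E)
  have lcL: "Polynomial.lead_coeff L = 1" unfolding L_def ell_def by (rule lead_coeff_prod_linear_powers)
  have formD: "is_form (3 * d - 3) [:D:]"
  proof -
    have c: "is_form (d - l) [:coeff g l:]" if g: "g \<in> {g0, g1, g2}" and "l \<le> 2" for g l
      unfolding is_form_def
    proof (intro allI impI)
      fix i j k assume nz: "coeff3 [:coeff g l:] i j k \<noteq> 0"
      then have k: "k = 0" by (cases k) simp_all
      then have "coeff3 g i j l \<noteq> 0" using nz by simp
      then have "i + j + l = d" using form[OF g] unfolding is_form_def by blast
      then show "i + j + k = d - l" using k by simp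
    qed
    have e: "3 * d - 3 = (d - 2) + ((d - 1) + (d - 0))" using d by simp
    have t: "is_form (3 * d - 3) ([:coeff f 2:] * ([:coeff g 1:] * [:coeff g' 0:] - [:coeff g' 1:] * [:coeff g 0:]))"
      if "f \<in> {g0, g1, g2}" "g \<in> {g0, g1, g2}" "g' \<in> {g0, g1, g2}" for f g g'
      unfolding e by (intro is_form_mult is_form_diff c that) simp_all
    show ?thesis unfolding D_def det3_def quad_coeffs_def prod.case
      by (simp only: ring_morph_simps[OF ring_morph_const]) (intro is_form_add is_form_diff t; simp)
  qed
  have coD: "i + j = 3 * d - 3" if "coeff (coeff D j) i \<noteq> 0" for i j
  proof -
    have "coeff3 [:D:] i j 0 \<noteq> 0" using that by simp
    then show ?thesis using formD unfolding is_form_def by fastforce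
  qed
  have "Polynomial.degree D \<le> 3 * d - 3"
  proof (rule degree_le, intro allI impI)
    fix j assume j: "3 * d - 3 < j"
    show "coeff D j = 0"
    proof (rule ccontr)
      assume "coeff D j \<noteq> 0"
      then obtain i where "coeff (coeff D j) i \<noteq> 0" by (metis coeff_0 poly_eqI)
      then show False using coD j by fastforce
    qed
  qed
  then have "Polynomial.degree K = 0" unfolding K degree_mult_eq[OF K0(2,1)] degL by simp
  then obtain k where k: "K = [:k:]" by (metis degree_eq_zeroE)
  have "coeff D (3 * d - 3) = k" unfolding K k using lcL degL by (simp add: mult.commute)
  then have "i = 0" if "coeff k i \<noteq> 0" for i using coD[of "3 * d - 3" i] that by simp
  then have "Polynomial.degree k = 0" by (metis K0(1) k leading_coeff_0_iff pCons_0_0)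
  then obtain c where c: "k = [:c:]" by (metis degree_eq_zeroE)
  show ?thesis using K K0(1) unfolding k c by (intro exI[of _ c]) (auto simp: const2_def)
qed

definition Ig :: "'a poly3 set" where "Ig = {a * g0 + b * g1 + c * g2 | a b c. True}"

lemma ideal_Ig: "ideal Ig ring_of_type_algebra"
  unfolding ideal_type_ring_iff
proof (intro conjI ballI allI)
  show "0 \<in> Ig" unfolding Ig_def by (intro CollectI exI[of _ 0]) simp
  fix f r assume "f \<in> Ig"
  then obtain a b c where f: "f = a * g0 + b * g1 + c * g2" unfolding Ig_def by blast
  have "r * f = (r * a) * g0 + (r * b) * g1 + (r * c) * g2" unfolding f by (simp add: algebra_simps)
  then show "r * f \<in> Ig" unfolding Ig_def by blast
  fix f' assume "f' \<in> Ig"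
  then obtain a' b' c' where f': "f' = a' * g0 + b' * g1 + c' * g2" unfolding Ig_def by blast
  have "f + f' = (a + a') * g0 + (b + b') * g1 + (c + c') * g2" unfolding f f' by (simp add: algebra_simps)
  then show "f + f' \<in> Ig" unfolding Ig_def by blast
qed

lemma generators_in_Ig: "g \<in> {g0, g1, g2} \<Longrightarrow> g \<in> Ig"
proof -
  have "g0 = 1 * g0 + 0 * g1 + 0 * g2" "g1 = 0 * g0 + 1 * g1 + 0 * g2" "g2 = 0 * g0 + 0 * g1 + 1 * g2" by simp_all
  then show "g \<in> {g0, g1, g2} \<Longrightarrow> g \<in> Ig" unfolding Ig_def by blast
qed

text \<open>
  In Cramer's rule all determinants are divisible by the product of lines, which is the determinant of
  the generators up to a constant. So the generators are a basis, over \<open>k[x,y]\<close>, of the module of all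
  polynomials of degree at most two in \<open>z\<close> that satisfy the conditions at the base points.
\<close>

lemma admissible_in_Ig:
  assumes g: "admissible g" shows "g \<in> Ig"
proof -
  obtain c where c: "c \<noteq> 0" "D = L * const2 c" using D_eq by blast
  have adm: "admissible g0" "admissible g1" "admissible g2" by (simp_all add: generators_admissible)
  obtain b0 where b0: "det3 (quad_coeffs g) (quad_coeffs g1) (quad_coeffs g2) = L * b0" using L_dvd_det[OF g adm(2,3)] by (elim dvdE)
  obtain b1 where b1: "det3 (quad_coeffs g0) (quad_coeffs g) (quad_coeffs g2) = L * b1" using L_dvd_det[OF adm(1) g adm(3)] by (elim dvdE)
  obtain b2 where b2: "det3 (quad_coeffs g0) (quad_coeffs g1) (quad_coeffs g) = L * b2" using L_dvd_det[OF adm(1,2) g] by (elim dvdE)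
  have "[:D:] * g = [:L * b0:] * g0 + [:L * b1:] * g1 + [:L * b2:] * g2"
    unfolding D_def b0[symmetric] b1[symmetric] b2[symmetric]
    using cramer adm g unfolding admissible_def by blast
  then have "[:L:] * (const3 c * g) = [:L:] * ([:b0:] * g0 + [:b1:] * g1 + [:b2:] * g2)"
    unfolding c(2) ring_morph_mult[OF ring_morph_const] const3_def const2_def by (simp only: distrib_left mult.assoc)
  moreover have "[:L:] \<noteq> 0" using D_nonzero c by auto
  ultimately have "const3 c * g = [:b0:] * g0 + [:b1:] * g1 + [:b2:] * g2" by (simp only: mult_cancel_left) simp
  then have "const3 c * g \<in> Ig" unfolding Ig_def by blast
  then have "const3 (inverse c) * (const3 c * g) \<in> Ig" using ideal_Ig unfolding ideal_type_ring_iff by blast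
  moreover have "const3 (inverse c) * (const3 c * g) = g"
    using c(1) by (simp add: mult.assoc[symmetric] ring_morph_mult[OF ring_morph_const3, symmetric] ring_morph_one[OF ring_morph_const3])
  ultimately show ?thesis by simp
qed

lemma fat_conds_combination:
  assumes "fat_conds \<pi> s n f" "fat_conds \<pi> s n f'"
  shows "fat_conds \<pi> s n (smult a f + smult b f')"
proof -
  have "coeff (smult a f + smult b f') 0 + s * coeff (smult a f + smult b f') 1 + s * s * coeff (smult a f + smult b f') 2 =
    a * (coeff f 0 + s * coeff f 1 + s * s * coeff f 2) + b * (coeff f' 0 + s * coeff f' 1 + s * s * coeff f' 2)"
    "coeff (smult a f + smult b f') 1 + 2 * s * coeff (smult a f + smult b f') 2 =
    a * (coeff f 1 + 2 * s * coeff f 2) + b * (coeff f' 1 + 2 * s * coeff f' 2)"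
    by (simp_all add: algebra_simps)
  then show ?thesis using assms unfolding fat_conds_def by (simp add: dvd_add dvd_mult)
qed

lemma admissible_combination:
  assumes "admissible f" "admissible f'" shows "admissible (smult a f + smult b f')"
proof -
  have "Polynomial.degree (smult a f + smult b f') \<le> 2"
    using assms unfolding admissible_def by (meson degree_add_le degree_smult_le le_trans)
  then show ?thesis using assms fat_conds_combination unfolding admissible_def by blast
qed

text \<open>
  This is saturation. Division of the coefficients by \<open>z - c\<close> reduces a relation \<open>(z - c) r \<in> Ig\<close> to
  one with coefficients in \<open>k[x,y]\<close>, in which \<open>r\<close> has degree at most one in \<open>z\<close>. The product satisfies
  the conditions at the base points, hence so does \<open>r\<close>, and \<open>r\<close> is a combination of the generators.
\<close>

lemma linear_nonzerodivisor:
  assumes c: "\<And>q. q \<in> B \<Longrightarrow> poly ([:[:0, \<sigma> q:]:] - c) [:0, \<tau> q:] \<noteq> 0"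
    and r: "[:- c, 1:] * r \<in> Ig"
  shows "r \<in> Ig"
proof -
  obtain a0 a1 a2 where a: "[:- c, 1:] * r = a0 * g0 + a1 * g1 + a2 * g2" using r unfolding Ig_def by blast
  \<comment> \<open>Quotients of the coefficients by \<open>z - c\<close>; the remainders are their values at \<open>z = c\<close>.\<close>
  define b0 b1 b2 where b: "b0 = synthetic_div a0 c" "b1 = synthetic_div a1 c" "b2 = synthetic_div a2 c"
  \<comment> \<open>The factor 1 gives this sum of three terms the shape required by \<open>admissible_combination\<close>.\<close>
  define s where "s = smult 1 (smult (poly a0 c) g0 + smult (poly a1 c) g1) + smult (poly a2 c) g2"
  define r' where "r' = r - (b0 * g0 + b1 * g1 + b2 * g2)"
  have eq: "[:- c, 1:] * r' = s"
  proof -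
    have "a0 = [:- c, 1:] * b0 + [:poly a0 c:]" "a1 = [:- c, 1:] * b1 + [:poly a1 c:]" "a2 = [:- c, 1:] * b2 + [:poly a2 c:]"
      unfolding b by (simp_all only: synthetic_div_correct')
    then have "[:- c, 1:] * r = ([:- c, 1:] * b0 + [:poly a0 c:]) * g0 + ([:- c, 1:] * b1 + [:poly a1 c:]) * g1 + ([:- c, 1:] * b2 + [:poly a2 c:]) * g2"
      using a by argo
    also have "\<dots> = [:- c, 1:] * (b0 * g0 + b1 * g1 + b2 * g2) + s"
      unfolding s_def by (simp only: distrib_left distrib_right mult.assoc ac_simps smult_1_left) (simp add: ac_simps)
    finally show ?thesis unfolding r'_def by (simp only: right_diff_distrib) simp
  qed
  have adm: "admissible s" unfolding s_def by (intro admissible_combination generators_admissible) simp_all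
  have deg': "Polynomial.degree r' \<le> 1"
  proof (cases "r' = 0")
    case False
    have "Polynomial.degree ([:- c, 1:] * r') = 1 + Polynomial.degree r'" using False by (subst degree_mult_eq) auto
    then show ?thesis using adm unfolding admissible_def eq by simp
  qed simp
  have "admissible r'"
    unfolding admissible_def
  proof (intro conjI ballI)
    show "Polynomial.degree r' \<le> 2" using deg' by simp
    fix q assume q: "q \<in> B"
    show "fat_conds (ell (\<tau> q)) [:[:0, \<sigma> q:]:] (m q) r'"
      unfolding ell_def
    proof (rule fat_conds_linear_factor[OF deg' c[OF q] m[OF q]])
      show "fat_conds [:- [:0, \<tau> q:], 1:] [:[:0, \<sigma> q:]:] (m q) ([:- c, 1:] * r')"
        using adm q unfolding eq admissible_def ell_def by blast
    qed
  qed
  then have "r' \<in> Ig" by (rule admissible_in_Ig)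
  moreover have "b0 * g0 + b1 * g1 + b2 * g2 \<in> Ig" unfolding Ig_def by blast
  ultimately have "r' + (b0 * g0 + b1 * g1 + b2 * g2) \<in> Ig" using ideal_Ig unfolding ideal_type_ring_iff by blast
  then show ?thesis unfolding r'_def by simp
qed

end

lemma subst3_congruence:
  fixes r :: "'a::comm_ring_1 poly3"
  assumes Q: "ideal Q ring_of_type_algebra"
    and X: "X3 - A \<in> Q" and Y: "Y3 - A' \<in> Q" and Z: "Z3 - A'' \<in> Q"
  shows "r - subst3 const3 r A A' A'' \<in> Q"
proof -
  note Qi = Q[unfolded ideal_type_ring_iff]
  have mult: "x * y - x' * y' \<in> Q" if "x - x' \<in> Q" "y - y' \<in> Q" for x y x' y'
  proof -
    have "y * (x - x') + x' * (y - y') \<in> Q" using that Qi by blast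
    then show ?thesis by (simp add: algebra_simps)
  qed
  have pow: "x ^ n - x' ^ n \<in> Q" if "x - x' \<in> Q" for x x' n
  proof (induction n)
    case 0 then show ?case using Qi by simp
  next
    case (Suc n) then show ?case unfolding power_Suc by (intro mult that)
  qed
  show ?thesis
  proof (rule poly3_monomial_induct[of _ r])
    show "0 - subst3 const3 0 A A' A'' \<in> Q" using Qi by (simp add: subst3_simps ring_morph_const3)
    show "(f + g) - subst3 const3 (f + g) A A' A'' \<in> Q"
      if "f - subst3 const3 f A A' A'' \<in> Q" "g - subst3 const3 g A A' A'' \<in> Q" for f g
    proof -
      have "(f - subst3 const3 f A A' A'') + (g - subst3 const3 g A A' A'') \<in> Q" using that Qi by blast
      then show ?thesis by (simp add: subst3_simps ring_morph_const3 algebra_simps)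
    qed
    fix i j l
    have "k - k \<in> Q" for k using Qi by simp
    then have "const3 c * X3 ^ i * Y3 ^ j * Z3 ^ l - const3 c * A ^ i * A' ^ j * A'' ^ l \<in> Q" for c
      by (intro mult pow X Y Z)
    then show "const3 (coeff3 r i j l) * X3 ^ i * Y3 ^ j * Z3 ^ l -
      subst3 const3 (const3 (coeff3 r i j l) * X3 ^ i * Y3 ^ j * Z3 ^ l) A A' A'' \<in> Q"
      by (simp only: subst3_simps ring_morph_const3)
  qed
qed

text \<open>
  On the line \<open>y = t x\<close> the exponent of \<open>x\<close> that accompanies \<open>z\<^sup>l\<close> is fixed by the degree.
\<close>

lemma form_restrict_to_line:
  fixes g :: "'a::field poly3"
  assumes "is_form d g"
  shows "subst3 const3 g X3 (const3 t * X3) Z3 = (\<Sum>l\<le>d. const3 (coeff (slice 1 t g) l) * X3 ^ (d - l) * Z3 ^ l)"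
  using assms
proof (rule form_monomial_induct)
  note s = ring_morph_simps[OF ring_morph_slice]
  note c = ring_morph_simps[OF ring_morph_const3]
  show "subst3 const3 (0::'a poly3) X3 (const3 t * X3) Z3 = (\<Sum>l\<le>d. const3 (coeff (slice 1 t 0) l) * X3 ^ (d - l) * Z3 ^ l)"
    by (simp add: subst3_simps ring_morph_const3 s c)
  show "subst3 const3 (f + g) X3 (const3 t * X3) Z3 = (\<Sum>l\<le>d. const3 (coeff (slice 1 t (f + g)) l) * X3 ^ (d - l) * Z3 ^ l)"
    if "subst3 const3 f X3 (const3 t * X3) Z3 = (\<Sum>l\<le>d. const3 (coeff (slice 1 t f) l) * X3 ^ (d - l) * Z3 ^ l)"
      "subst3 const3 g X3 (const3 t * X3) Z3 = (\<Sum>l\<le>d. const3 (coeff (slice 1 t g) l) * X3 ^ (d - l) * Z3 ^ l)" for f g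
    by (simp add: subst3_simps ring_morph_const3 s c that distrib_right sum.distrib)
  fix k :: 'a and i j l assume d: "i + j + l = d"
  have "slice 1 t (const3 k * X3 ^ i * Y3 ^ j * Z3 ^ l) = [:k:] * [:1:] ^ i * [:t:] ^ j * [:0, 1:] ^ l"
    unfolding slice_eq_subst3 by (simp only: subst3_simps ring_morph_const)
  also have "\<dots> = monom (k * t ^ j) l"
    by (simp add: monom_altdef one_pCons[symmetric] ring_morph_power[OF ring_morph_const, symmetric] mult.commute)
  finally have sl: "slice 1 t (const3 k * X3 ^ i * Y3 ^ j * Z3 ^ l) = monom (k * t ^ j) l" .
  have "(\<Sum>l'\<le>d. const3 (coeff (monom (k * t ^ j) l) l') * X3 ^ (d - l') * Z3 ^ l') =
    (\<Sum>l'\<le>d. if l = l' then const3 (k * t ^ j) * X3 ^ (d - l) * Z3 ^ l else 0)"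
    by (rule sum.cong) (auto simp: coeff_monom c)
  also have "\<dots> = const3 (k * t ^ j) * X3 ^ (i + j) * Z3 ^ l" using d by (auto simp: sum.delta)
  also have "\<dots> = subst3 const3 (const3 k * X3 ^ i * Y3 ^ j * Z3 ^ l) X3 (const3 t * X3) Z3"
    by (simp add: subst3_simps ring_morph_const3 c power_mult_distrib power_add mult_ac)
  finally show "subst3 const3 (const3 k * X3 ^ i * Y3 ^ j * Z3 ^ l) X3 (const3 t * X3) Z3 =
    (\<Sum>l'\<le>d. const3 (coeff (slice 1 t (const3 k * X3 ^ i * Y3 ^ j * Z3 ^ l)) l') * X3 ^ (d - l') * Z3 ^ l')"
    unfolding sl ..
qed

lemma prime_prod_power:
  assumes Q: "primeideal Q (ring_of_type_algebra :: 'r::comm_ring_1 ring)" and "finite T" "(\<Prod>t\<in>T. f t ^ n t) \<in> Q"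
  shows "\<exists>t\<in>T. f t \<in> Q"
proof -
  note Qp = Q[unfolded primeideal_type_ring_iff]
  have pow: "x \<in> Q" if "x ^ k \<in> Q" for x k
    using that by (induction k) (use Qp in auto)
  show ?thesis using assms(2,3)
  proof (induction T rule: finite_induct)
    case empty then show ?case using Qp by simp
  next
    case (insert t T)
    then have "f t ^ n t \<in> Q \<or> (\<Prod>t\<in>T. f t ^ n t) \<in> Q" using Qp by simp
    then show ?case using pow insert.IH by blast
  qed
qed

lemma const3_not_in_prime:
  assumes Q: "primeideal Q (ring_of_type_algebra :: 'a::field poly3 ring)" and c: "c \<noteq> 0"
  shows "const3 c \<notin> Q"
proof
  assume "const3 c \<in> Q"
  then have "const3 (inverse c) * const3 c \<in> Q" using Q unfolding primeideal_type_ring_iff ideal_type_ring_iff by blast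
  then show False using Q c unfolding primeideal_type_ring_iff
    by (simp add: ring_morph_mult[OF ring_morph_const3, symmetric] ring_morph_one[OF ring_morph_const3])
qed

text \<open>
  Over an algebraically closed field a binary form is a product of linear factors. Here it has degree
  at most two in \<open>z\<close>, so the factors can be written down.
\<close>

lemma binary_form_in_prime:
  fixes Q :: "'a::alg_closed_field poly3 set"
  assumes Q: "primeideal Q ring_of_type_algebra" and d: "d \<ge> 2" and nz: "(c0, c1, c2) \<noteq> (0, 0, 0)"
    and f: "const3 c0 * X3 ^ d + const3 c1 * X3 ^ (d - 1) * Z3 + const3 c2 * X3 ^ (d - 2) * Z3 ^ 2 \<in> Q"
  shows "X3 \<in> Q \<or> (\<exists>s. Z3 - const3 s * X3 \<in> Q)"
proof -
  note Qp = Q[unfolded primeideal_type_ring_iff]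
  note c = ring_morph_simps[OF ring_morph_const3]
  have pow: "x \<in> Q" if "x ^ k \<in> Q" for x k
    using that by (induction k) (use Qp in auto)
  have X: "X3 ^ d = X3 ^ (d - 2) * (X3 * X3 :: 'a poly3)" "X3 ^ (d - 1) = X3 ^ (d - 2) * (X3 :: 'a poly3)"
  proof -
    obtain n where n: "d = n + 2" using d by (metis add.commute le_Suc_ex)
    show "X3 ^ d = X3 ^ (d - 2) * (X3 * X3 :: 'a poly3)" "X3 ^ (d - 1) = X3 ^ (d - 2) * (X3 :: 'a poly3)"
      unfolding n by (simp_all add: mult_ac)
  qed
  have split: "X3 \<in> Q \<or> A \<in> Q" if "const3 k * X3 ^ n * A \<in> Q" "k \<noteq> 0" for k n A
    using that const3_not_in_prime[OF Q that(2)] pow Qp by blast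
  show ?thesis
  proof (cases "c2 = 0")
    case False
    then have "Polynomial.degree [:c0, c1, c2:] > 0" by simp
    then obtain r where "poly [:c0, c1, c2:] r = 0" using alg_closed_imp_poly_has_root by blast
    then have r: "c0 = - c1 * r - c2 * r * r" by (simp add: eq_neg_iff_add_eq_0 algebra_simps)
    define r' where "r' = - c1 / c2 - r"
    have c1: "c1 = - c2 * (r + r')" unfolding r'_def using False by (simp add: field_simps)
    have c0: "c0 = c2 * r * r'" unfolding r c1 by (simp add: algebra_simps)
    have "const3 c0 * X3 ^ d + const3 c1 * X3 ^ (d - 1) * Z3 + const3 c2 * X3 ^ (d - 2) * Z3 ^ 2 =
      const3 c2 * X3 ^ (d - 2) * ((Z3 - const3 r * X3) * (Z3 - const3 r' * X3))"
      unfolding X c0 c1 c power2_eq_square by (simp add: algebra_simps)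
    then have "const3 c2 * X3 ^ (d - 2) * ((Z3 - const3 r * X3) * (Z3 - const3 r' * X3)) \<in> Q" using f by simp
    then show ?thesis using split False Qp by blast
  next
    case c2: True
    show ?thesis
    proof (cases "c1 = 0")
      case False
      have "const3 c0 * X3 ^ d + const3 c1 * X3 ^ (d - 1) * Z3 + const3 c2 * X3 ^ (d - 2) * Z3 ^ 2 =
        const3 c1 * X3 ^ (d - 1) * (Z3 - const3 (- c0 / c1) * X3)"
      proof -
        have "const3 (- c1 * (- c0 / c1)) = - const3 c1 * const3 (- c0 / c1)" by (simp only: c)
        then have "const3 c0 = - const3 c1 * const3 (- c0 / c1)" using False by simp
        then show ?thesis unfolding X c2 by (simp add: algebra_simps c)
      qed
      then show ?thesis using split[OF _ False] f by metis
    next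
      case True
      then have "c0 \<noteq> 0" "const3 c0 * X3 ^ d * 1 \<in> Q" using nz c2 f by (auto simp: c)
      then show ?thesis using split Qp by blast
    qed
  qed
qed

text \<open>
  Modulo \<open>Q\<close> the three variables are polynomials in \<open>w\<close>, and then so is everything else.
\<close>

lemma curve_of_parametrisation:
  fixes Q :: "'a::field poly3 set"
  assumes Q: "ideal Q ring_of_type_algebra"
    and X: "X3 - poly (map_poly const3 a) w \<in> Q" and Y: "Y3 - poly (map_poly const3 b) w \<in> Q"
    and Z: "Z3 - poly (map_poly const3 c) w \<in> Q"
  shows "\<exists>p. r - poly (map_poly const3 p) w \<in> Q"
proof -
  note ev = ring_morph_eval[OF ring_morph_const3, of w]
  have "poly (map_poly const3 (subst3 (\<lambda>c. [:c:]) r a b c)) w =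
    subst3 (\<lambda>x. poly (map_poly const3 [:x:]) w) r (poly (map_poly const3 a) w) (poly (map_poly const3 b) w) (poly (map_poly const3 c) w)"
    by (rule morph_subst3[OF ev ring_morph_const])
  also have "(\<lambda>x. poly (map_poly const3 [:x:]) w) = const3"
    by (rule ext) (rule poly_map_poly_const[OF ring_morph_const3])
  finally have "poly (map_poly const3 (subst3 (\<lambda>c. [:c:]) r a b c)) w =
    subst3 const3 r (poly (map_poly const3 a) w) (poly (map_poly const3 b) w) (poly (map_poly const3 c) w)" .
  then show ?thesis using subst3_congruence[OF Q X Y Z, of r] by metis
qed

lemma ell_eq: "[:ell t:] = Y3 - const3 t * X3"
  by (simp add: ell_def Y3_def const3_def X3_def)

context quadratic_cremona
begin

text \<open>
  The determinant lies in the ideal, by Cramer's rule for the constant \<open>1\<close>. So a prime over the ideal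
  contains the equation of one of the lines through \<open>(0, 0, 1)\<close>, and also a factor of the restriction
  of a generator to that line. Together they define a line through the origin of three-space.
\<close>

lemma curve_over_Ig:
  assumes Q: "primeideal Q ring_of_type_algebra" and IQ: "Ig \<subseteq> Q"
  shows "\<exists>w. \<forall>r. \<exists>p. r - poly (map_poly const3 p) w \<in> Q"
proof -
  have Qi: "ideal Q ring_of_type_algebra" using Q by (rule primeideal.axioms(1))
  note Qp = Q[unfolded primeideal_type_ring_iff] and Qa = Qi[unfolded ideal_type_ring_iff]
  have "[:D:] * 1 \<in> Ig"
  proof -
    have "[:D:] * 1 = [:det3 (quad_coeffs 1) (quad_coeffs g1) (quad_coeffs g2):] * g0 + [:det3 (quad_coeffs g0) (quad_coeffs 1) (quad_coeffs g2):] * g1 + [:det3 (quad_coeffs g0) (quad_coeffs g1) (quad_coeffs 1):] * g2"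
      unfolding D_def by (rule cramer) (simp_all add: deg)
    then show ?thesis unfolding Ig_def by blast
  qed
  then have "[:D:] \<in> Q" using IQ by auto
  obtain c where c: "c \<noteq> 0" "D = L * const2 c" using D_eq by blast
  have "[:D:] = [:L:] * const3 c"
    unfolding c(2) ring_morph_mult[OF ring_morph_const] by (simp only: const3_def const2_def)
  then have "[:L:] \<in> Q" using \<open>[:D:] \<in> Q\<close> const3_not_in_prime[OF Q c(1)] Qp by metis
  moreover have "[:L:] = (\<Prod>t\<in>T. [:ell t:] ^ E t)"
  proof -
    have "[:\<Prod>t\<in>S. ell t ^ E t:] = (\<Prod>t\<in>S. [:ell t:] ^ E t)" if "finite S" for S
      using that
    proof (induction S rule: finite_induct)
      case empty then show ?case unfolding prod.empty by (rule ring_morph_one[OF ring_morph_const])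
    next
      case (insert t S)
      then show ?case unfolding prod.insert[OF insert(1,2)] ring_morph_mult[OF ring_morph_const] ring_morph_power[OF ring_morph_const]
        by simp
    qed
    then show ?thesis unfolding L_def using finT by blast
  qed
  ultimately obtain t where t: "[:ell t:] \<in> Q" using prime_prod_power[OF Q finT, of "\<lambda>t. [:ell t:]" E] by auto
  have Y: "Y3 - const3 t * X3 \<in> Q" using t unfolding ell_eq .
  obtain g where g: "g \<in> {g0, g1, g2}" "slice 1 t g \<noteq> 0" using no_line by blast
  let ?u = "slice 1 t g"
  have du: "Polynomial.degree ?u \<le> 2" using degree_slice_le deg[OF g(1)] by blast
  have "g - subst3 const3 g X3 (const3 t * X3) Z3 \<in> Q"
    using subst3_congruence[OF Qi _ Y, of X3 Z3 g] Qa by simp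
  moreover have "g \<in> Q" using generators_in_Ig[OF g(1)] IQ by blast
  ultimately have "g - (g - subst3 const3 g X3 (const3 t * X3) Z3) \<in> Q" using ideal_type_ring_diff[OF Qi] by blast
  then have "subst3 const3 g X3 (const3 t * X3) Z3 \<in> Q" by simp
  moreover have "(\<Sum>l\<le>d. const3 (coeff ?u l) * X3 ^ (d - l) * Z3 ^ l) =
      const3 (coeff ?u 0) * X3 ^ d + const3 (coeff ?u 1) * X3 ^ (d - 1) * Z3 + const3 (coeff ?u 2) * X3 ^ (d - 2) * Z3 ^ 2"
  proof -
    have "(\<Sum>l\<le>d. const3 (coeff ?u l) * X3 ^ (d - l) * Z3 ^ l) = (\<Sum>l\<in>{0, 1, 2}. const3 (coeff ?u l) * X3 ^ (d - l) * Z3 ^ l)"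
      using d du by (intro sum.mono_neutral_right) (auto simp: coeff_eq_0 ring_morph_zero[OF ring_morph_const3])
    then show ?thesis by (simp add: add.assoc)
  qed
  ultimately have q: "const3 (coeff ?u 0) * X3 ^ d + const3 (coeff ?u 1) * X3 ^ (d - 1) * Z3 + const3 (coeff ?u 2) * X3 ^ (d - 2) * Z3 ^ 2 \<in> Q"
    unfolding form_restrict_to_line[OF form[OF g(1)]] by simp
  have "(coeff ?u 0, coeff ?u 1, coeff ?u 2) \<noteq> (0, 0, 0)" using quadratic_eq[OF du] g(2) by auto
  from binary_form_in_prime[OF Q d this q] show ?thesis
  proof
    assume X: "X3 \<in> Q"
    have "(Y3 - const3 t * X3) + const3 t * X3 \<in> Q" using X Y Qa by blast
    then have Y0: "Y3 \<in> Q" by simp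
    have "\<exists>p. r - poly (map_poly const3 p) Z3 \<in> Q" for r
      by (rule curve_of_parametrisation[OF Qi, of 0 Z3 0 "[:0, 1:]"])
         (use X Y0 Qa in \<open>simp_all add: poly_map_poly_var[OF ring_morph_const3] del: poly_pCons\<close>)
    then show ?thesis by blast
  next
    assume "\<exists>s. Z3 - const3 s * X3 \<in> Q"
    then obtain s where s: "Z3 - const3 s * X3 \<in> Q" by blast
    have ev: "poly (map_poly const3 [:0, k:]) X3 = const3 k * X3" for k :: 'a
      by (simp add: map_poly_pCons ring_morph_zero[OF ring_morph_const3] mult.commute)
    have "\<exists>p. r - poly (map_poly const3 p) X3 \<in> Q" for r
      by (rule curve_of_parametrisation[OF Qi, of "[:0, 1:]" X3 "[:0, t:]" "[:0, s:]"])
         (use s Y Qa in \<open>simp_all add: ev ring_morph_one[OF ring_morph_const3] del: poly_pCons\<close>)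
    then show ?thesis by blast
  qed
qed

end

section \<open>Cremona maps with a point of multiplicity $d-2$\<close>

lemma to_std_line:
  assumes \<phi>: "ring_morph \<phi>" and q: "to_std (\<lambda>x. x) p \<nu> (a, b, c) = (q0, q1, q2)"
  shows "\<exists>w0 w1 w2. to_std \<phi> p \<nu> (s * \<phi> a + \<pi> * v0, s * \<phi> b + \<pi> * v1, s * \<phi> c + \<pi> * v2) =
    (s * \<phi> q0 + \<pi> * w0, s * \<phi> q1 + \<pi> * w1, s * \<phi> q2 + \<pi> * w2)"
proof -
  obtain w0 w1 w2 where w: "to_std \<phi> p \<nu> (v0, v1, v2) = (w0, w1, w2)" by (metis prod_cases3)
  have "to_std \<phi> p \<nu> (s * \<phi> a + \<pi> * v0, s * \<phi> b + \<pi> * v1, s * \<phi> c + \<pi> * v2) =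
    (s * \<phi> q0 + \<pi> * w0, s * \<phi> q1 + \<pi> * w1, s * \<phi> q2 + \<pi> * w2)"
    using q[symmetric] w[symmetric] by (cases p) (auto simp: ring_morph_simps[OF \<phi>] split: if_splits, (simp add: algebra_simps)+)
  then show ?thesis by blast
qed

lemma blowup_systemI:
  "g \<in> \<Lambda> \<Longrightarrow> chart_pullback t g = exceptional t ^ virt_mult_origin \<Lambda> * g' \<Longrightarrow> g' \<in> blowup_system t \<Lambda>"
  unfolding blowup_system_def by blast

lemma from_std_scale: "from_std \<phi> p \<nu> (s * a, s * b, s * c) = map_triple ((*) s) (from_std \<phi> p \<nu> (a, b, c))"
  by (cases p) (simp add: algebra_simps)

lemma from_std_zero: "from_std \<phi> p \<nu> (0, 0, 0) = (0, 0, 0)"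
  by (cases p) simp

lemma from_std_self: "p \<in> proj_plane \<Longrightarrow> from_std (\<lambda>x. x) p \<nu> p = (0, 0, 1)"
  by (cases p) (auto simp: proj_plane_def)

lemma to_std_self: "p \<in> proj_plane \<Longrightarrow> to_std (\<lambda>x. x) p \<nu> (0, 0, 1) = p"
  by (cases p) (auto simp: proj_plane_def)

lemma subst2_shift_back:
  "subst2 const2 (subst2 const2 P (U2 - const2 \<nu> * V2) V2) (U2 + const2 \<nu> * V2) V2 = P"
  by (rule morph_eq_poly2[of "\<lambda>P. subst2 const2 (subst2 const2 P (U2 - const2 \<nu> * V2) V2) (U2 + const2 \<nu> * V2) V2" "\<lambda>P. P"])
     (simp_all add: ring_morph_id ring_morph_comp[OF ring_morph_subst2 ring_morph_subst2] ring_morph_const2 subst2_simps)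

lemma coeff_coord_eq_0_iff: "coeff (coord p \<nu> f) l = 0 \<longleftrightarrow> coeff (coord p 0 f) l = 0"
proof -
  note z = ring_morph_zero[OF ring_morph_subst2[OF ring_morph_const2]]
  show ?thesis unfolding coeff_coord_shift[of p \<nu>] using subst2_shift_back[of "coeff (coord p 0 f) l" \<nu>] z by metis
qed

lemma local_equation_at_origin:
  assumes "q \<in> proj_plane"
  shows "coeff (coeff (local_equation q f) 0) 0 = subst_at (\<lambda>x. x) f q"
proof -
  let ?e = "\<lambda>P. poly (poly P 0) 0"
  have e: "ring_morph ?e" by (rule ring_morph_comp[OF ring_morph_poly_eval ring_morph_poly_eval])
  have "local_equation q f = subst_at const2 (coord q 0 f) (U2, V2, 1)"
    by (simp add: subst3_dehomogenize local_equation_coord)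
  then have "?e (local_equation q f) = subst_at (\<lambda>x. ?e (const2 x)) (coord q 0 f) (map_triple ?e (U2, V2, 1))"
    by (simp only: morph_subst_at[OF e ring_morph_const2])
  also have "\<dots> = subst_at (\<lambda>x. x) (coord q 0 f) (0, 0, 1)" by (simp add: const2_def U2_def V2_def)
  also have "\<dots> = subst_at (\<lambda>x. x) f q"
    unfolding subst_at_coord[OF ring_morph_id] to_std_self[OF assms] ..
  finally show ?thesis by (simp add: poly_0_coeff_0)
qed

lemma not_unit_line: "\<not> Y3 - const3 t * X3 dvd (1 :: 'a::field poly3)" "\<not> X3 dvd (1 :: 'a::field poly3)"
proof -
  have s: "ring_morph (\<lambda>f :: 'a poly3. subst3 (\<lambda>x. x) f 0 0 0)" by (rule ring_morph_subst3[OF ring_morph_id])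
  show "\<not> Y3 - const3 t * X3 dvd (1 :: 'a poly3)"
    using ring_morph_dvd[OF s, of "Y3 - const3 t * X3" 1] by (auto simp: subst3_simps ring_morph_id)
  show "\<not> X3 dvd (1 :: 'a poly3)"
    using ring_morph_dvd[OF s, of X3 1] by (auto simp: subst3_simps ring_morph_id)
qed

text \<open>
  Modulo \<open>y - t x\<close> a form is determined by its restriction to the line, because its degree restores the
  powers of \<open>x\<close>.
\<close>

lemma line_dvd_of_slice_zero:
  assumes f: "is_form d f" and "slice 1 t f = 0"
  shows "Y3 - const3 t * X3 dvd (f :: 'a::field poly3)"
proof -
  let ?Q = "{r. Y3 - const3 t * X3 dvd r}"
  have Q: "ideal ?Q ring_of_type_algebra" unfolding ideal_type_ring_iff by auto
  have "f - subst3 const3 f X3 (const3 t * X3) Z3 \<in> ?Q"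
    by (rule subst3_congruence[OF Q]) simp_all
  moreover have "subst3 const3 f X3 (const3 t * X3) Z3 = 0"
    unfolding form_restrict_to_line[OF f] assms(2) by (simp add: ring_morph_zero[OF ring_morph_const3])
  ultimately show ?thesis by simp
qed

text \<open>
  For a form, the restriction to the line of direction \<open>c\<close> through \<open>p\<close> collects the values of the
  homogeneous parts of its local equation in that direction.
\<close>

lemma coeff_slice_form:
  fixes G :: "'a::field poly3"
  assumes "is_form d G" "l \<le> d"
  shows "coeff (slice 1 c G) l = poly (hom_part_u (d - l) (poly G 1)) c"
  using assms(1)
proof (rule form_monomial_induct)
  show "coeff (slice 1 c 0) l = poly (hom_part_u (d - l) (poly 0 1)) c"
    by (simp add: ring_morph_zero[OF ring_morph_slice] hom_part_zero)
  show "coeff (slice 1 c (f + g)) l = poly (hom_part_u (d - l) (poly (f + g) 1)) c"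
    if "coeff (slice 1 c f) l = poly (hom_part_u (d - l) (poly f 1)) c"
      "coeff (slice 1 c g) l = poly (hom_part_u (d - l) (poly g 1)) c" for f g
    using that by (simp add: ring_morph_add[OF ring_morph_slice] hom_part_u_add)
  fix k :: 'a and i j n assume d: "i + j + n = d"
  have "poly (const3 k * X3 ^ i * Y3 ^ j * Z3 ^ n) 1 = const2 k * U2 ^ i * V2 ^ j"
    by (simp add: const3_def X3_def Y3_def Z3_def const2_def U2_def V2_def)
  then have 1: "hom_part_u (d - l) (poly (const3 k * X3 ^ i * Y3 ^ j * Z3 ^ n) 1) = (if n = l then monom k j else 0)"
    using d assms(2) by (auto simp: hom_part_u_monomial)
  have "slice 1 c (const3 k * X3 ^ i * Y3 ^ j * Z3 ^ n) = [:k:] * [:1:] ^ i * [:c:] ^ j * [:0, 1:] ^ n"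
    unfolding slice_eq_subst3 by (simp only: subst3_simps ring_morph_const)
  also have "\<dots> = monom (k * c ^ j) n"
    by (simp add: monom_altdef one_pCons[symmetric] ring_morph_power[OF ring_morph_const, symmetric] mult.commute)
  finally show "coeff (slice 1 c (const3 k * X3 ^ i * Y3 ^ j * Z3 ^ n)) l =
      poly (hom_part_u (d - l) (poly (const3 k * X3 ^ i * Y3 ^ j * Z3 ^ n) 1)) c"
    unfolding 1 by (simp add: poly_monom)
qed

locale cremona_system =
  fixes d :: nat and f0 f1 f2 :: "'a::alg_closed_field poly3"
  assumes cremona: "cremona_map d (f0, f1, f2)"
begin

abbreviation "F \<equiv> (f0, f1, f2)"

lemma generators: "f \<in> {f0, f1, f2} \<Longrightarrow> f \<in> linear_system F"
proof -
  note c = ring_morph_one[OF ring_morph_const3] ring_morph_zero[OF ring_morph_const3]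
  have "f0 = const3 1 * f0 + const3 0 * f1 + const3 0 * f2" "f1 = const3 0 * f0 + const3 1 * f1 + const3 0 * f2"
    "f2 = const3 0 * f0 + const3 0 * f1 + const3 1 * f2" by (simp_all add: c)
  then show "f \<in> {f0, f1, f2} \<Longrightarrow> f \<in> linear_system F" by (simp only: linear_system.simps) blast
qed

lemma form: "f \<in> {f0, f1, f2} \<Longrightarrow> is_form d f"
  using cremona unfolding cremona_map_def by auto

lemma f0_nonzero: "f0 \<noteq> 0"
proof
  assume "f0 = 0"
  then have "const3 1 * f0 + const3 0 * f1 + const3 0 * f2 = 0" by (simp add: ring_morph_zero[OF ring_morph_const3])
  moreover have "lin_indep F" using cremona unfolding cremona_map_def by blast
  ultimately have "(1 :: 'a) = 0" unfolding lin_indep.simps by blast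
  then show False by simp
qed

lemma low_coeffs_zero:
  "f \<in> {f0, f1, f2} \<Longrightarrow> i + j < virt_mult F (q, []) \<Longrightarrow> coeff (coeff (local_equation q f) j) i = 0"
  using virt_mult_origin_coeff[of "local_equation q f" "local_equation q ` linear_system F" i j] generators
  unfolding virt_mult_def by auto

lemma virt_mult_attained:
  "\<exists>f\<in>linear_system F. \<exists>i j. coeff (coeff (local_equation q f) j) i \<noteq> 0 \<and> i + j = virt_mult F (q, [])"
proof -
  let ?\<Lambda> = "local_equation q ` linear_system F"
  have in_L: "local_equation q f0 \<in> ?\<Lambda>" using generators[of f0] by blast
  have nz: "local_equation q f0 \<noteq> 0" by (rule local_equation_nonzero[OF form f0_nonzero]) simp
  have v: "virt_mult_origin ?\<Lambda> = virt_mult F (q, [])" unfolding virt_mult_def by simp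
  show ?thesis
    using virt_mult_origin_attained[OF in_L nz] unfolding v bex_simps(7) .
qed

lemma nonzero_system: "\<exists>g\<in>system_at F (q, []). g \<noteq> 0"
proof (rule bexI)
  show "local_equation q f0 \<noteq> 0" by (rule local_equation_nonzero[OF form f0_nonzero]) simp
  show "local_equation q f0 \<in> system_at F (q, [])"
    unfolding system_at.simps fold.simps id_apply using generators[of f0] by blast
qed

text \<open>
  Changes of coordinates are automorphisms, so common factors can be excluded in every frame.
\<close>

lemma common_factor_unit:
  assumes "\<And>f. f \<in> {f0, f1, f2} \<Longrightarrow> y dvd coord p' \<mu> f"
  shows "y dvd 1"
proof -
  have "uncoord p' \<mu> y dvd f" if "f \<in> {f0, f1, f2}" for f
    using ring_morph_dvd[OF ring_morph_uncoord assms[OF that], of p' \<mu>] by (simp only: uncoord_coord)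
  then have "uncoord p' \<mu> y dvd 1" using cremona unfolding cremona_map_def by simp
  then have "coord p' \<mu> (uncoord p' \<mu> y) dvd coord p' \<mu> 1" by (rule ring_morph_dvd[OF ring_morph_coord])
  then show ?thesis by (simp only: coord_uncoord ring_morph_one[OF ring_morph_coord])
qed

lemma no_common_line: "\<exists>f\<in>{f0, f1, f2}. slice 1 t (coord p' \<mu> f) \<noteq> 0"
proof (rule ccontr)
  assume "\<not> ?thesis"
  then have "Y3 - const3 t * X3 dvd coord p' \<mu> f" if "f \<in> {f0, f1, f2}" for f
    using line_dvd_of_slice_zero[OF is_form_coord[OF form[OF that]]] that by blast
  then show False using common_factor_unit not_unit_line(1) by blast
qed

end

text \<open>
  A point \<open>p\<close> of multiplicity \<open>d - 2\<close> and a frame in which no other proper base point lies on \<open>x = 0\<close>.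
\<close>

locale cremona_frame = cremona_system +
  fixes p :: "'a \<times> 'a \<times> 'a" and \<nu> :: 'a
  assumes d4: "d \<ge> 4" and p: "p \<in> proj_plane" and virt_p: "virt_mult (f0, f1, f2) (p, []) = d - 2"
    and frame: "\<And>q. (q, []) \<in> base_points (f0, f1, f2) \<Longrightarrow> q \<noteq> p \<Longrightarrow> fst (from_std (\<lambda>x. x) p \<nu> q) \<noteq> 0"
begin

text \<open>
  The equations in the frame, the other proper base points, and their affine coordinates.
\<close>

definition "\<theta> = coord p \<nu>"

definition "B = {q. (q, []) \<in> base_points F \<and> q \<noteq> p}"
definition "\<tau> q = fst (snd (from_std (\<lambda>x. x) p \<nu> q)) / fst (from_std (\<lambda>x. x) p \<nu> q)"
definition "\<sigma> q = snd (snd (from_std (\<lambda>x. x) p \<nu> q)) / fst (from_std (\<lambda>x. x) p \<nu> q)"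
definition "m q = virt_mult F (q, [])"

lemma form_\<theta>: "f \<in> {f0, f1, f2} \<Longrightarrow> is_form d (\<theta> f)"
  unfolding \<theta>_def by (intro is_form_coord form)

lemma coeff_\<theta>_high: "f \<in> {f0, f1, f2} \<Longrightarrow> l > 2 \<Longrightarrow> coeff (\<theta> f) l = 0"
  unfolding \<theta>_def coeff_coord_eq_0_iff[of p \<nu>]
  using d4 by (intro coord_coeff_zero[OF form, of _ "d - 2"] low_coeffs_zero) (simp_all add: virt_p)

lemma degree_\<theta>: "f \<in> {f0, f1, f2} \<Longrightarrow> Polynomial.degree (\<theta> f) \<le> 2"
  by (rule degree_le) (simp add: coeff_\<theta>_high)

text \<open>
  Otherwise all members of the linear system would have multiplicity at least \<open>d - 1\<close> at \<open>p\<close>.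
\<close>

lemma quadratic_\<theta>: "\<exists>f\<in>{f0, f1, f2}. coeff (\<theta> f) 2 \<noteq> 0"
proof (rule ccontr)
  assume "\<not> ?thesis"
  then have z: "coeff (coord p 0 f0) 2 = 0" "coeff (coord p 0 f1) 2 = 0" "coeff (coord p 0 f2) 2 = 0"
    unfolding \<theta>_def coeff_coord_eq_0_iff[of p \<nu>] by auto
  obtain f i j where f: "f \<in> linear_system F" "coeff (coeff (local_equation p f) j) i \<noteq> 0" "i + j = d - 2"
    using virt_mult_attained[of p] unfolding virt_p by blast
  obtain a b c where abc: "f = const3 a * f0 + const3 b * f1 + const3 c * f2" using f(1) by auto
  have fm: "is_form d f" unfolding abc by (intro is_form_add is_form_const_mult form) simp_all
  have cz: "coeff (coord p 0 f) 2 = 0"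
    unfolding abc ring_morph_add[OF ring_morph_coord] ring_morph_mult[OF ring_morph_coord] coord_const3
    using z by (simp add: const3_def)
  have "coeff (coeff (local_equation p f) j) i = coeff3 (coord p 0 f) i j 2"
    unfolding local_equation_coord coeff_dehomogenize[OF is_form_coord[OF fm]] using f(3) d4
    by (simp add: diff_diff_left)
  then show False using f(2) cz by simp
qed

lemma base_point_coords:
  assumes "q \<in> B"
  shows "\<exists>x. x \<noteq> 0 \<and> from_std (\<lambda>x. x) p \<nu> q = (x, x * \<tau> q, x * \<sigma> q)"
proof -
  obtain x y z where xyz: "from_std (\<lambda>x. x) p \<nu> q = (x, y, z)" by (metis prod_cases3)
  have "x \<noteq> 0" using frame assms xyz unfolding B_def by fastforce
  then show ?thesis unfolding \<tau>_def \<sigma>_def xyz by (intro exI[of _ x]) simp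
qed

text \<open>
  The coordinates of \<open>q\<close> in the frame are a multiple of \<open>(1, \<tau> q, \<sigma> q)\<close>; the factor is absorbed by \<open>s\<close>.
\<close>

lemma order_in_frame:
  assumes q: "q \<in> B" and f: "f \<in> {f0, f1, f2}" and \<phi>: "ring_morph \<phi>"
  shows "\<pi> ^ m q dvd subst_at \<phi> (\<theta> f) (s + \<pi> * v0, s * \<phi> (\<tau> q) + \<pi> * v1, s * \<phi> (\<sigma> q) + \<pi> * v2)"
proof -
  obtain x where x: "x \<noteq> 0" "from_std (\<lambda>x. x) p \<nu> q = (x, x * \<tau> q, x * \<sigma> q)" using base_point_coords[OF q] by blast
  obtain q0 q1 q2 where q012: "q = (q0, q1, q2)" by (metis prod_cases3)
  have ts: "to_std (\<lambda>x. x) p \<nu> (x, x * \<tau> q, x * \<sigma> q) = (q0, q1, q2)"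
    using to_std_from_std[of "\<lambda>x. x" p \<nu> q] x(2) q012 by simp
  let ?s = "s * \<phi> (1 / x)"
  have sx: "?s * \<phi> (x * k) = s * \<phi> k" for k
  proof -
    have "\<phi> (1 / x) * \<phi> (x * k) = \<phi> k" using x(1) by (simp add: ring_morph_mult[OF \<phi>, symmetric])
    then show ?thesis by (simp add: mult.assoc)
  qed
  have s1: "?s * \<phi> x = s" using sx[of 1] by (simp add: ring_morph_one[OF \<phi>])
  obtain w0 w1 w2 where w: "to_std \<phi> p \<nu> (?s * \<phi> x + \<pi> * v0, ?s * \<phi> (x * \<tau> q) + \<pi> * v1, ?s * \<phi> (x * \<sigma> q) + \<pi> * v2) =
    (?s * \<phi> q0 + \<pi> * w0, ?s * \<phi> q1 + \<pi> * w1, ?s * \<phi> q2 + \<pi> * w2)"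
    using to_std_line[OF \<phi> ts] by blast
  have qp: "q \<in> proj_plane" using q unfolding B_def base_points_def by auto
  have "\<pi> ^ m q dvd subst_at \<phi> f (?s * \<phi> q0 + \<pi> * w0, ?s * \<phi> q1 + \<pi> * w1, ?s * \<phi> q2 + \<pi> * w2)"
    unfolding m_def using low_coeffs_zero[OF f] by (intro order_at_point[OF form[OF f] _ qp q012 \<phi>]) blast
  then show ?thesis unfolding w[symmetric] \<theta>_def subst_at_coord[OF \<phi>] sx s1 .
qed

lemma order_\<theta>:
  assumes "q \<in> B" "f \<in> {f0, f1, f2}"
  shows "[:ell (\<tau> q):] ^ m q dvd pcompose (\<theta> f) [:[:[:0, \<sigma> q:]:], ell (\<tau> q):]"
proof -
  have "[:ell (\<tau> q):] ^ m q dvd subst_at const3 (\<theta> f)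
      (X3 + [:ell (\<tau> q):] * 0, X3 * const3 (\<tau> q) + [:ell (\<tau> q):] * 1, X3 * const3 (\<sigma> q) + [:ell (\<tau> q):] * Z3)"
    by (rule order_in_frame[OF assms ring_morph_const3])
  moreover have "X3 * const3 (\<tau> q) + [:ell (\<tau> q):] * 1 = Y3" unfolding ell_eq by simp
  moreover have "X3 * const3 (\<sigma> q) + [:ell (\<tau> q):] * Z3 = [:[:[:0, \<sigma> q:]:], ell (\<tau> q):]"
    by (simp add: X3_def const3_def Z3_def)
  ultimately show ?thesis by (simp add: pcompose_eq_subst3)
qed

lemma order_slice_\<theta>:
  assumes "q \<in> B" "f \<in> {f0, f1, f2}"
  shows "[:- \<sigma> q, 1:] ^ m q dvd slice 1 (\<tau> q) (\<theta> f)"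
proof -
  have "[:- \<sigma> q, 1:] ^ m q dvd subst_at (\<lambda>c. [:c:]) (\<theta> f)
      (1 + [:- \<sigma> q, 1:] * 0, 1 * [:\<tau> q:] + [:- \<sigma> q, 1:] * 0, 1 * [:\<sigma> q:] + [:- \<sigma> q, 1:] * 1)"
    by (rule order_in_frame[OF assms ring_morph_const])
  then show ?thesis by (simp add: slice_eq_subst3 one_pCons)
qed

text \<open>
  At a common zero of the generators the local equations of all members of the linear system have no
  constant term, so the virtual multiplicity is positive.
\<close>

lemma base_point_of_common_zero:
  assumes x: "x \<noteq> 0" and zero: "\<And>f. f \<in> {f0, f1, f2} \<Longrightarrow> poly (slice x y (\<theta> f)) z = 0"
  shows "\<exists>q\<in>B. y = \<tau> q * x"
proof -
  obtain a b c where abc: "to_std (\<lambda>x. x) p \<nu> (x, y, z) = (a, b, c)" by (metis prod_cases3)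
  have fs: "from_std (\<lambda>x. x) p \<nu> (a, b, c) = (x, y, z)" using from_std_to_std abc by metis
  have "(a, b, c) \<noteq> (0, 0, 0)" using fs x from_std_zero by (metis prod.inject)
  from proj_plane_normalise[OF this] obtain s q0 q1 q2 where s: "s \<noteq> 0" and qp: "(q0, q1, q2) \<in> proj_plane" and sq: "(a, b, c) = (s * q0, s * q1, s * q2)"
    by (elim exE conjE)
  let ?q = "(q0, q1, q2)"
  have fz: "subst_at (\<lambda>x. x) f ?q = 0" if "f \<in> {f0, f1, f2}" for f
  proof -
    have "poly (slice x y (\<theta> f)) z = subst_at (\<lambda>x. x) (\<theta> f) (x, y, z)"
      unfolding slice_eq_subst3
      using morph_subst3[OF ring_morph_poly_eval[of z] ring_morph_const, of "\<theta> f" "[:x:]" "[:y:]" "[:0, 1:]"] by simp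
    also have "\<dots> = subst_at (\<lambda>x. x) f (s * q0, s * q1, s * q2)"
      unfolding \<theta>_def subst_at_coord[OF ring_morph_id] abc sq ..
    also have "\<dots> = s ^ d * subst_at (\<lambda>x. x) f ?q"
      using form_subst3_scale[OF form[OF that] ring_morph_id] by simp
    finally show ?thesis using zero[OF that] s by simp
  qed
  have "virt_mult F (?q, []) \<noteq> 0"
  proof
    assume v0: "virt_mult F (?q, []) = 0"
    obtain f i j where f: "f \<in> linear_system F" "coeff (coeff (local_equation ?q f) j) i \<noteq> 0" "i + j = 0"
      using virt_mult_attained[of ?q] unfolding v0 by blast
    obtain k0 k1 k2 where k: "f = const3 k0 * f0 + const3 k1 * f1 + const3 k2 * f2" using f(1) by auto
    have "subst_at (\<lambda>x. x) f ?q = 0"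
      unfolding k using fz[of f0] fz[of f1] fz[of f2] by (simp add: subst3_simps ring_morph_id)
    then show False using f(2,3) local_equation_at_origin[OF qp, of f] by simp
  qed
  then have bp: "(?q, []) \<in> base_points F" unfolding base_points_def using qp by simp
  have xyz: "map_triple ((*) s) (from_std (\<lambda>x. x) p \<nu> ?q) = (x, y, z)"
    using fs unfolding sq from_std_scale .
  have "?q \<noteq> p"
  proof
    assume "?q = p"
    then have "map_triple ((*) s) (0, 0, 1) = (x, y, z)" using xyz from_std_self[OF p] by simp
    then show False using x by simp
  qed
  then have qB: "?q \<in> B" unfolding B_def using bp by simp
  obtain x' where x': "from_std (\<lambda>x. x) p \<nu> ?q = (x', x' * \<tau> ?q, x' * \<sigma> ?q)" using base_point_coords[OF qB] by blast
  have "x = s * x'" "y = s * (x' * \<tau> ?q)" using xyz unfolding x' by auto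
  then have "y = \<tau> ?q * x" by (simp add: mult_ac)
  then show ?thesis using qB by blast
qed

lemma coords_injective:
  assumes q: "q \<in> B" "q' \<in> B" and eq: "\<tau> q = \<tau> q'" "\<sigma> q = \<sigma> q'"
  shows "q = q'"
proof -
  obtain x where x: "x \<noteq> 0" "from_std (\<lambda>x. x) p \<nu> q = (x, x * \<tau> q, x * \<sigma> q)" using base_point_coords[OF q(1)] by blast
  obtain x' where x': "x' \<noteq> 0" "from_std (\<lambda>x. x) p \<nu> q' = (x', x' * \<tau> q', x' * \<sigma> q')" using base_point_coords[OF q(2)] by blast
  obtain a b c where abc: "q = (a, b, c)" by (metis prod_cases3)
  let ?k = "x' / x"
  have "from_std (\<lambda>x. x) p \<nu> (?k * a, ?k * b, ?k * c) = from_std (\<lambda>x. x) p \<nu> q'"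
    unfolding from_std_scale abc[symmetric] x(2) x'(2) using x(1) eq by simp
  then have e: "(?k * a, ?k * b, ?k * c) = q'" by (metis to_std_from_std)
  have "(a, b, c) \<in> proj_plane" "(?k * a, ?k * b, ?k * c) \<in> proj_plane"
    using q unfolding e abc[symmetric] B_def base_points_def by auto
  then have "?k = 1" by (rule proj_plane_eqI)
  then show ?thesis using e abc by simp
qed

text \<open>
  The components of the inverse map, written in the frame, return the coordinates of the frame.
\<close>

lemma inverse_in_frame:
  "\<exists>e Gx Gz h. is_form e Gx \<and> is_form e Gz \<and> h \<noteq> 0 \<and>
    subst3 const3 Gx (\<theta> f0) (\<theta> f1) (\<theta> f2) = h * X3 \<and> subst3 const3 Gz (\<theta> f0) (\<theta> f1) (\<theta> f2) = h * Z3"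
proof -
  obtain e G0 G1 G2 where G: "is_form e G0" "is_form e G1" "is_form e G2"
    "represents_identity (comp_triple (G0, G1, G2) F)"
    using cremona unfolding cremona_map_def birational_def by (metis forms_triple.simps prod_cases3)
  obtain h where h: "h \<noteq> 0" "subst3 const3 G0 f0 f1 f2 = h * X3" "subst3 const3 G1 f0 f1 f2 = h * Y3"
    "subst3 const3 G2 f0 f1 f2 = h * Z3"
    using G(4) unfolding represents_identity_def by auto
  have m\<theta>: "ring_morph \<theta>" unfolding \<theta>_def by (rule ring_morph_coord)
  define \<Psi> where "\<Psi> G = subst3 const3 G (\<theta> f0) (\<theta> f1) (\<theta> f2)" for G
  have m\<Psi>: "ring_morph \<Psi>" unfolding \<Psi>_def[abs_def] by (rule ring_morph_subst3[OF ring_morph_const3])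
  have \<Psi>: "\<Psi> G = \<theta> (subst3 const3 G f0 f1 f2)" for G
    unfolding \<Psi>_def morph_subst3[OF m\<theta> ring_morph_const3] unfolding \<theta>_def coord_const3 ..
  obtain H0 H1 H2 where H: "from_std const3 p \<nu> (G0, G1, G2) = (H0, H1, H2)" by (metis prod_cases3)
  have "is_form e H0 \<and> is_form e H1 \<and> is_form e H2"
    using H[symmetric] by (cases p) (auto split: if_splits intro!: is_form_add is_form_diff is_form_const_mult G)
  moreover have "(\<Psi> H0, \<Psi> H1, \<Psi> H2) = (\<theta> h * X3, \<theta> h * Y3, \<theta> h * Z3)"
  proof -
    have "(\<Psi> H0, \<Psi> H1, \<Psi> H2) = map_triple \<Psi> (from_std const3 p \<nu> (G0, G1, G2))" unfolding H by simp
    also have "\<dots> = from_std (\<lambda>x. \<Psi> (const3 x)) p \<nu> (\<Psi> G0, \<Psi> G1, \<Psi> G2)" by (simp only: map_from_std[OF m\<Psi>] map_triple.simps)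
    also have "(\<lambda>x. \<Psi> (const3 x)) = const3" unfolding \<Psi>_def by (simp add: subst3_const3 ring_morph_const3)
    also have "(\<Psi> G0, \<Psi> G1, \<Psi> G2) = (\<theta> h * \<theta> X3, \<theta> h * \<theta> Y3, \<theta> h * \<theta> Z3)"
      unfolding \<Psi> h ring_morph_mult[OF m\<theta>] ..
    also have "from_std const3 p \<nu> (\<theta> h * \<theta> X3, \<theta> h * \<theta> Y3, \<theta> h * \<theta> Z3) =
      map_triple ((*) (\<theta> h)) (from_std const3 p \<nu> (\<theta> X3, \<theta> Y3, \<theta> Z3))" by (rule from_std_scale)
    also have "(\<theta> X3, \<theta> Y3, \<theta> Z3) = to_std const3 p \<nu> (X3, Y3, Z3)"
    proof -
      obtain A B C where "to_std const3 p \<nu> (X3, Y3, Z3) = (A, B, C)" by (metis prod_cases3)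
      then show ?thesis unfolding \<theta>_def coord_def by (simp add: subst3_simps ring_morph_const3)
    qed
    finally show ?thesis unfolding from_std_to_std by simp
  qed
  moreover have "\<theta> h \<noteq> 0" using h(1) uncoord_coord[of p \<nu> h] ring_morph_zero[OF ring_morph_uncoord] unfolding \<theta>_def by metis
  ultimately show ?thesis unfolding \<Psi>_def by blast
qed

text \<open>
  Bezout for the line through \<open>p\<close> and \<open>q\<close>: if its multiplicities at the two points exceeded \<open>d\<close>, all
  members of the linear system would contain the line.
\<close>

lemma virt_mult_other_le_2:
  assumes q: "q \<in> B" shows "m q \<le> 2"
proof -
  obtain f where f: "f \<in> {f0, f1, f2}" "slice 1 (\<tau> q) (\<theta> f) \<noteq> 0" using no_common_line unfolding \<theta>_def by blast
  have "(\<Sum>r\<in>{q}. m r) \<le> Polynomial.degree (slice 1 (\<tau> q) (\<theta> f))"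
    by (rule sum_multiplicities_le_degree[of _ \<sigma>]) (use order_slice_\<theta>[OF q f(1)] f(2) in auto)
  also have "\<dots> \<le> 2" by (rule degree_slice_le[OF degree_\<theta>[OF f(1)]])
  finally show ?thesis by simp
qed

text \<open>
  Bezout for the line through \<open>p\<close> in the direction \<open>t\<close>. The coefficients of the
  restriction of a generator to this line are coefficients of degree at most two of its transform at the
  infinitely near point. If the multiplicity there is at least three, all of them vanish and the line is a
  common factor.
\<close>

lemma virt_mult_first_near_le_2: "virt_mult F (p, [t]) \<le> 2"
proof (rule ccontr)
  assume "\<not> ?thesis"
  then have v3: "e < virt_mult F (p, [t])" if "e \<le> 2" for e using that by simp
  let ?\<Lambda> = "local_equation p ` linear_system F"
  have v: "virt_mult_origin ?\<Lambda> = d - 2" using virt_p unfolding virt_mult_def by simp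
  have vt: "virt_mult_origin (blowup_system t ?\<Lambda>) = virt_mult F (p, [t])" unfolding virt_mult_def by simp
  show False
  proof (cases t)
    case (Some c)
    have "slice 1 c (coord p 0 f) = 0" if f: "f \<in> {f0, f1, f2}" for f
    proof (rule poly_eqI)
      fix l
      let ?g = "local_equation p f"
      have gm: "?g \<in> ?\<Lambda>" using generators[OF f] by blast
      show "coeff (slice 1 c (coord p 0 f)) l = coeff 0 l"
      proof (cases "l \<le> 2")
        case True
        obtain g' where g': "chart_pullback (Some c) ?g = U2 ^ (d - 2) * g'"
          "\<And>e a. coeff (coeff g' a) e = coeff (pcompose (hom_part_u (d - 2 + e) ?g) [:c, 1:]) a"
          using chart_pullback_Some[OF virt_mult_origin_coeff[OF gm, unfolded v], where c = c] by blast
        have "g' \<in> blowup_system t ?\<Lambda>" 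
          using g'(1) unfolding Some by (intro blowup_systemI[OF gm]) (simp only: v exceptional.simps)
        then have "coeff (coeff g' 0) (2 - l) = 0" using virt_mult_origin_coeff v3[of "2 - l"] vt by fastforce
        then have "poly (hom_part_u (d - 2 + (2 - l)) ?g) c = 0" unfolding g'(2) by (simp flip: poly_0_coeff_0 add: poly_pcompose)
        moreover have "d - 2 + (2 - l) = d - l" using True d4 by simp
        ultimately show ?thesis
          using coeff_slice_form[OF is_form_coord[OF form[OF f], of p 0], of l c] True d4 unfolding local_equation_coord by simp
      next
        case False
        then have "coeff (coord p 0 f) l = 0" using coeff_\<theta>_high[OF f, of l] unfolding \<theta>_def coeff_coord_eq_0_iff[of p \<nu>] by simp
        then show ?thesis by (simp add: coeff_slice)
      qed
    qed
    then show False using no_common_line[of c p 0] by blast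
  next
    case None
    have "X3 dvd coord p 0 f" if f: "f \<in> {f0, f1, f2}" for f
    proof (rule poly3_monomial_induct[of _ "coord p 0 f"])
      let ?g = "local_equation p f"
      have gm: "?g \<in> ?\<Lambda>" using generators[OF f] by blast
      fix i j l assume nz: "coeff3 (coord p 0 f) i j l \<noteq> 0"
      have "i \<noteq> 0"
      proof
        assume i: "i = 0"
        have jl: "j + l = d" "coeff (coeff ?g j) 0 \<noteq> 0" using coeff_local_equation[OF form[OF f] nz] nz i by simp_all
        have "l \<le> 2" using nz coeff_\<theta>_high[OF f, of l] unfolding \<theta>_def coeff_coord_eq_0_iff[of p \<nu>] by (metis coeff_0 not_le)
        then have je: "j = d - 2 + (2 - l)" using jl(1) d4 by simp
        obtain g' where g': "chart_pullback None ?g = V2 ^ (d - 2) * g'" "\<And>e. coeff g' e = hom_part_v (d - 2 + e) ?g"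
          using chart_pullback_None[OF virt_mult_origin_coeff[OF gm, unfolded v]] by blast
        have "g' \<in> blowup_system t ?\<Lambda>" 
          using g'(1) unfolding None by (intro blowup_systemI[OF gm]) (simp only: v exceptional.simps)
        then have "coeff (coeff g' (2 - l)) 0 = 0" using virt_mult_origin_coeff v3[of "2 - l"] vt by fastforce
        then show False using jl(2) unfolding g'(2) coeff_hom_part_v je by simp
      qed
      then show "X3 dvd const3 (coeff3 (coord p 0 f) i j l) * X3 ^ i * Y3 ^ j * Z3 ^ l"
        by (intro dvd_mult2 dvd_mult dvd_power) simp
    qed simp_all
    then show False using common_factor_unit not_unit_line(2) by blast
  qed
qed

text \<open>
  Multiplicities do not increase along infinitely near points, so it is enough to consider proper
  points and the points in the first neighbourhood of \<open>p\<close>.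
\<close>

lemma virt_mult_other_points_le_2:
  assumes q: "(q, ts) \<in> base_points F" and ne: "(q, ts) \<noteq> (p, [])"
  shows "virt_mult F (q, ts) \<le> 2"
proof -
  obtain g where g: "g \<in> system_at F (q, [])" "g \<noteq> 0" using nonzero_system by blast
  show ?thesis
  proof (cases "q = p")
    case False
    have le: "virt_mult F (q, ts) \<le> virt_mult F (q, [])" using virt_mult_infinitely_near_le[OF g, of ts] by simp
    then have "q \<in> B" using q False unfolding B_def base_points_def by auto
    then show ?thesis using virt_mult_other_le_2 le unfolding m_def by fastforce
  next
    case True
    then obtain t us where ts: "ts = [t] @ us" using ne by (cases ts) auto
    obtain g' where g': "g' \<in> system_at F (p, [t])" "g' \<noteq> 0"
      using virt_mult_infinitely_near_le[OF g, of "[t]"] True by auto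
    have "virt_mult F (q, ts) \<le> virt_mult F (p, [t])"
      using virt_mult_infinitely_near_le[OF g', of us] unfolding ts True by blast
    then show ?thesis using virt_mult_first_near_le_2[of t] by simp
  qed
qed

end

section \<open>Types and base ideals\<close>

text \<open>
  Each point excludes at most one value of \<open>\<nu>\<close>.
\<close>

lemma exists_frame:
  fixes p :: "'a::alg_closed_field \<times> 'a \<times> 'a"
  assumes fin: "finite Q" and p: "p \<in> proj_plane" and Q: "Q \<subseteq> proj_plane"
  shows "\<exists>\<nu>. \<forall>q\<in>Q. q \<noteq> p \<longrightarrow> fst (from_std (\<lambda>x. x) p \<nu> q) \<noteq> 0"
proof -
  let ?x = "\<lambda>q. fst (from_std (\<lambda>x. x) p 0 q)" and ?y = "\<lambda>q. fst (snd (from_std (\<lambda>x. x) p 0 q))"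
  obtain \<nu> where \<nu>: "\<nu> \<notin> (\<lambda>q. - ?x q / ?y q) ` Q"
    using ex_new_if_finite[OF infinite_UNIV_alg_closed finite_imageI[OF fin]] by blast
  have "fst (from_std (\<lambda>x. x) p \<nu> q) \<noteq> 0" if q: "q \<in> Q" "q \<noteq> p" for q
  proof
    assume z: "fst (from_std (\<lambda>x. x) p \<nu> q) = 0"
    have eq: "fst (from_std (\<lambda>x. x) p \<nu> q) = ?x q + \<nu> * ?y q" by (cases p; cases q) simp
    show False
    proof (cases "?y q = 0")
      case False
      then have "\<nu> = - ?x q / ?y q" using z eq by (simp add: field_simps eq_neg_iff_add_eq_0)
      then show False using \<nu> q(1) by blast
    next
      case True
      obtain x y s where xys: "from_std (\<lambda>x. x) p 0 q = (x, y, s)" by (metis prod_cases3)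
      then have "from_std (\<lambda>x. x) p 0 q = (0, 0, s)" using True z eq by simp
      then have qs: "q = to_std (\<lambda>x. x) p 0 (0, 0, s)" by (metis to_std_from_std)
      obtain a b c where abc: "p = (a, b, c)" by (metis prod_cases3)
      have "q = (s * a, s * b, s * c)" using qs p unfolding abc proj_plane_def by auto
      moreover from this have "s = 1" using p q(1) Q unfolding abc by (intro proj_plane_eqI[of a b c]) auto
      ultimately show False using q(2) abc by simp
    qed
  qed
  then show ?thesis by blast
qed

lemma multiset_of_ones_and_twos:
  fixes N :: "int multiset"
  assumes "\<And>x. x \<in># N \<Longrightarrow> x \<in> {1, 2}"
  shows "N = replicate_mset (count N 2) 2 + replicate_mset (count N 1) 1"
proof (rule multiset_eqI)
  fix x
  show "count N x = count (replicate_mset (count N 2) 2 + replicate_mset (count N 1) 1) x"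
    using assms[of x] by (cases "x \<in># N") (auto simp: not_in_iff)
qed

text \<open>
  The numbers of ones and twos are determined by the two equations of condition.
\<close>

lemma homaloidal_type_with_small_rest:
  fixes N :: "int multiset"
  assumes d: "d \<ge> 4" and hom: "homaloidal_type (d, {#int d - 2#} + N)" and N: "\<And>x. x \<in># N \<Longrightarrow> x \<in> {1, 2}"
  shows "N = replicate_mset (d - 2) 2 + replicate_mset 3 1"
proof -
  define a b where "a = count N 2" and "b = count N 1"
  have Neq: "N = replicate_mset a 2 + replicate_mset b 1"
    unfolding a_def b_def by (rule multiset_of_ones_and_twos[OF N])
  have "(int d - 2) + (2 * int a + int b) = 3 * int d - 3"
    "(int d - 2)\<^sup>2 + (4 * int a + int b) = (int d)\<^sup>2 - 1"
    using hom unfolding Neq by (simp_all add: mult.commute)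
  then have "2 * int a + int b = 2 * int d - 1" "4 * int a + int b = 4 * int d - 5"
    by (simp_all add: power2_eq_square algebra_simps)
  then have "a = d - 2" "b = 3" using d by linarith+
  then show ?thesis using Neq by simp
qed

lemma has_type_finite:
  assumes T: "has_type F (d, M)" and M: "M \<noteq> {#}"
  shows "finite (base_points F)" "cremona_map d F"
    "M = image_mset (\<lambda>q. int (virt_mult F q)) (mset_set (base_points F))"
proof -
  show 1: "cremona_map d F" "M = image_mset (\<lambda>q. int (virt_mult F q)) (mset_set (base_points F))"
    using T unfolding has_type_def by auto
  show "finite (base_points F)"
  proof (rule ccontr)
    assume "infinite (base_points F)"
    then show False using M 1(2) by simp
  qed
qed

context cremona_system
begin

lemma virt_mult_proper_ge: "virt_mult F (q, ts) \<le> virt_mult F (q, [])"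
proof -
  obtain g where "g \<in> system_at F (q, [])" "g \<noteq> 0" using nonzero_system by blast
  from virt_mult_infinitely_near_le[OF this, of ts] show ?thesis by simp
qed

lemma cremona_frame_exists:
  assumes "d \<ge> 4" "p \<in> proj_plane" "virt_mult F (p, []) = d - 2" and fin: "finite (base_points F)"
  shows "\<exists>\<nu>. cremona_frame d f0 f1 f2 p \<nu>"
proof -
  let ?Q = "{q. (q, []) \<in> base_points F}"
  have "?Q \<subseteq> fst ` base_points F" by force
  then have "finite ?Q" using fin finite_surj by blast
  moreover have "?Q \<subseteq> proj_plane" unfolding base_points_def by auto
  ultimately obtain \<nu> where "\<forall>q\<in>?Q. q \<noteq> p \<longrightarrow> fst (from_std (\<lambda>x. x) p \<nu> q) \<noteq> 0"
    using exists_frame assms(2) by blast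
  then have "cremona_frame d f0 f1 f2 p \<nu>" using assms(1-3) by unfold_locales auto
  then show ?thesis by blast
qed

text \<open>
  By monotonicity along infinitely near points, the highest multiplicity is attained at a proper point
  \<open>p\<close>. All other multiplicities are then one or two.
\<close>

lemma type_of_submaximal_multiplicity:
  assumes d: "d \<ge> 4" and hom: "homaloidal_type (d, M)" and T: "has_type F (d, M)" and Max: "Max (set_mset M) = int d - 2"
  shows "M = {#int d - 2#} + replicate_mset (d - 2) 2 + replicate_mset 3 1"
proof -
  have "M \<noteq> {#}"
  proof
    assume "M = {#}"
    then show False using hom d by simp
  qed
  note h = has_type_finite[OF T this]
  have setM: "set_mset M = (\<lambda>q. int (virt_mult F q)) ` base_points F" using h(1,3) by simp
  have "Max (set_mset M) \<in> set_mset M" using \<open>M \<noteq> {#}\<close> by (intro Max_in) auto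
  then obtain p ts where p: "(p, ts) \<in> base_points F" "int (virt_mult F (p, ts)) = int d - 2"
    unfolding setM Max[unfolded setM] by force
  have pp: "p \<in> proj_plane" using p(1) unfolding base_points_def by simp
  have ge: "virt_mult F (p, ts) \<le> virt_mult F (p, [])" by (rule virt_mult_proper_ge)
  then have bp: "(p, []) \<in> base_points F" using p pp d unfolding base_points_def by simp
  then have "int (virt_mult F (p, [])) \<le> Max (set_mset M)" unfolding setM using h(1) by (intro Max_ge) auto
  then have vp: "virt_mult F (p, []) = d - 2" using ge p(2) Max by linarith
  obtain \<nu> where "cremona_frame d f0 f1 f2 p \<nu>" using cremona_frame_exists[OF d pp vp h(1)] by blast
  then interpret cremona_frame d f0 f1 f2 p \<nu> .
  define N where "N = image_mset (\<lambda>q. int (virt_mult F q)) (mset_set (base_points F - {(p, [])}))"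
  have MN: "M = {#int d - 2#} + N"
  proof -
    have "mset_set (base_points F) = add_mset (p, []) (mset_set (base_points F - {(p, [])}))"
      using bp h(1) by (simp add: mset_set.remove)
    then show ?thesis unfolding h(3) N_def using vp d by simp
  qed
  have "x \<in> {1, 2}" if "x \<in># N" for x
  proof -
    obtain q us where q: "(q, us) \<in> base_points F" "(q, us) \<noteq> (p, [])" "x = int (virt_mult F (q, us))"
      using \<open>x \<in># N\<close> h(1) unfolding N_def by auto
    have "virt_mult F (q, us) \<le> 2" by (rule virt_mult_other_points_le_2[OF q(1,2)])
    moreover have "virt_mult F (q, us) > 0" using q(1) unfolding base_points_def by simp
    ultimately show ?thesis using q(3) by auto
  qed
  then have "N = replicate_mset (d - 2) 2 + replicate_mset 3 1"
    using homaloidal_type_with_small_rest[OF d] hom unfolding MN by blast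
  then show ?thesis unfolding MN by (simp only: add.assoc)
qed

end

context cremona_frame
begin

lemma finite_B: "finite (base_points F) \<Longrightarrow> finite B"
proof -
  have "B \<subseteq> fst ` base_points F" unfolding B_def by force
  then show "finite (base_points F) \<Longrightarrow> finite B" using finite_surj by blast
qed

lemma quadratic_cremona_in_frame:
  assumes fin: "finite (base_points F)" and m: "\<And>q. q \<in> B \<Longrightarrow> m q \<in> {1, 2}"
    and msum: "(\<Sum>q\<in>B. 2 * m q - 1) = 3 * d - 3"
  shows "\<exists>e Gx Gz h. quadratic_cremona d (\<theta> f0) (\<theta> f1) (\<theta> f2) B \<tau> \<sigma> m e Gx Gz h"
proof -
  obtain e Gx Gz h where G: "is_form e Gx" "is_form e Gz" "h \<noteq> 0"
    "subst3 const3 Gx (\<theta> f0) (\<theta> f1) (\<theta> f2) = h * X3" "subst3 const3 Gz (\<theta> f0) (\<theta> f1) (\<theta> f2) = h * Z3"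
    using inverse_in_frame by blast
  have im: "g \<in> {\<theta> f0, \<theta> f1, \<theta> f2} \<longleftrightarrow> (\<exists>f\<in>{f0, f1, f2}. g = \<theta> f)" for g by blast
  have "quadratic_cremona d (\<theta> f0) (\<theta> f1) (\<theta> f2) B \<tau> \<sigma> m e Gx Gz h"
  proof
    show "d \<ge> 2" using d4 by simp
    show "is_form d g" if "g \<in> {\<theta> f0, \<theta> f1, \<theta> f2}" for g using that form_\<theta> unfolding im by blast
    show "Polynomial.degree g \<le> 2" if "g \<in> {\<theta> f0, \<theta> f1, \<theta> f2}" for g using that degree_\<theta> unfolding im by blast
    show "\<exists>g\<in>{\<theta> f0, \<theta> f1, \<theta> f2}. coeff g 2 \<noteq> 0" using quadratic_\<theta> by blast
    show "finite B" by (rule finite_B[OF fin])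
    show "q = q'" if "q \<in> B" "q' \<in> B" "\<tau> q = \<tau> q'" "\<sigma> q = \<sigma> q'" for q q' using coords_injective that by blast
    show "m q \<in> {1, 2}" if "q \<in> B" for q using m that .
    show "[:ell (\<tau> q):] ^ m q dvd pcompose g [:[:[:0, \<sigma> q:]:], ell (\<tau> q):]"
      if "q \<in> B" "g \<in> {\<theta> f0, \<theta> f1, \<theta> f2}" for q g using that order_\<theta> unfolding im by blast
    show "[:- \<sigma> q, 1:] ^ m q dvd slice 1 (\<tau> q) g"
      if "q \<in> B" "g \<in> {\<theta> f0, \<theta> f1, \<theta> f2}" for q g using that order_slice_\<theta> unfolding im by blast
    show "\<exists>q\<in>B. y = \<tau> q * x"
      if "x \<noteq> 0" "\<And>g. g \<in> {\<theta> f0, \<theta> f1, \<theta> f2} \<Longrightarrow> poly (slice x y g) z = 0" for x y z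
      by (rule base_point_of_common_zero[OF that(1)]) (use that(2) im in blast)
    show "\<exists>g\<in>{\<theta> f0, \<theta> f1, \<theta> f2}. slice 1 t g \<noteq> 0" for t using no_common_line[of t p \<nu>] unfolding \<theta>_def by blast
  qed (use msum G in simp_all)
  then show ?thesis by blast
qed

lemma ideal_base_ideal: "ideal (base_ideal F) poly3_ring"
  unfolding base_ideal_def by (rule genideal_type_ring_ideal)

text \<open>
  The conclusions about the generators in the frame are carried back by the inverse change of
  coordinates \<open>\<eta>\<close>. The line \<open>z = \<mu> x\<close> of the frame contains no base point.
\<close>

theorem cohen_macaulay_base_ideal:
  assumes fin: "finite (base_points F)" and m: "\<And>q. q \<in> B \<Longrightarrow> m q \<in> {1, 2}"
    and msum: "(\<Sum>q\<in>B. 2 * m q - 1) = 3 * d - 3"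
  shows "cohen_macaulay (poly3_ring Quot base_ideal F)"
proof -
  obtain e Gx Gz h where "quadratic_cremona d (\<theta> f0) (\<theta> f1) (\<theta> f2) B \<tau> \<sigma> m e Gx Gz h"
    using quadratic_cremona_in_frame[OF assms] by blast
  then interpret qc: quadratic_cremona d "\<theta> f0" "\<theta> f1" "\<theta> f2" B \<tau> \<sigma> m e Gx Gz h .
  define \<eta> where "\<eta> = uncoord p \<nu>"
  have m\<theta>: "ring_morph \<theta>" and m\<eta>: "ring_morph \<eta>" unfolding \<theta>_def \<eta>_def by (rule ring_morph_coord ring_morph_uncoord)+
  have \<theta>\<eta>: "\<theta> (\<eta> r) = r" and \<eta>\<theta>: "\<eta> (\<theta> r) = r" for r
    unfolding \<theta>_def \<eta>_def by (rule coord_uncoord uncoord_coord)+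
  have \<theta>c: "\<theta> (const3 k) = const3 k" and \<eta>c: "\<eta> (const3 k) = const3 k" for k
    unfolding \<theta>_def \<eta>_def by (rule coord_const3 uncoord_const3)+
  note Ia = ideal_base_ideal[unfolded ideal_type_ring_iff] and Ig = qc.ideal_Ig[unfolded ideal_type_ring_iff]
  have mem: "r \<in> base_ideal F \<longleftrightarrow> \<theta> r \<in> qc.Ig" for r
  proof
    have "ideal {r. \<theta> r \<in> qc.Ig} poly3_ring"
      unfolding ideal_type_ring_iff using Ig by (simp add: ring_morph_simps[OF m\<theta>])
    moreover have "linear_system F \<subseteq> {r. \<theta> r \<in> qc.Ig}"
    proof
      fix f assume "f \<in> linear_system F"
      then obtain a b c where "f = const3 a * f0 + const3 b * f1 + const3 c * f2" by auto
      then have "\<theta> f = const3 a * \<theta> f0 + const3 b * \<theta> f1 + const3 c * \<theta> f2"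
        by (simp only: ring_morph_simps[OF m\<theta>] \<theta>c)
      then show "f \<in> {r. \<theta> r \<in> qc.Ig}" unfolding qc.Ig_def by blast
    qed
    ultimately have "base_ideal F \<subseteq> {r. \<theta> r \<in> qc.Ig}" unfolding base_ideal_def by (rule genideal_type_ring_least)
    then show "r \<in> base_ideal F \<Longrightarrow> \<theta> r \<in> qc.Ig" by blast
    assume "\<theta> r \<in> qc.Ig"
    then obtain a b c where abc: "\<theta> r = a * \<theta> f0 + b * \<theta> f1 + c * \<theta> f2" unfolding qc.Ig_def by blast
    have "r = \<eta> (\<theta> r)" by (simp only: \<eta>\<theta>)
    also have "\<dots> = \<eta> a * f0 + \<eta> b * f1 + \<eta> c * f2" unfolding abc by (simp only: ring_morph_simps[OF m\<eta>] \<eta>\<theta>)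
    finally have r: "r = \<eta> a * f0 + \<eta> b * f1 + \<eta> c * f2" .
    have "f \<in> base_ideal F" if "f \<in> {f0, f1, f2}" for f
      using generators[OF that] genideal_type_ring_superset[of "linear_system F"] unfolding base_ideal_def by blast
    then show "r \<in> base_ideal F" unfolding r using Ia by blast
  qed
  obtain \<mu> where \<mu>: "\<mu> \<notin> \<sigma> ` B"
    using ex_new_if_finite[OF infinite_UNIV_alg_closed finite_imageI[OF finite_B[OF fin]]] by blast
  show ?thesis
  proof (rule cohen_macaulay_quotient[where \<kappa> = const3 and u = "\<eta> (Z3 - const3 \<mu> * X3)"])
    show "ring_morph const3" by (rule ring_morph_const3)
    show "noetherian_ring poly3_ring" by (intro Hilbert_basis noetherian_field)
    show "ideal (base_ideal F) poly3_ring" by (rule ideal_base_ideal)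
    show "r \<in> base_ideal F" if "(\<eta> (Z3 - const3 \<mu> * X3) - const3 a) * r \<in> base_ideal F" for a r
    proof -
      have "(Z3 - const3 \<mu> * X3 - const3 a) * \<theta> r \<in> qc.Ig"
        using that unfolding mem by (simp only: ring_morph_mult[OF m\<theta>] ring_morph_diff[OF m\<theta>] \<theta>\<eta> \<theta>c)
      moreover have "Z3 - const3 \<mu> * X3 - const3 a = [:- [:[:a, \<mu>:]:], 1:]"
        by (simp add: Z3_def X3_def const3_def)
      ultimately have lin: "[:- [:[:a, \<mu>:]:], 1:] * \<theta> r \<in> qc.Ig" by simp
      have nz: "poly ([:[:0, \<sigma> q:]:] - [:[:a, \<mu>:]:]) [:0, \<tau> q:] \<noteq> 0" if "q \<in> B" for q
        using \<mu> that by auto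
      show ?thesis unfolding mem by (rule qc.linear_nonzerodivisor[OF nz lin])
    qed
    fix Q assume Q: "primeideal Q poly3_ring" and IQ: "base_ideal F \<subseteq> Q"
    have "primeideal {r. \<eta> r \<in> Q} poly3_ring"
      using Q unfolding primeideal_type_ring_iff ideal_type_ring_iff by (simp add: ring_morph_simps[OF m\<eta>])
    moreover have "qc.Ig \<subseteq> {r. \<eta> r \<in> Q}"
    proof
      fix r assume "r \<in> qc.Ig"
      then have "\<eta> r \<in> base_ideal F" unfolding mem \<theta>\<eta> .
      then show "r \<in> {r. \<eta> r \<in> Q}" using IQ by blast
    qed
    ultimately obtain w where w: "\<And>r. \<exists>p. r - poly (map_poly const3 p) w \<in> {r. \<eta> r \<in> Q}"
      using qc.curve_over_Ig by blast
    have ev: "\<eta> (poly (map_poly const3 p) w) = poly (map_poly const3 p) (\<eta> w)" for p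
    proof (rule morph_eq_poly[of "\<lambda>p. \<eta> (poly (map_poly const3 p) w)"])
      show "ring_morph (\<lambda>p. \<eta> (poly (map_poly const3 p) w))" "ring_morph (\<lambda>p. poly (map_poly const3 p) (\<eta> w))"
        by (intro ring_morph_comp[OF m\<eta>] ring_morph_eval ring_morph_const3)+
    qed (simp_all only: poly_map_poly_const[OF ring_morph_const3] poly_map_poly_var[OF ring_morph_const3] \<eta>c)
    have "\<exists>p. r - poly (map_poly const3 p) (\<eta> w) \<in> Q" for r
    proof -
      obtain p where "\<eta> (\<theta> r - poly (map_poly const3 p) w) \<in> Q" using w[of "\<theta> r"] by blast
      then show ?thesis unfolding ring_morph_diff[OF m\<eta>] \<eta>\<theta> ev by blast
    qed
    then show "\<exists>w. \<forall>r. \<exists>p. r - poly (map_poly const3 p) w \<in> Q" by blast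
  qed
qed

end

theorem proposition3p1:
  "(\<forall>d M. d \<ge> 4 \<and> proper_homaloidal_type TYPE('a::alg_closed_field) (d, M)
        \<and> Max (set_mset M) = int d - 2 \<longrightarrow>
      M = {#int d - 2#} + replicate_mset (d - 2) 2 + replicate_mset 3 1) \<and>
   (\<forall>d (F :: 'a triple). d \<ge> 4 \<and> cremona_map d F
        \<and> has_type F (d, {#int d - 2#} + replicate_mset (d - 2) 2 + replicate_mset 3 1)
        \<and> has_proper_base_points F \<longrightarrow>
      cohen_macaulay (poly3_ring Quot base_ideal F))"
proof (intro conjI allI impI; elim conjE)
  fix d M
  assume d: "d \<ge> 4" and T: "proper_homaloidal_type TYPE('a) (d, M)" and Max: "Max (set_mset M) = int d - 2"
  obtain F :: "'a triple" where hom: "homaloidal_type (d, M)" and F: "has_type F (d, M)"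
    using T unfolding proper_homaloidal_type_def by blast
  obtain f0 f1 f2 where f: "F = (f0, f1, f2)" by (metis prod_cases3)
  have "cremona_map d (f0, f1, f2)" using F unfolding f has_type_def by auto
  then interpret cremona_system d f0 f1 f2 by unfold_locales
  show "M = {#int d - 2#} + replicate_mset (d - 2) 2 + replicate_mset 3 1"
    by (rule type_of_submaximal_multiplicity[OF d hom F[unfolded f] Max])
next
  fix d and F :: "'a triple"
  let ?N = "replicate_mset (d - 2) 2 + replicate_mset 3 1 :: int multiset"
  assume d: "d \<ge> 4" and cr: "cremona_map d F" and pr: "has_proper_base_points F"
    and "has_type F (d, {#int d - 2#} + replicate_mset (d - 2) 2 + replicate_mset 3 1)"
  then have T: "has_type F (d, {#int d - 2#} + ?N)" by (simp only: add.assoc)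
  obtain f0 f1 f2 where f: "F = (f0, f1, f2)" by (metis prod_cases3)
  interpret cremona_system d f0 f1 f2 using cr unfolding f by unfold_locales
  have "{#int d - 2#} + ?N \<noteq> {#}" by simp
  note h = has_type_finite[OF T this]
  let ?v = "\<lambda>q. int (virt_mult F q)"
  have "int d - 2 \<in># image_mset ?v (mset_set (base_points F))" unfolding h(3)[symmetric] by simp
  then obtain p ts where p0: "(p, ts) \<in> base_points F" "?v (p, ts) = int d - 2" using h(1) by auto
  have ts: "ts = []" using p0(1) pr unfolding has_proper_base_points_def by blast
  have p: "(p, []) \<in> base_points F" "virt_mult F (p, []) = d - 2" using p0 d unfolding ts by simp_all
  have pp: "p \<in> proj_plane" using p(1) unfolding base_points_def by simp
  obtain \<nu> where "cremona_frame d f0 f1 f2 p \<nu>"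
    using cremona_frame_exists[OF d pp p(2)[unfolded f] h(1)[unfolded f]] by blast
  then interpret fr: cremona_frame d f0 f1 f2 p \<nu> .
  have rest: "base_points F - {(p, [])} = (\<lambda>q. (q, [])) ` fr.B"
    using pr unfolding has_proper_base_points_def fr.B_def f by auto
  have inj: "inj_on (\<lambda>q. (q, [])) fr.B" by (simp add: inj_on_def)
  have "mset_set (base_points F) = add_mset (p, []) (mset_set (base_points F - {(p, [])}))"
    using p(1) h(1) by (simp add: mset_set.remove)
  then have "{#int d - 2#} + ?N = add_mset (int d - 2) (image_mset ?v (mset_set (base_points F - {(p, [])})))"
    unfolding h(3) using p(2) d by simp
  then have "?N = image_mset ?v (mset_set (base_points F - {(p, [])}))" by simp
  also have "mset_set (base_points F - {(p, [])}) = image_mset (\<lambda>q. (q, [])) (mset_set fr.B)"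
    unfolding rest by (rule image_mset_mset_set[OF inj, symmetric])
  finally have N: "?N = image_mset (\<lambda>q. int (fr.m q)) (mset_set fr.B)"
    by (simp add: image_mset.compositionality comp_def fr.m_def f)
  have finB: "finite fr.B" using fr.finite_B h(1) f by blast
  have m: "fr.m q \<in> {1, 2}" if "q \<in> fr.B" for q
  proof -
    have "int (fr.m q) \<in># ?N" unfolding N using that finB by simp
    then show ?thesis by (auto simp: in_replicate_mset split: if_splits)
  qed
  have "(\<Sum>q\<in>fr.B. 2 * fr.m q - 1) = 3 * d - 3"
  proof -
    have "int (\<Sum>q\<in>fr.B. 2 * fr.m q - 1) = (\<Sum>q\<in>fr.B. 2 * int (fr.m q) - 1)"
      unfolding of_nat_sum
    proof (rule sum.cong[OF refl])
      fix q assume "q \<in> fr.B"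
      then show "int (2 * fr.m q - 1) = 2 * int (fr.m q) - 1" using m[of q] by auto
    qed
    also have "\<dots> = (\<Sum>x\<in>#image_mset (\<lambda>q. int (fr.m q)) (mset_set fr.B). 2 * x - 1)"
      by (simp add: image_mset.compositionality comp_def sum_unfold_sum_mset)
    also have "\<dots> = 3 * int d - 3" unfolding N[symmetric] using d by (simp add: of_nat_diff)
    finally show ?thesis using d by linarith
  qed
  then show "cohen_macaulay (poly3_ring Quot base_ideal F)"
    unfolding f using fr.cohen_macaulay_base_ideal h(1)[unfolded f] m by blast
qed

end
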